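(* Let $F:M_1\to M_2$ be a semi-invariant Riemannian submersion from a Kähler manifold $(M_1,g_1,J)$ onto a Riemannian manifold $(M_2,g_2)$. Then $F$ is a totally geodesic map if and only if the following two conditions hold for all $X,Y\in\Gamma(\ker F_* )$ and all $Z\in\Gamma((\ker F_* )^\perp)$: (a) $\hat{\nabla}_X\phi Y+\mathcal{T}_X\omega Y$ and $\hat{\nabla}_X\mathcal{B}Z+\mathcal{T}_X\mathcal{C}Z$ belong to $\mathcal{D}_1$; (b) $\mathcal{H}\nabla^{1}_X\omega Y+\mathcal{T}_X\phi Y$ and $\mathcal{T}_X\mathcal{B}Z+\mathcal{H}\nabla^{1}_X\mathcal{C}Z$ belong to $J\mathcal{D}_2$.
   Context: A Riemannian submersion $F:(M_1,g_1)\to(M_2,g_2)$ (with $\dim M_1>\dim M_2$) is a smooth surjective map of maximal rank whose differential $F_*$ preserves the lengths of horizontal vectors, i.e. vectors orthogonal to $\ker F_*$. $\mathcal{V}$ and $\mathcal{H}$ denote the orthogonal projections of $TM_1$ onto $\ker F_*$ (vertical) and $(\ker F_* )^\perp$ (horizontal), and $\nabla^1$ is the Levi-Civita connection of $g_1$. $\Gamma(\cdot)$ denotes smooth sections. An almost Hermitian manifold $(M_1,g_1,J)$ satisfies $J^2=-I$ and $g_1(X,Y)=g_1(JX,JY)$; it is Kähler if $(\nabla^1_XJ)Y=0$ for all $X,Y$. A Riemannian submersion $F$ from an almost Hermitian manifold $(M_1,g_1,J)$ onto a Riemannian manifold $(M_2,g_2)$ is called semi-invariant if there is a distribution $\mathcal{D}_1\subseteq\ker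 F_*$ such that $\ker F_*=\mathcal{D}_1\oplus\mathcal{D}_2$, $J(\mathcal{D}_1)=\mathcal{D}_1$ and $J(\mathcal{D}_2)\subseteq(\ker F_* )^\perp$, where $\mathcal{D}_2$ is the orthogonal complement of $\mathcal{D}_1$ in $\ker F_*$. Let $\mu$ be the orthogonal complement of $J\mathcal{D}_2$ in $(\ker F_* )^\perp$. For $V\in\Gamma(\ker F_* )$ write $JV=\phi V+\omega V$ with $\phi V\in\Gamma(\mathcal{D}_1)$, $\omega V\in\Gamma(J\mathcal{D}_2)$. For $X\in\Gamma((\ker F_* )^\perp)$ write $JX=\mathcal{B}X+\mathcal{C}X$ with $\mathcal{B}X\in\Gamma(\mathcal{D}_2)$, $\mathcal{C}X\in\Gamma(\mu)$. O'Neill's tensor $\mathcal{T}$ is $\mathcal{T}_EG=\mathcal{H}\nabla^1_{\mathcal{V}E}\mathcal{V}G+\mathcal{V}\nabla^1_{\mathcal{V}E}\mathcal{H}G$ for vector fields $E,G$ on $M_1$, and $\hat\nabla_VW=\mathcal{V}\nabla^1_VW$ for $V,W\in\Gamma(\ker F_* )$. The second fundamental form of $F$ is $(\nabla F_* )(X,Y)=\nabla^F_XF_*(Y)-F_*(\nabla^1_XY)$, where $\nabla^F$ is the pullback connection on $F^{-1}TM_2$. $F$ is a totally geodesic map if $(\nabla F_* )(X,Y)=0$ for all $X,Y\in\Gamma(TM_1)$.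
   Formalization: The conditions on Z are required only for basic Z (horizontal and F-related to a vector field on M_2), not all Z in Γ((ker F_* )^⊥); for arbitrary horizontal Z the claim fails, e.g. for the flat projection C^2→C with Z = x∂_u, X = ∂_x. *)

theory Defs
  imports "HOL-Analysis.Analysis" "HOL-Library.Function_Algebras"
begin

section \<open>Pointwise vector space structure on functions\<close>

instantiation "fun" :: (type, scaleR) scaleR
begin

definition scaleR_fun_def: "r *\<^sub>R f = (\<lambda>x. r *\<^sub>R f x)"

instance ..

end

instance "fun" :: (type, real_vector) real_vector
  by standard (simp_all add: scaleR_fun_def fun_eq_iff scaleR_add_right scaleR_add_left)


section \<open>Smooth manifolds, tangent vectors, vector fields\<close>

text \<open>
  For an open subset of a finite-dimensional space, continuous directional derivatives in all
  directions are equivalent to a continuous Frechet derivative, so this is the usual notion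
  of a map of class $C^k$.
\<close>

primrec Ck_on :: "nat \<Rightarrow> 'e::real_normed_vector set \<Rightarrow> ('e \<Rightarrow> 'f::real_normed_vector) \<Rightarrow> bool" where
  "Ck_on 0 S f \<longleftrightarrow> continuous_on S f"
| "Ck_on (Suc k) S f \<longleftrightarrow>
     (\<forall>x\<in>S. f differentiable (at x)) \<and> (\<forall>v. Ck_on k S (\<lambda>x. frechet_derivative f (at x) v))"

definition smooth_on :: "'e::real_normed_vector set \<Rightarrow> ('e \<Rightarrow> 'f::real_normed_vector) \<Rightarrow> bool" where
  "smooth_on S f \<longleftrightarrow> (\<forall>k. Ck_on k S f)"

text \<open>
  A manifold is a Hausdorff, second countable type \<open>'m\<close> with a smooth atlas of charts \<open>(U, \<phi>)\<close>,
  \<open>U\<close> being the domain of \<open>\<phi>\<close>; values of \<open>\<phi>\<close> outside \<open>U\<close> are irrelevant. The atlas need not be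
  maximal. The model space \<open>'e\<close> is a finite-dimensional inner product space; the class
  \<open>euclidean_space\<close> is not used because it excludes dimension \<open>0\<close>, and a Riemannian submersion
  onto a point is allowed. (For an inner product space \<open>heine_borel\<close> already entails finite
  dimension; the first conjunct of \<open>smooth_atlas\<close> records it explicitly.)
\<close>

type_synonym ('m, 'e) atlas = "('m set \<times> ('m \<Rightarrow> 'e)) set"

definition smooth_atlas ::
  "('m::{t2_space,second_countable_topology}, 'e::{real_inner,heine_borel}) atlas \<Rightarrow> bool" where
  "smooth_atlas A \<longleftrightarrow>
     (\<exists>B::'e set. finite B \<and> span B = UNIV) \<and>
     (\<Union>(U, \<phi>)\<in>A. U) = UNIV \<and>
     (\<forall>(U, \<phi>)\<in>A. open U \<and> open (\<phi> ` U) \<and> homeomorphism U (\<phi> ` U) \<phi> (inv_into U \<phi>)) \<and>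
     (\<forall>(U, \<phi>)\<in>A. \<forall>(V, \<psi>)\<in>A. smooth_on (\<phi> ` (U \<inter> V)) (\<psi> \<circ> inv_into U \<phi>))"

definition manifold_dim :: "('m, 'e::real_vector) atlas \<Rightarrow> nat" where
  "manifold_dim A = dim (UNIV :: 'e set)"

definition smooth_fun :: "('m, 'e::real_normed_vector) atlas \<Rightarrow> ('m \<Rightarrow> real) \<Rightarrow> bool" where
  "smooth_fun A f \<longleftrightarrow> (\<forall>(U, \<phi>)\<in>A. smooth_on (\<phi> ` U) (f \<circ> inv_into U \<phi>))"

definition smooth_map ::
  "('m::topological_space, 'e::real_normed_vector) atlas \<Rightarrow>
   ('n::topological_space, 'd::real_normed_vector) atlas \<Rightarrow> ('m \<Rightarrow> 'n) \<Rightarrow> bool" where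
  "smooth_map A B F \<longleftrightarrow> continuous_on UNIV F \<and>
     (\<forall>(U, \<phi>)\<in>A. \<forall>(V, \<psi>)\<in>B. smooth_on (\<phi> ` (U \<inter> F -` V)) (\<psi> \<circ> F \<circ> inv_into U \<phi>))"

text \<open>
  A tangent vector at \<open>p\<close> is an operator \<open>f \<mapsto> D(f \<circ> \<phi>\<inverse>)(\<phi> p) u\<close> on smooth functions, with \<open>\<phi>\<close> a
  chart around \<open>p\<close> and \<open>u\<close> a coordinate vector. It is set to \<open>0\<close> on non-smooth functions,
  so that equality of tangent vectors is equality of functions.
\<close>

type_synonym 'm tvec = "('m \<Rightarrow> real) \<Rightarrow> real"

definition coord_vec ::
  "('m, 'e::real_normed_vector) atlas \<Rightarrow> 'm set \<times> ('m \<Rightarrow> 'e) \<Rightarrow> 'm \<Rightarrow> 'e \<Rightarrow> 'm tvec" where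
  "coord_vec A c p u = (\<lambda>f. if smooth_fun A f
     then frechet_derivative (f \<circ> inv_into (fst c) (snd c)) (at (snd c p)) u else 0)"

definition tangent_space :: "('m, 'e::real_normed_vector) atlas \<Rightarrow> 'm \<Rightarrow> 'm tvec set" where
  "tangent_space A p = {coord_vec A c p u | c u. c \<in> A \<and> p \<in> fst c}"

definition vector_fields :: "('m, 'e::real_normed_vector) atlas \<Rightarrow> ('m \<Rightarrow> 'm tvec) set" where
  "vector_fields A = {X. (\<forall>p. X p \<in> tangent_space A p) \<and>
                         (\<forall>f. smooth_fun A f \<longrightarrow> smooth_fun A (\<lambda>p. X p f))}"

text \<open>On non-smooth \<open>f\<close> the bracket vanishes, by the convention on tangent vectors.\<close>

definition lie_bracket ::
  "('m \<Rightarrow> 'm tvec) \<Rightarrow> ('m \<Rightarrow> 'm tvec) \<Rightarrow> ('m \<Rightarrow> 'm tvec)" where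
  "lie_bracket X Y = (\<lambda>p f. X p (\<lambda>q. Y q f) - Y p (\<lambda>q. X q f))"

text \<open>A smooth distribution of constant rank: locally spanned by smooth vector fields.\<close>

definition distribution ::
  "('m::topological_space, 'e::real_normed_vector) atlas \<Rightarrow> ('m \<Rightarrow> 'm tvec set) \<Rightarrow> bool" where
  "distribution A D \<longleftrightarrow>
     (\<forall>p. subspace (D p) \<and> D p \<subseteq> tangent_space A p) \<and>
     (\<exists>k. \<forall>p. dim (D p) = k) \<and>
     (\<forall>p. \<exists>U Xs. open U \<and> p \<in> U \<and> finite Xs \<and> Xs \<subseteq> vector_fields A \<and>
            (\<forall>q\<in>U. D q = span ((\<lambda>X. X q) ` Xs)))"

definition sections_of ::
  "('m, 'e::real_normed_vector) atlas \<Rightarrow> ('m \<Rightarrow> 'm tvec set) \<Rightarrow> ('m \<Rightarrow> 'm tvec) set" where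
  "sections_of A D = {X \<in> vector_fields A. \<forall>p. X p \<in> D p}"

definition differential ::
  "('n, 'd::real_normed_vector) atlas \<Rightarrow> ('m \<Rightarrow> 'n) \<Rightarrow> 'm tvec \<Rightarrow> 'n tvec" where
  "differential B F v = (\<lambda>f. if smooth_fun B f then v (f \<circ> F) else 0)"

text \<open>Smooth sections of the pullback bundle \<open>F\<inverse>TN\<close>.\<close>

definition sections_along ::
  "('m, 'e::real_normed_vector) atlas \<Rightarrow> ('n, 'd::real_normed_vector) atlas \<Rightarrow> ('m \<Rightarrow> 'n) \<Rightarrow>
   ('m \<Rightarrow> 'n tvec) set" where
  "sections_along A B F = {s. (\<forall>p. s p \<in> tangent_space B (F p)) \<and>
                              (\<forall>f. smooth_fun B f \<longrightarrow> smooth_fun A (\<lambda>p. s p f))}"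


section \<open>Metrics and connections\<close>

definition riemannian_metric ::
  "('m, 'e::real_normed_vector) atlas \<Rightarrow> ('m \<Rightarrow> 'm tvec \<Rightarrow> 'm tvec \<Rightarrow> real) \<Rightarrow> bool" where
  "riemannian_metric A g \<longleftrightarrow>
     (\<forall>p. \<forall>u\<in>tangent_space A p. \<forall>v\<in>tangent_space A p. \<forall>w\<in>tangent_space A p. \<forall>c.
        g p (u + v) w = g p u w + g p v w \<and> g p (c *\<^sub>R u) w = c * g p u w \<and> g p u v = g p v u) \<and>
     (\<forall>p. \<forall>u\<in>tangent_space A p. u \<noteq> 0 \<longrightarrow> g p u u > 0) \<and>
     (\<forall>X\<in>vector_fields A. \<forall>Y\<in>vector_fields A. smooth_fun A (\<lambda>p. g p (X p) (Y p)))"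

text \<open>
  A connection on a vector bundle with module of smooth sections \<open>\<Gamma>\<close>; \<open>nab X s\<close> is the covariant
  derivative of \<open>s\<close> in direction \<open>X\<close>.
\<close>

definition connection_on ::
  "('m, 'e::real_normed_vector) atlas \<Rightarrow> ('m \<Rightarrow> 'v::real_vector) set \<Rightarrow>
   (('m \<Rightarrow> 'm tvec) \<Rightarrow> ('m \<Rightarrow> 'v) \<Rightarrow> ('m \<Rightarrow> 'v)) \<Rightarrow> bool" where
  "connection_on A \<Gamma> nab \<longleftrightarrow>
     (\<forall>X\<in>vector_fields A. \<forall>s\<in>\<Gamma>. nab X s \<in> \<Gamma>) \<and>
     (\<forall>X\<in>vector_fields A. \<forall>Y\<in>vector_fields A. \<forall>s\<in>\<Gamma>. nab (X + Y) s = nab X s + nab Y s) \<and>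
     (\<forall>X\<in>vector_fields A. \<forall>s\<in>\<Gamma>. \<forall>t\<in>\<Gamma>. nab X (s + t) = nab X s + nab X t) \<and>
     (\<forall>X\<in>vector_fields A. \<forall>s\<in>\<Gamma>. \<forall>f. smooth_fun A f \<longrightarrow>
        nab (\<lambda>p. f p *\<^sub>R X p) s = (\<lambda>p. f p *\<^sub>R nab X s p) \<and>
        nab X (\<lambda>p. f p *\<^sub>R s p) = (\<lambda>p. X p f *\<^sub>R s p + f p *\<^sub>R nab X s p))"

definition levi_civita ::
  "('m, 'e::real_normed_vector) atlas \<Rightarrow> ('m \<Rightarrow> 'm tvec \<Rightarrow> 'm tvec \<Rightarrow> real) \<Rightarrow>
   (('m \<Rightarrow> 'm tvec) \<Rightarrow> ('m \<Rightarrow> 'm tvec) \<Rightarrow> ('m \<Rightarrow> 'm tvec)) \<Rightarrow> bool" where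
  "levi_civita A g nab \<longleftrightarrow>
     connection_on A (vector_fields A) nab \<and>
     (\<forall>X\<in>vector_fields A. \<forall>Y\<in>vector_fields A. nab X Y - nab Y X = lie_bracket X Y) \<and>
     (\<forall>X\<in>vector_fields A. \<forall>Y\<in>vector_fields A. \<forall>Z\<in>vector_fields A. \<forall>p.
        X p (\<lambda>q. g q (Y q) (Z q)) = g p (nab X Y p) (Z p) + g p (Y p) (nab X Z p))"

text \<open>
  The pullback of \<open>nab = \<nabla>\<close> along \<open>F\<close> is the connection \<open>D\<close> on \<open>F\<inverse>TN\<close> with
  \<open>D\<^sub>X (W \<circ> F) = (\<nabla>\<^bsub>F\<^sub>*X\<^esub> W) \<circ> F\<close>. Since \<open>F\<^sub>*X\<close> is only a field along \<open>F\<close>, the right-hand side at \<open>p\<close> is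
  expressed by any vector field \<open>V\<close> on the target extending \<open>F\<^sub>*(X p)\<close>.
\<close>

definition pullback_connection ::
  "('m, 'e::real_normed_vector) atlas \<Rightarrow> ('n, 'd::real_normed_vector) atlas \<Rightarrow> ('m \<Rightarrow> 'n) \<Rightarrow>
   (('n \<Rightarrow> 'n tvec) \<Rightarrow> ('n \<Rightarrow> 'n tvec) \<Rightarrow> ('n \<Rightarrow> 'n tvec)) \<Rightarrow>
   (('m \<Rightarrow> 'm tvec) \<Rightarrow> ('m \<Rightarrow> 'n tvec) \<Rightarrow> ('m \<Rightarrow> 'n tvec)) \<Rightarrow> bool" where
  "pullback_connection A B F nab D \<longleftrightarrow>
     connection_on A (sections_along A B F) D \<and>
     (\<forall>X\<in>vector_fields A. \<forall>V\<in>vector_fields B. \<forall>W\<in>vector_fields B. \<forall>p.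
        V (F p) = differential B F (X p) \<longrightarrow> D X (W \<circ> F) p = nab V W (F p))"

definition second_fundamental_form ::
  "('n, 'd::real_normed_vector) atlas \<Rightarrow> ('m \<Rightarrow> 'n) \<Rightarrow>
   (('m \<Rightarrow> 'm tvec) \<Rightarrow> ('m \<Rightarrow> 'm tvec) \<Rightarrow> ('m \<Rightarrow> 'm tvec)) \<Rightarrow>
   (('m \<Rightarrow> 'm tvec) \<Rightarrow> ('m \<Rightarrow> 'n tvec) \<Rightarrow> ('m \<Rightarrow> 'n tvec)) \<Rightarrow>
   ('m \<Rightarrow> 'm tvec) \<Rightarrow> ('m \<Rightarrow> 'm tvec) \<Rightarrow> ('m \<Rightarrow> 'n tvec)" where
  "second_fundamental_form B F nab D X Y =
     (\<lambda>p. D X (\<lambda>q. differential B F (Y q)) p - differential B F (nab X Y p))"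

definition totally_geodesic_map ::
  "('m, 'e::real_normed_vector) atlas \<Rightarrow> ('n, 'd::real_normed_vector) atlas \<Rightarrow> ('m \<Rightarrow> 'n) \<Rightarrow>
   (('m \<Rightarrow> 'm tvec) \<Rightarrow> ('m \<Rightarrow> 'm tvec) \<Rightarrow> ('m \<Rightarrow> 'm tvec)) \<Rightarrow>
   (('m \<Rightarrow> 'm tvec) \<Rightarrow> ('m \<Rightarrow> 'n tvec) \<Rightarrow> ('m \<Rightarrow> 'n tvec)) \<Rightarrow> bool" where
  "totally_geodesic_map A B F nab D \<longleftrightarrow>
     (\<forall>X\<in>vector_fields A. \<forall>Y\<in>vector_fields A. \<forall>p. second_fundamental_form B F nab D X Y p = 0)"


section \<open>Almost Hermitian and Kaehler manifolds\<close>

definition almost_hermitian ::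
  "('m, 'e::real_normed_vector) atlas \<Rightarrow> ('m \<Rightarrow> 'm tvec \<Rightarrow> 'm tvec \<Rightarrow> real) \<Rightarrow>
   ('m \<Rightarrow> 'm tvec \<Rightarrow> 'm tvec) \<Rightarrow> bool" where
  "almost_hermitian A g J \<longleftrightarrow>
     riemannian_metric A g \<and>
     (\<forall>p. \<forall>u\<in>tangent_space A p. \<forall>v\<in>tangent_space A p. \<forall>c.
        J p u \<in> tangent_space A p \<and> J p (u + v) = J p u + J p v \<and> J p (c *\<^sub>R u) = c *\<^sub>R J p u \<and>
        J p (J p u) = - u \<and> g p u v = g p (J p u) (J p v)) \<and>
     (\<forall>X\<in>vector_fields A. (\<lambda>p. J p (X p)) \<in> vector_fields A)"

text \<open>The parallelism condition is \<open>(\<nabla>\<^sub>X J) Y = \<nabla>\<^sub>X (JY) - J (\<nabla>\<^sub>X Y) = 0\<close>.\<close>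

definition kaehler ::
  "('m, 'e::real_normed_vector) atlas \<Rightarrow> ('m \<Rightarrow> 'm tvec \<Rightarrow> 'm tvec \<Rightarrow> real) \<Rightarrow>
   (('m \<Rightarrow> 'm tvec) \<Rightarrow> ('m \<Rightarrow> 'm tvec) \<Rightarrow> ('m \<Rightarrow> 'm tvec)) \<Rightarrow>
   ('m \<Rightarrow> 'm tvec \<Rightarrow> 'm tvec) \<Rightarrow> bool" where
  "kaehler A g nab J \<longleftrightarrow>
     almost_hermitian A g J \<and> levi_civita A g nab \<and>
     (\<forall>X\<in>vector_fields A. \<forall>Y\<in>vector_fields A. \<forall>p.
        nab X (\<lambda>q. J q (Y q)) p - J p (nab X Y p) = 0)"


section \<open>Semi-invariant Riemannian submersions\<close>

definition orth_compl_in ::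
  "('v \<Rightarrow> 'v \<Rightarrow> real) \<Rightarrow> 'v set \<Rightarrow> 'v set \<Rightarrow> 'v set" where
  "orth_compl_in g V W = {v \<in> V. \<forall>w\<in>W. g v w = 0}"

text \<open>The \<open>S\<close>-component of \<open>v\<close> with respect to a direct sum decomposition \<open>S \<oplus> T\<close>.\<close>

definition component :: "'v::real_vector set \<Rightarrow> 'v set \<Rightarrow> 'v \<Rightarrow> 'v" where
  "component S T v = (THE a. a \<in> S \<and> v - a \<in> T)"

definition ker_dist ::
  "('m, 'e::real_normed_vector) atlas \<Rightarrow> ('n, 'd::real_normed_vector) atlas \<Rightarrow> ('m \<Rightarrow> 'n) \<Rightarrow>
   'm \<Rightarrow> 'm tvec set" where
  "ker_dist A B F p = {v \<in> tangent_space A p. differential B F v = 0}"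

definition hor_dist ::
  "('m, 'e::real_normed_vector) atlas \<Rightarrow> ('m \<Rightarrow> 'm tvec \<Rightarrow> 'm tvec \<Rightarrow> real) \<Rightarrow>
   ('n, 'd::real_normed_vector) atlas \<Rightarrow> ('m \<Rightarrow> 'n) \<Rightarrow> 'm \<Rightarrow> 'm tvec set" where
  "hor_dist A g B F p = orth_compl_in (g p) (tangent_space A p) (ker_dist A B F p)"

definition riemannian_submersion ::
  "('m::topological_space, 'e::real_normed_vector) atlas \<Rightarrow>
   ('m \<Rightarrow> 'm tvec \<Rightarrow> 'm tvec \<Rightarrow> real) \<Rightarrow>
   ('n::topological_space, 'd::real_normed_vector) atlas \<Rightarrow>
   ('n \<Rightarrow> 'n tvec \<Rightarrow> 'n tvec \<Rightarrow> real) \<Rightarrow> ('m \<Rightarrow> 'n) \<Rightarrow> bool" where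
  "riemannian_submersion A g B h F \<longleftrightarrow>
     manifold_dim A > manifold_dim B \<and> smooth_map A B F \<and> surj F \<and>
     (\<forall>p. differential B F ` tangent_space A p = tangent_space B (F p)) \<and>
     (\<forall>p. \<forall>u\<in>hor_dist A g B F p. sqrt (h (F p) (differential B F u) (differential B F u)) = sqrt (g p u u))"

definition vert_proj ::
  "('m, 'e::real_normed_vector) atlas \<Rightarrow> ('m \<Rightarrow> 'm tvec \<Rightarrow> 'm tvec \<Rightarrow> real) \<Rightarrow>
   ('n, 'd::real_normed_vector) atlas \<Rightarrow> ('m \<Rightarrow> 'n) \<Rightarrow> ('m \<Rightarrow> 'm tvec) \<Rightarrow> ('m \<Rightarrow> 'm tvec)" where
  "vert_proj A g B F X = (\<lambda>p. component (ker_dist A B F p) (hor_dist A g B F p) (X p))"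

definition hor_proj ::
  "('m, 'e::real_normed_vector) atlas \<Rightarrow> ('m \<Rightarrow> 'm tvec \<Rightarrow> 'm tvec \<Rightarrow> real) \<Rightarrow>
   ('n, 'd::real_normed_vector) atlas \<Rightarrow> ('m \<Rightarrow> 'n) \<Rightarrow> ('m \<Rightarrow> 'm tvec) \<Rightarrow> ('m \<Rightarrow> 'm tvec)" where
  "hor_proj A g B F X = (\<lambda>p. component (hor_dist A g B F p) (ker_dist A B F p) (X p))"

definition oneill_T ::
  "('m, 'e::real_normed_vector) atlas \<Rightarrow> ('m \<Rightarrow> 'm tvec \<Rightarrow> 'm tvec \<Rightarrow> real) \<Rightarrow>
   ('n, 'd::real_normed_vector) atlas \<Rightarrow> ('m \<Rightarrow> 'n) \<Rightarrow>
   (('m \<Rightarrow> 'm tvec) \<Rightarrow> ('m \<Rightarrow> 'm tvec) \<Rightarrow> ('m \<Rightarrow> 'm tvec)) \<Rightarrow>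
   ('m \<Rightarrow> 'm tvec) \<Rightarrow> ('m \<Rightarrow> 'm tvec) \<Rightarrow> ('m \<Rightarrow> 'm tvec)" where
  "oneill_T A g B F nab E G =
     hor_proj A g B F (nab (vert_proj A g B F E) (vert_proj A g B F G)) +
     vert_proj A g B F (nab (vert_proj A g B F E) (hor_proj A g B F G))"

definition vert_connection ::
  "('m, 'e::real_normed_vector) atlas \<Rightarrow> ('m \<Rightarrow> 'm tvec \<Rightarrow> 'm tvec \<Rightarrow> real) \<Rightarrow>
   ('n, 'd::real_normed_vector) atlas \<Rightarrow> ('m \<Rightarrow> 'n) \<Rightarrow>
   (('m \<Rightarrow> 'm tvec) \<Rightarrow> ('m \<Rightarrow> 'm tvec) \<Rightarrow> ('m \<Rightarrow> 'm tvec)) \<Rightarrow>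
   ('m \<Rightarrow> 'm tvec) \<Rightarrow> ('m \<Rightarrow> 'm tvec) \<Rightarrow> ('m \<Rightarrow> 'm tvec)" where
  "vert_connection A g B F nab V W = vert_proj A g B F (nab V W)"

definition D2_of ::
  "('m, 'e::real_normed_vector) atlas \<Rightarrow> ('m \<Rightarrow> 'm tvec \<Rightarrow> 'm tvec \<Rightarrow> real) \<Rightarrow>
   ('n, 'd::real_normed_vector) atlas \<Rightarrow> ('m \<Rightarrow> 'n) \<Rightarrow> ('m \<Rightarrow> 'm tvec set) \<Rightarrow> 'm \<Rightarrow> 'm tvec set" where
  "D2_of A g B F D1 p = orth_compl_in (g p) (ker_dist A B F p) (D1 p)"

text \<open>\<open>D1\<close> is the distribution witnessing semi-invariance.\<close>

definition semi_invariant_submersion ::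
  "('m::topological_space, 'e::real_normed_vector) atlas \<Rightarrow>
   ('m \<Rightarrow> 'm tvec \<Rightarrow> 'm tvec \<Rightarrow> real) \<Rightarrow> ('m \<Rightarrow> 'm tvec \<Rightarrow> 'm tvec) \<Rightarrow>
   ('n::topological_space, 'd::real_normed_vector) atlas \<Rightarrow>
   ('n \<Rightarrow> 'n tvec \<Rightarrow> 'n tvec \<Rightarrow> real) \<Rightarrow> ('m \<Rightarrow> 'n) \<Rightarrow> ('m \<Rightarrow> 'm tvec set) \<Rightarrow> bool" where
  "semi_invariant_submersion A g J B h F D1 \<longleftrightarrow>
     riemannian_submersion A g B h F \<and> distribution A D1 \<and>
     (\<forall>p. D1 p \<subseteq> ker_dist A B F p \<and>
          ker_dist A B F p = {u + v | u v. u \<in> D1 p \<and> v \<in> D2_of A g B F D1 p} \<and>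
          D1 p \<inter> D2_of A g B F D1 p = {0} \<and>
          J p ` D1 p = D1 p \<and>
          J p ` D2_of A g B F D1 p \<subseteq> hor_dist A g B F p)"

definition JD2_of ::
  "('m, 'e::real_normed_vector) atlas \<Rightarrow> ('m \<Rightarrow> 'm tvec \<Rightarrow> 'm tvec \<Rightarrow> real) \<Rightarrow>
   ('m \<Rightarrow> 'm tvec \<Rightarrow> 'm tvec) \<Rightarrow>
   ('n, 'd::real_normed_vector) atlas \<Rightarrow> ('m \<Rightarrow> 'n) \<Rightarrow> ('m \<Rightarrow> 'm tvec set) \<Rightarrow> 'm \<Rightarrow> 'm tvec set" where
  "JD2_of A g J B F D1 p = J p ` D2_of A g B F D1 p"

definition mu_of ::
  "('m, 'e::real_normed_vector) atlas \<Rightarrow> ('m \<Rightarrow> 'm tvec \<Rightarrow> 'm tvec \<Rightarrow> real) \<Rightarrow>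
   ('m \<Rightarrow> 'm tvec \<Rightarrow> 'm tvec) \<Rightarrow>
   ('n, 'd::real_normed_vector) atlas \<Rightarrow> ('m \<Rightarrow> 'n) \<Rightarrow> ('m \<Rightarrow> 'm tvec set) \<Rightarrow> 'm \<Rightarrow> 'm tvec set" where
  "mu_of A g J B F D1 p = orth_compl_in (g p) (hor_dist A g B F p) (JD2_of A g J B F D1 p)"

text \<open>
  \<open>JV = \<phi>V + \<omega>V\<close> along \<open>D1 \<oplus> JD2\<close> for vertical \<open>V\<close>, and \<open>JX = \<B>X + \<C>X\<close> along \<open>D2 \<oplus> \<mu>\<close> for
  horizontal \<open>X\<close>.
\<close>

definition phi_part ::
  "('m, 'e::real_normed_vector) atlas \<Rightarrow> ('m \<Rightarrow> 'm tvec \<Rightarrow> 'm tvec \<Rightarrow> real) \<Rightarrow>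
   ('m \<Rightarrow> 'm tvec \<Rightarrow> 'm tvec) \<Rightarrow>
   ('n, 'd::real_normed_vector) atlas \<Rightarrow> ('m \<Rightarrow> 'n) \<Rightarrow> ('m \<Rightarrow> 'm tvec set) \<Rightarrow>
   ('m \<Rightarrow> 'm tvec) \<Rightarrow> ('m \<Rightarrow> 'm tvec)" where
  "phi_part A g J B F D1 V = (\<lambda>p. component (D1 p) (JD2_of A g J B F D1 p) (J p (V p)))"

definition omega_part ::
  "('m, 'e::real_normed_vector) atlas \<Rightarrow> ('m \<Rightarrow> 'm tvec \<Rightarrow> 'm tvec \<Rightarrow> real) \<Rightarrow>
   ('m \<Rightarrow> 'm tvec \<Rightarrow> 'm tvec) \<Rightarrow>
   ('n, 'd::real_normed_vector) atlas \<Rightarrow> ('m \<Rightarrow> 'n) \<Rightarrow> ('m \<Rightarrow> 'm tvec set) \<Rightarrow>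
   ('m \<Rightarrow> 'm tvec) \<Rightarrow> ('m \<Rightarrow> 'm tvec)" where
  "omega_part A g J B F D1 V = (\<lambda>p. component (JD2_of A g J B F D1 p) (D1 p) (J p (V p)))"

definition B_part ::
  "('m, 'e::real_normed_vector) atlas \<Rightarrow> ('m \<Rightarrow> 'm tvec \<Rightarrow> 'm tvec \<Rightarrow> real) \<Rightarrow>
   ('m \<Rightarrow> 'm tvec \<Rightarrow> 'm tvec) \<Rightarrow>
   ('n, 'd::real_normed_vector) atlas \<Rightarrow> ('m \<Rightarrow> 'n) \<Rightarrow> ('m \<Rightarrow> 'm tvec set) \<Rightarrow>
   ('m \<Rightarrow> 'm tvec) \<Rightarrow> ('m \<Rightarrow> 'm tvec)" where
  "B_part A g J B F D1 X =
     (\<lambda>p. component (D2_of A g B F D1 p) (mu_of A g J B F D1 p) (J p (X p)))"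

definition C_part ::
  "('m, 'e::real_normed_vector) atlas \<Rightarrow> ('m \<Rightarrow> 'm tvec \<Rightarrow> 'm tvec \<Rightarrow> real) \<Rightarrow>
   ('m \<Rightarrow> 'm tvec \<Rightarrow> 'm tvec) \<Rightarrow>
   ('n, 'd::real_normed_vector) atlas \<Rightarrow> ('m \<Rightarrow> 'n) \<Rightarrow> ('m \<Rightarrow> 'm tvec set) \<Rightarrow>
   ('m \<Rightarrow> 'm tvec) \<Rightarrow> ('m \<Rightarrow> 'm tvec)" where
  "C_part A g J B F D1 X =
     (\<lambda>p. component (mu_of A g J B F D1 p) (D2_of A g B F D1 p) (J p (X p)))"

text \<open>
  Basic vector fields: horizontal and \<open>F\<close>-related to a vector field on the base. Every horizontal
  tangent vector extends to one. Statements quantified over \<open>Z \<in> \<Gamma>((ker F\<^sub>*)\<^sup>\<bottom>)\<close> that involve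
  \<open>\<H>\<nabla>\<^sub>X Z\<close> with \<open>X\<close> vertical have to be read for basic \<open>Z\<close>: by the Leibniz rule this expression is not
  tensorial in \<open>Z\<close>, and \<open>(\<nabla>F\<^sub>*)(X, Z) = - F\<^sub>*(\<nabla>\<^sub>X Z)\<close> needs \<open>\<nabla>\<^sup>F\<^sub>X F\<^sub>*Z = 0\<close>.
\<close>

definition basic_fields ::
  "('m, 'e::real_normed_vector) atlas \<Rightarrow> ('m \<Rightarrow> 'm tvec \<Rightarrow> 'm tvec \<Rightarrow> real) \<Rightarrow>
   ('n, 'd::real_normed_vector) atlas \<Rightarrow> ('m \<Rightarrow> 'n) \<Rightarrow> ('m \<Rightarrow> 'm tvec) set" where
  "basic_fields A g B F = {Z \<in> sections_of A (hor_dist A g B F).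
     \<exists>W\<in>vector_fields B. \<forall>p. differential B F (Z p) = W (F p)}"

end

theory Submission
  imports Defs
begin

text \<open>
  The criterion compares both sides with one intermediate statement: for vertical fields \<open>X\<close>, \<open>Y\<close> and
  basic fields \<open>Z\<close>, the fields \<open>\<nabla>\<^sub>X Y\<close> and \<open>\<nabla>\<^sub>X Z\<close> are vertical.

  Conditions (a) and (b) say exactly this. Since \<open>J\<close> preserves \<open>\<D>\<^sub>1\<close> and maps \<open>\<D>\<^sub>2\<close> into the horizontal
  distribution, \<open>\<phi>Y\<close> and \<open>\<omega>Y\<close> are just the vertical and the horizontal part of \<open>JY\<close>, and \<open>\<B>Z\<close> and
  \<open>\<C>Z\<close> are those of \<open>JZ\<close> (\<open>phi_omega_eq\<close>, \<open>B_C_eq\<close>). Splitting \<open>\<nabla>\<^sub>X(JG)\<close> accordingly, the sums in (a)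
  and (b) become its vertical and horizontal part (\<open>covariant_derivative_split\<close>), and
  \<open>\<nabla>\<^sub>X(JG) = J\<nabla>\<^sub>X G\<close> on a Kaehler manifold. So (a) and (b) require \<open>J\<nabla>\<^sub>X G\<close> to lie in
  \<open>\<D>\<^sub>1 \<oplus> J\<D>\<^sub>2 = J(ker F\<^sub>*)\<close>, that is, \<open>\<nabla>\<^sub>X G\<close> to be vertical (\<open>projections_of_J_iff_vertical\<close>).

  On the other side, \<open>(\<nabla>F\<^sub>*)(X, G) = - F\<^sub>*(\<nabla>\<^sub>X G)\<close> for \<open>X\<close> vertical and \<open>G\<close> vertical or basic, so a totally
  geodesic \<open>F\<close> has these derivatives vertical. Conversely, the second fundamental form is tensorial
  (\<open>sff_pointwise\<close>), and at each point every vector is the value of a vertical field plus a basic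
  field (\<open>vertical_plus_basic\<close>); the mixed values are symmetric because the bracket of a basic and a
  vertical field is vertical (\<open>dF_nabla1_commute\<close>), and for two basic fields \<open>\<nabla>F\<^sub>*\<close> vanishes for
  every Riemannian submersion (\<open>sff_basic\<close>).

  All of this needs enough smooth global fields. Cut-off functions give local frames that extend
  to the whole manifold (\<open>bump_function\<close>, \<open>local_frame\<close>), and a field is smooth once its inner
  products with all smooth fields are (\<open>smooth_if_smooth_pairings\<close>). Horizontal parts and basic
  lifts are smooth by this test, because for horizontal \<open>Z\<close> the product \<open>g\<^sub>1(Z, X)\<close> equals
  \<open>g\<^sub>2(F\<^sub>*Z, F\<^sub>*X)\<close>.
\<close>


section \<open>Calculus of $C^k$ maps\<close>

(* The recursion is used through the rules below, one for the derivative at a point and one for the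
   partial derivatives as functions. *)
declare Ck_on.simps(2) [simp del]

lemma has_derivative_cong_open:
  assumes "open S" "x \<in> S" "\<And>y. y \<in> S \<Longrightarrow> f y = g y"
  shows "(f has_derivative D) (at x) \<longleftrightarrow> (g has_derivative D) (at x)"
  using has_derivative_transform_within_open[OF _ assms(1,2), of f D UNIV g]
    has_derivative_transform_within_open[OF _ assms(1,2), of g D UNIV f] assms(3)
  by auto

lemma frechet_derivative_cong_open:
  assumes "open S" "x \<in> S" "\<And>y. y \<in> S \<Longrightarrow> f y = g y"
  shows "frechet_derivative f (at x) = frechet_derivative g (at x)"
  unfolding frechet_derivative_def using has_derivative_cong_open[OF assms] by simp

lemma Ck_on_cong:
  assumes "open S" "\<And>x. x \<in> S \<Longrightarrow> f x = g x"
  shows "Ck_on k S f \<longleftrightarrow> Ck_on k S g"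
  using assms(2)
proof (induction k arbitrary: f g)
  case 0
  then show ?case by (simp cong: continuous_on_cong)
next
  case (Suc k)
  have "f differentiable (at x) \<longleftrightarrow> g differentiable (at x)" if "x \<in> S" for x
    using has_derivative_cong_open[OF assms(1) that, of f g] Suc.prems
    by (simp add: differentiable_def)
  moreover have "Ck_on k S (\<lambda>x. frechet_derivative f (at x) v) \<longleftrightarrow>
      Ck_on k S (\<lambda>x. frechet_derivative g (at x) v)" for v
    using frechet_derivative_cong_open[OF assms(1), of _ f g] Suc.prems
    by (intro Suc.IH) auto
  ultimately show ?case by (simp add: Ck_on.simps(2))
qed

lemma Ck_on_subset: "Ck_on k S f \<Longrightarrow> T \<subseteq> S \<Longrightarrow> Ck_on k T f"
  by (induction k arbitrary: f) (auto simp: Ck_on.simps(2) intro: continuous_on_subset)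

lemma Ck_on_lower: "Ck_on (Suc k) S f \<Longrightarrow> Ck_on k S f"
proof (induction k arbitrary: f)
  case 0
  then show ?case
    by (auto intro!: differentiable_imp_continuous_on
        simp: Ck_on.simps(2) differentiable_on_def differentiable_at_withinI)
next
  case (Suc k)
  then show ?case by (metis Ck_on.simps(2))
qed

lemma Ck_on_has_derivative:
  "Ck_on (Suc k) S f \<Longrightarrow> x \<in> S \<Longrightarrow> (f has_derivative frechet_derivative f (at x)) (at x)"
  by (simp add: Ck_on.simps(2) frechet_derivative_works[symmetric])

lemma Ck_on_derivative: "Ck_on (Suc k) S f \<Longrightarrow> Ck_on k S (\<lambda>x. frechet_derivative f (at x) v)"
  by (simp add: Ck_on.simps(2))

lemma Ck_on_SucI:
  assumes "open S" "\<And>x. x \<in> S \<Longrightarrow> (f has_derivative f' x) (at x)"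
    "\<And>v. Ck_on k S (\<lambda>x. f' x v)"
  shows "Ck_on (Suc k) S f"
proof -
  have "frechet_derivative f (at x) = f' x" if "x \<in> S" for x
    using assms(2)[OF that] frechet_derivative_at by metis
  then have "Ck_on k S (\<lambda>x. frechet_derivative f (at x) v)" for v
    using assms(1,3) by (subst Ck_on_cong[where g = "\<lambda>x. f' x v"]) auto
  then show ?thesis using assms(2) by (auto simp: Ck_on.simps(2) differentiable_def)
qed

lemma Ck_on_locally:
  assumes "open S" "\<And>x. x \<in> S \<Longrightarrow> \<exists>T. open T \<and> x \<in> T \<and> Ck_on k (S \<inter> T) f"
  shows "Ck_on k S f"
  using assms(2)
proof (induction k arbitrary: f)
  case 0
  have "isCont f x" if "x \<in> S" for x
    using 0[OF that] assms(1) that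
    by (metis Ck_on.simps(1) IntI continuous_on_eq_continuous_at open_Int)
  then show ?case by (simp add: continuous_at_imp_continuous_on)
next
  case (Suc k)
  have "f differentiable (at x)" if "x \<in> S" for x
    using Suc.prems[OF that] that by (auto simp: Ck_on.simps(2))
  moreover have "Ck_on k S (\<lambda>x. frechet_derivative f (at x) v)" for v
  proof (rule Suc.IH)
    fix x assume "x \<in> S"
    then obtain T where "open T" "x \<in> T" "Ck_on (Suc k) (S \<inter> T) f" using Suc.prems by blast
    then show "\<exists>T. open T \<and> x \<in> T \<and> Ck_on k (S \<inter> T) (\<lambda>x. frechet_derivative f (at x) v)"
      using Ck_on_derivative by blast
  qed
  ultimately show ?case by (simp add: Ck_on.simps(2))
qed

lemma Ck_on_const: "open S \<Longrightarrow> Ck_on k S (\<lambda>x. c)"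
proof (induction k arbitrary: c)
  case (Suc k)
  then show ?case by (intro Ck_on_SucI[where f' = "\<lambda>x v. 0"]) auto
qed simp

lemma Ck_on_bounded_linear:
  assumes "open S" "bounded_linear L"
  shows "Ck_on k S L"
proof (cases k)
  case 0
  then show ?thesis using assms by (simp add: linear_continuous_on)
next
  case (Suc j)
  have "Ck_on (Suc j) S L"
    by (rule Ck_on_SucI[where f' = "\<lambda>x. L"])
      (rule assms bounded_linear_imp_has_derivative Ck_on_const)+
  then show ?thesis using Suc by simp
qed

lemma Ck_on_add: "open S \<Longrightarrow> Ck_on k S f \<Longrightarrow> Ck_on k S g \<Longrightarrow> Ck_on k S (\<lambda>x. f x + g x)"
proof (induction k arbitrary: f g)
  case (Suc k)
  show ?case
    by (rule Ck_on_SucI[where f' = "\<lambda>x v. frechet_derivative f (at x) v + frechet_derivative g (at x) v"])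
      (rule Suc.prems has_derivative_add Ck_on_has_derivative[OF Suc.prems(2)]
        Ck_on_has_derivative[OF Suc.prems(3)] Suc.IH Ck_on_derivative | assumption)+
qed (simp add: continuous_on_add)

lemma Ck_on_bilinear:
  assumes "bounded_bilinear pr" "open S"
  shows "Ck_on k S f \<Longrightarrow> Ck_on k S g \<Longrightarrow> Ck_on k S (\<lambda>x. pr (f x) (g x))"
proof (induction k arbitrary: f g)
  case 0
  then show ?case using bounded_bilinear.continuous_on[OF assms(1)] by auto
next
  case (Suc k)
  have lower: "Ck_on k S f" "Ck_on k S g" using Suc.prems by (auto intro: Ck_on_lower)
  show ?case
    by (rule Ck_on_SucI[where f' = "\<lambda>x v. pr (f x) (frechet_derivative g (at x) v) +
          pr (frechet_derivative f (at x) v) (g x)"])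
      (rule lower assms(2) Suc.prems bounded_bilinear.FDERIV[OF assms(1)]
        Ck_on_has_derivative[OF Suc.prems(1)] Ck_on_has_derivative[OF Suc.prems(2)]
        Ck_on_add Suc.IH Ck_on_derivative | assumption)+
qed

lemmas Ck_on_mult = Ck_on_bilinear[OF bounded_bilinear_mult]
lemmas Ck_on_scaleR = Ck_on_bilinear[OF bounded_bilinear_scaleR]
lemmas Ck_on_inner = Ck_on_bilinear[OF bounded_bilinear_inner]

lemma Ck_on_sum:
  assumes "open S" "\<And>i. i \<in> I \<Longrightarrow> Ck_on k S (f i)"
  shows "Ck_on k S (\<lambda>x. \<Sum>i\<in>I. f i x)"
  using assms(2)
  by (induction I rule: infinite_finite_induct) (auto intro: Ck_on_add Ck_on_const assms(1))

lemma Ck_on_inverse: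
  fixes f :: "'a::real_normed_vector \<Rightarrow> real"
  assumes "open S" "\<And>x. x \<in> S \<Longrightarrow> f x \<noteq> 0"
  shows "Ck_on k S f \<Longrightarrow> Ck_on k S (\<lambda>x. inverse (f x))"
proof (induction k)
  case 0
  then show ?case using assms by (auto intro: continuous_on_inverse)
next
  case (Suc k)
  have *: "Ck_on k S (\<lambda>x. inverse (f x))" using Suc by (auto intro: Ck_on_lower)
  show ?case
  proof (rule Ck_on_SucI[where f' = "\<lambda>x v. - (inverse (f x) * frechet_derivative f (at x) v * inverse (f x))"])
    fix x assume "x \<in> S"
    show "((\<lambda>x. inverse (f x)) has_derivative
        (\<lambda>v. - (inverse (f x) * frechet_derivative f (at x) v * inverse (f x)))) (at x)"
      by (rule Deriv.has_derivative_inverse[OF assms(2) Ck_on_has_derivative[OF Suc.prems]]) fact+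
  next
    fix v
    have "Ck_on k S (\<lambda>x. - 1 * (inverse (f x) * frechet_derivative f (at x) v * inverse (f x)))"
      by (intro Ck_on_mult Ck_on_const * Ck_on_derivative[OF Suc.prems] assms(1))
    then show "Ck_on k S (\<lambda>x. - (inverse (f x) * frechet_derivative f (at x) v * inverse (f x)))"
      by simp
  qed (rule assms(1))
qed

text \<open>Stated through the expansion of vectors, so that it also covers the zero space, whose basis is
  empty and which is not of class \<open>euclidean_space\<close>.\<close>

definition orthonormal_basis :: "'e::real_inner set \<Rightarrow> bool" where
  "orthonormal_basis B \<longleftrightarrow> finite B \<and> (\<forall>b\<in>B. \<forall>c\<in>B. b \<bullet> c = (if b = c then 1 else 0)) \<and>
     (\<forall>x. x = (\<Sum>b\<in>B. (x \<bullet> b) *\<^sub>R b))"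

lemma orthonormal_basis_real: "orthonormal_basis {1::real}"
  by (simp add: orthonormal_basis_def)

lemma orthonormal_basis_exists:
  assumes "finite B" "span B = (UNIV :: 'e::real_inner set)"
  shows "\<exists>C::'e set. orthonormal_basis C"
proof -
  obtain C where C: "finite C" "span C = (UNIV::'e set)" "pairwise orthogonal C"
    using basis_orthogonal[OF assms(1)] assms(2) by auto
  define N where "N = (\<lambda>b. b /\<^sub>R norm b) ` (C - {0})"
  have fin: "finite N" using C by (simp add: N_def)
  have orth: "b \<bullet> c = (if b = c then 1 else 0)" if bc: "b \<in> N" "c \<in> N" for b c
  proof -
    obtain b' c' where b': "b' \<in> C" "b' \<noteq> 0" "b = b' /\<^sub>R norm b'"
      and c': "c' \<in> C" "c' \<noteq> 0" "c = c' /\<^sub>R norm c'"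
      using bc by (auto simp: N_def)
    show ?thesis
    proof (cases "b' = c'")
      case True
      then show ?thesis using b' c' by (simp add: dot_square_norm power2_eq_square)
    next
      case False
      then have "b' \<bullet> c' = 0" using C(3) b' c' by (auto simp: pairwise_def orthogonal_def)
      then have 0: "b \<bullet> c = 0" using b' c' by simp
      moreover have "b \<bullet> b \<noteq> 0" using b' by simp
      ultimately show ?thesis by auto
    qed
  qed
  have "C \<subseteq> span N"
  proof
    fix b assume "b \<in> C"
    show "b \<in> span N"
    proof (cases "b = 0")
      case True then show ?thesis by (simp add: span_zero)
    next
      case False
      then have "b /\<^sub>R norm b \<in> span N" using \<open>b \<in> C\<close> by (auto simp: N_def intro: span_base)
      then have "norm b *\<^sub>R (b /\<^sub>R norm b) \<in> span N" by (rule span_scale)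
      then show ?thesis using False by simp
    qed
  qed
  then have spanN: "span N = UNIV" using C(2) by (metis span_minimal subspace_span top.extremum_uniqueI)
  have "x = (\<Sum>b\<in>N. (x \<bullet> b) *\<^sub>R b)" for x
  proof -
    have "x \<in> span N" using spanN by simp
    then obtain a where a: "x = (\<Sum>b\<in>N. a b *\<^sub>R b)" using fin by (auto simp: span_finite)
    have "x \<bullet> c = a c" if "c \<in> N" for c
    proof -
      have "x \<bullet> c = (\<Sum>b\<in>N. a b * (b \<bullet> c))" by (simp add: a inner_sum_left)
      also have "\<dots> = (\<Sum>b\<in>N. if b = c then a b else 0)"
        using orth that by (intro sum.cong) auto
      finally show ?thesis using that fin by simp
    qed
    then show ?thesis using a by simp
  qed
  then show ?thesis using fin orth unfolding orthonormal_basis_def by blast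
qed

text \<open>In the derivative \<open>Dg(f x)(Df(x) v)\<close> the direction depends on \<open>x\<close>. Expanding \<open>Df(x) v\<close> in a fixed
  basis leaves only derivatives of \<open>g\<close> in constant directions, to which the induction hypothesis
  applies.\<close>

lemma Ck_on_compose:
  fixes f :: "'a::real_normed_vector \<Rightarrow> 'b::real_inner" and g :: "'b \<Rightarrow> 'c::real_normed_vector"
  assumes B: "orthonormal_basis (B :: 'b set)" and "open S" "open T" "f ` S \<subseteq> T"
  shows "Ck_on k S f \<Longrightarrow> Ck_on k T g \<Longrightarrow> Ck_on k S (\<lambda>x. g (f x))"
proof (induction k arbitrary: g)
  case 0
  then show ?case using assms by (auto intro: continuous_on_compose2)
next
  case (Suc k)
  let ?f = "\<lambda>x. frechet_derivative f (at x)" and ?g = "\<lambda>y. frechet_derivative g (at y)"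
  have fd: "(f has_derivative ?f x) (at x)" if "x \<in> S" for x
    using Suc.prems(1) that by (rule Ck_on_has_derivative)
  have gd: "(g has_derivative ?g (f x)) (at (f x))" if "x \<in> S" for x
    using Suc.prems(2) assms(4) that by (intro Ck_on_has_derivative) auto
  show ?case
  proof (rule Ck_on_SucI[where f' = "\<lambda>x v. ?g (f x) (?f x v)"])
    fix x assume "x \<in> S"
    then show "((\<lambda>x. g (f x)) has_derivative (\<lambda>v. ?g (f x) (?f x v))) (at x)"
      using has_derivative_compose[OF fd gd] by auto
  next
    fix v
    have "?g (f x) (?f x v) = (\<Sum>b\<in>B. (?f x v \<bullet> b) *\<^sub>R ?g (f x) b)" if "x \<in> S" for x
    proof -
      have lin: "linear (?g (f x))" using gd[OF that] by (rule has_derivative_linear)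
      have "?f x v = (\<Sum>b\<in>B. (?f x v \<bullet> b) *\<^sub>R b)" using B unfolding orthonormal_basis_def by blast
      then have "?g (f x) (?f x v) = ?g (f x) (\<Sum>b\<in>B. (?f x v \<bullet> b) *\<^sub>R b)" by simp
      then show ?thesis by (simp add: linear_sum[OF lin] linear_cmul[OF lin])
    qed
    moreover have "Ck_on k S (\<lambda>x. \<Sum>b\<in>B. (?f x v \<bullet> b) *\<^sub>R ?g (f x) b)"
      by (intro Ck_on_sum Ck_on_scaleR Ck_on_inner Suc.IH Ck_on_const Ck_on_derivative
          Ck_on_lower[OF Suc.prems(1)] Suc.prems assms(2))
    ultimately show "Ck_on k S (\<lambda>x. ?g (f x) (?f x v))"
      using Ck_on_cong[OF assms(2), of "\<lambda>x. ?g (f x) (?f x v)"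
          "\<lambda>x. \<Sum>b\<in>B. (?f x v \<bullet> b) *\<^sub>R ?g (f x) b"] by blast
  qed (use assms(2) in auto)
qed


section \<open>Smooth maps and a smooth cut-off\<close>

lemma smooth_on_cong:
  "open S \<Longrightarrow> (\<And>x. x \<in> S \<Longrightarrow> f x = g x) \<Longrightarrow> smooth_on S f \<longleftrightarrow> smooth_on S g"
  unfolding smooth_on_def using Ck_on_cong[of S f g] by simp

lemma smooth_on_subset: "smooth_on S f \<Longrightarrow> T \<subseteq> S \<Longrightarrow> smooth_on T f"
  unfolding smooth_on_def using Ck_on_subset by blast

lemma smooth_on_const: "open S \<Longrightarrow> smooth_on S (\<lambda>x. c)"
  unfolding smooth_on_def by (simp add: Ck_on_const)

lemma smooth_on_bounded_linear: "open S \<Longrightarrow> bounded_linear L \<Longrightarrow> smooth_on S L"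
  unfolding smooth_on_def by (simp add: Ck_on_bounded_linear)

lemma smooth_on_add:
  "open S \<Longrightarrow> smooth_on S f \<Longrightarrow> smooth_on S g \<Longrightarrow> smooth_on S (\<lambda>x. f x + g x)"
  unfolding smooth_on_def by (simp add: Ck_on_add)

lemma smooth_on_mult:
  fixes f g :: "'a::real_normed_vector \<Rightarrow> real"
  shows "open S \<Longrightarrow> smooth_on S f \<Longrightarrow> smooth_on S g \<Longrightarrow> smooth_on S (\<lambda>x. f x * g x)"
  unfolding smooth_on_def by (simp add: Ck_on_mult)

lemma smooth_on_inverse:
  fixes f :: "'a::real_normed_vector \<Rightarrow> real"
  shows "open S \<Longrightarrow> (\<And>x. x \<in> S \<Longrightarrow> f x \<noteq> 0) \<Longrightarrow> smooth_on S f \<Longrightarrow> smooth_on S (\<lambda>x. inverse (f x))"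
  unfolding smooth_on_def by (simp add: Ck_on_inverse)

lemma smooth_on_compose:
  assumes "orthonormal_basis (B :: 'b::real_inner set)" "open S" "open T" "f ` S \<subseteq> T"
    "smooth_on S f" "smooth_on T g"
  shows "smooth_on S (\<lambda>x. g (f x :: 'b))"
  using assms unfolding smooth_on_def by (auto intro: Ck_on_compose)

lemma smooth_on_locally:
  assumes "open S" "\<And>x. x \<in> S \<Longrightarrow> \<exists>T. open T \<and> x \<in> T \<and> smooth_on (S \<inter> T) f"
  shows "smooth_on S f"
  unfolding smooth_on_def
proof (intro allI Ck_on_locally[OF assms(1)])
  fix k x assume "x \<in> S"
  then show "\<exists>T. open T \<and> x \<in> T \<and> Ck_on k (S \<inter> T) f"
    using assms(2) unfolding smooth_on_def by blast
qed

lemma smooth_on_has_derivative: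
  "smooth_on S f \<Longrightarrow> x \<in> S \<Longrightarrow> (f has_derivative frechet_derivative f (at x)) (at x)"
  unfolding smooth_on_def using Ck_on_has_derivative by blast

lemma smooth_on_frechet_derivative:
  "smooth_on S f \<Longrightarrow> smooth_on S (\<lambda>x. frechet_derivative f (at x) v)"
  unfolding smooth_on_def using Ck_on_derivative by blast

lemma smooth_on_imp_continuous_on: "smooth_on S f \<Longrightarrow> continuous_on S f"
  unfolding smooth_on_def by (metis Ck_on.simps(1))

text \<open>The classical smooth function \<open>exp(-1/t)\<close> with a pole factor \<open>t\<^sup>-\<^sup>n\<close>: the derivatives of \<open>flat_exp n\<close>
  are linear combinations of functions of the same family, so that one induction shows
  that all of them are smooth.\<close>

definition flat_exp :: "nat \<Rightarrow> real \<Rightarrow> real" where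
  "flat_exp n t = (if t > 0 then exp (- (1 / t)) / t ^ n else 0)"

text \<open>From the right, \<open>y = 1/t\<close> turns this into the decay of \<open>y\<^sup>n exp(-y)\<close> at infinity.\<close>

lemma flat_exp_tendsto: "(flat_exp n \<longlongrightarrow> 0) (at 0)"
proof -
  have "((\<lambda>y. y ^ n / exp y) \<longlongrightarrow> (0::real)) at_top" by (rule tendsto_power_div_exp_0)
  then have "((\<lambda>t. (inverse t) ^ n / exp (inverse t)) \<longlongrightarrow> (0::real)) (at_right 0)"
    by (rule filterlim_compose) (rule filterlim_inverse_at_top_right)
  moreover have "\<forall>\<^sub>F t in at_right 0. (inverse t) ^ n / exp (inverse t) = flat_exp n t"
    by (auto simp: eventually_at_right_field flat_exp_def exp_minus field_simps power_inverse
        intro!: exI[of _ 1])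
  ultimately have "(flat_exp n \<longlongrightarrow> 0) (at_right 0)" by (rule Lim_transform_eventually)
  moreover have "(flat_exp n \<longlongrightarrow> 0) (at_left 0)"
    by (rule tendsto_eventually)
       (auto simp: eventually_at_left_field flat_exp_def intro!: exI[of _ "-1"])
  ultimately show ?thesis by (simp add: filterlim_split_at)
qed

lemma flat_exp_DERIV:
  "(flat_exp n has_real_derivative flat_exp (n + 2) t - real n * flat_exp (n + 1) t) (at t)"
proof -
  consider "t > 0" | "t = 0" | "t < 0" by linarith
  then show ?thesis
  proof cases
    case 1
    have pow: "((\<lambda>t. t ^ n) has_real_derivative real n * t ^ n / t) (at t)"
      using 1 DERIV_pow[of n t] by (cases n) auto
    have exp: "((\<lambda>t. exp (- (1 / t))) has_real_derivative exp (- (1 / t)) / t ^ 2) (at t)"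
      using 1 by (auto intro!: derivative_eq_intros simp: power2_eq_square)
    have "((\<lambda>t. exp (- (1 / t)) / t ^ n) has_real_derivative
        flat_exp (n + 2) t - real n * flat_exp (n + 1) t) (at t)"
      by (rule DERIV_cong[OF DERIV_divide[OF exp pow]])
        (use 1 in \<open>auto simp: flat_exp_def divide_simps power2_eq_square power_add algebra_simps\<close>)
    then show ?thesis
      by (rule has_field_derivative_transform_within_open[where S = "{0<..}"])
         (use 1 in \<open>auto simp: flat_exp_def\<close>)
  next
    case 2
    have "((\<lambda>h. flat_exp (n + 1) h) \<longlongrightarrow> 0) (at 0)" by (rule flat_exp_tendsto)
    moreover have "\<forall>\<^sub>F h in at 0. flat_exp (n + 1) h = (flat_exp n (0 + h) - flat_exp n 0) / h"
      by (rule eventually_at_filter[THEN iffD2]) (auto simp: flat_exp_def)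
    ultimately have "((\<lambda>h. (flat_exp n (0 + h) - flat_exp n 0) / h) \<longlongrightarrow> 0) (at 0)"
      by (rule Lim_transform_eventually)
    then show ?thesis using 2 by (simp add: DERIV_def flat_exp_def)
  next
    case 3
    then have "((\<lambda>t. 0) has_real_derivative flat_exp (n + 2) t - real n * flat_exp (n + 1) t) (at t)"
      by (simp add: flat_exp_def)
    then show ?thesis
      by (rule has_field_derivative_transform_within_open[where S = "{..<0}"])
         (use 3 in \<open>auto simp: flat_exp_def\<close>)
  qed
qed


lemma smooth_on_flat_exp: "smooth_on UNIV (flat_exp n)"
proof -
  have "Ck_on k UNIV (flat_exp n)" for k
  proof (induction k arbitrary: n)
    case 0
    show ?case
      using DERIV_isCont[OF flat_exp_DERIV] by (simp add: continuous_at_imp_continuous_on)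
  next
    case (Suc k)
    show ?case
    proof (rule Ck_on_SucI[where f' = "\<lambda>t v. (flat_exp (n + 2) t + - real n * flat_exp (n + 1) t) * v"])
      show "(flat_exp n has_derivative (\<lambda>v. (flat_exp (n + 2) t + - real n * flat_exp (n + 1) t) * v)) (at t)"
        for t using flat_exp_DERIV[of n t] by (simp add: has_field_derivative_def)
    qed (intro Ck_on_mult Ck_on_add Ck_on_const Suc.IH open_UNIV)+
  qed
  then show ?thesis by (simp add: smooth_on_def)
qed

text \<open>With \<open>f(t) = exp(-1/t)\<close> for \<open>t > 0\<close> and \<open>f(t) = 0\<close> otherwise, \<open>f(t) / (f(t) + f(1 - t))\<close> is such a
  step; the denominator never vanishes as \<open>t\<close> and \<open>1 - t\<close> are not both nonpositive.\<close>

lemma smooth_step: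
  "\<exists>s::real \<Rightarrow> real. smooth_on UNIV s \<and> (\<forall>t\<le>0. s t = 0) \<and> (\<forall>t\<ge>1. s t = 1)"
proof -
  define d where "d t = flat_exp 0 t + flat_exp 0 (1 + - 1 * t)" for t
  have e: "smooth_on UNIV (\<lambda>t::real. flat_exp 0 (1 + - 1 * t))"
    by (rule smooth_on_compose[OF orthonormal_basis_real open_UNIV open_UNIV,
          where f = "\<lambda>t. 1 + - 1 * t" and g = "flat_exp 0"])
       (intro smooth_on_add smooth_on_mult smooth_on_bounded_linear smooth_on_flat_exp smooth_on_const
          bounded_linear_ident open_UNIV subset_UNIV)+
  have pos: "d t \<noteq> 0" for t
    by (cases "t > 0") (auto simp: d_def flat_exp_def add_pos_pos less_imp_neq[symmetric])
  have "smooth_on UNIV (\<lambda>t. flat_exp 0 t * inverse (d t))"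
    unfolding d_def
    by (intro smooth_on_mult smooth_on_inverse smooth_on_add smooth_on_flat_exp e open_UNIV)
       (use pos in \<open>simp add: d_def\<close>)
  moreover have "flat_exp 0 t * inverse (d t) = 0" if "t \<le> 0" for t
    using that by (simp add: flat_exp_def)
  moreover have "flat_exp 0 t * inverse (d t) = 1" if "t \<ge> 1" for t
    using that by (simp add: flat_exp_def d_def)
  ultimately show ?thesis by blast
qed

lemma smooth_bump_ball:
  fixes c :: "'e::real_inner"
  assumes "r > 0"
  shows "\<exists>b::'e \<Rightarrow> real. smooth_on UNIV b \<and> (\<forall>x\<in>ball c r. b x = 1) \<and> (\<forall>x. x \<notin> cball c (2 * r) \<longrightarrow> b x = 0)"
proof -
  obtain s :: "real \<Rightarrow> real" where s: "smooth_on UNIV s" "\<And>t. t \<le> 0 \<Longrightarrow> s t = 0" "\<And>t. t \<ge> 1 \<Longrightarrow> s t = 1"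
    using smooth_step by blast
  \<comment> \<open>\<open>q\<close> is at least 1 on the inner ball and at most \<open>-2\<close> off the outer one.\<close>
  define q where "q x = 2 + (- 1 / r\<^sup>2) * ((x + - c) \<bullet> (x + - c))" for x
  have "smooth_on UNIV q"
    unfolding q_def smooth_on_def
    by (intro allI Ck_on_add Ck_on_mult Ck_on_inner Ck_on_const Ck_on_bounded_linear
        bounded_linear_ident open_UNIV)
  then have "smooth_on UNIV (\<lambda>x. s (q x))"
    by (rule smooth_on_compose[OF orthonormal_basis_real open_UNIV open_UNIV subset_UNIV _ s(1)])
  moreover have q: "q x = 2 - (norm (x - c) / r)\<^sup>2" for x
    by (simp add: q_def power_divide power2_norm_eq_inner)
  have "s (q x) = 1" if "x \<in> ball c r" for x
  proof -
    have "(norm (x - c) / r)\<^sup>2 \<le> 1\<^sup>2"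
      using that assms by (intro power_mono) (auto simp: dist_norm norm_minus_commute)
    then show ?thesis using s(3) by (simp add: q)
  qed
  moreover have "s (q x) = 0" if "x \<notin> cball c (2 * r)" for x
  proof -
    have "2\<^sup>2 \<le> (norm (x - c) / r)\<^sup>2"
      using that assms
      by (intro power_mono) (auto simp: dist_norm norm_minus_commute pos_le_divide_eq)
    then show ?thesis using s(2) by (simp add: q)
  qed
  ultimately show ?thesis by (intro exI[of _ "\<lambda>x. s (q x)"]) auto
qed


section \<open>Smooth functions on a manifold\<close>

text \<open>Smoothness on an open subset only; reciprocals and functions given in one chart are of
  this kind before they are cut off.\<close>

definition smooth_in :: "('m, 'e::real_normed_vector) atlas \<Rightarrow> 'm set \<Rightarrow> ('m \<Rightarrow> real) \<Rightarrow> bool" where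
  "smooth_in A W f \<longleftrightarrow> (\<forall>(U, \<phi>)\<in>A. smooth_on (\<phi> ` (U \<inter> W)) (f \<circ> inv_into U \<phi>))"

lemma smooth_fun_iff: "smooth_fun A f \<longleftrightarrow> smooth_in A UNIV f"
  by (simp add: smooth_fun_def smooth_in_def)

lemma smooth_in_subset: "smooth_in A W f \<Longrightarrow> V \<subseteq> W \<Longrightarrow> smooth_in A V f"
  unfolding smooth_in_def by (auto intro: smooth_on_subset[OF _ image_mono])

lemma smooth_in_smooth_fun: "smooth_fun A f \<Longrightarrow> smooth_in A W f"
  unfolding smooth_fun_iff by (rule smooth_in_subset[OF _ subset_UNIV])

locale smooth_manifold =
  fixes A :: "('m::{t2_space,second_countable_topology}, 'e::{real_inner,heine_borel}) atlas"
  assumes atlas: "smooth_atlas A"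
begin

lemma basis_exists: "\<exists>B::'e set. orthonormal_basis B"
proof -
  have "\<exists>B::'e set. finite B \<and> span B = UNIV" using atlas unfolding smooth_atlas_def by (rule conjunct1)
  then show ?thesis using orthonormal_basis_exists by blast
qed

lemma chart_exists: "\<exists>U \<phi>. (U, \<phi>) \<in> A \<and> p \<in> U"
proof -
  have "(\<Union>(U, \<phi>)\<in>A. U) = UNIV" using atlas by (simp add: smooth_atlas_def)
  then have "p \<in> (\<Union>(U, \<phi>)\<in>A. U)" by simp
  then show ?thesis by auto
qed

lemma chart:
  assumes "(U, \<phi>) \<in> A"
  shows "open U" "open (\<phi> ` U)" "homeomorphism U (\<phi> ` U) \<phi> (inv_into U \<phi>)"
proof -
  have "\<forall>(U, \<phi>)\<in>A. open U \<and> open (\<phi> ` U) \<and> homeomorphism U (\<phi> ` U) \<phi> (inv_into U \<phi>)"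
    using atlas unfolding smooth_atlas_def by (elim conjE)
  from bspec[OF this assms]
  show "open U" "open (\<phi> ` U)" "homeomorphism U (\<phi> ` U) \<phi> (inv_into U \<phi>)" by auto
qed

lemma chart_transition:
  assumes "(U, \<phi>) \<in> A" "(V, \<psi>) \<in> A"
  shows "smooth_on (\<phi> ` (U \<inter> V)) (\<psi> \<circ> inv_into U \<phi>)"
proof -
  have "\<forall>(U, \<phi>)\<in>A. \<forall>(V, \<psi>)\<in>A. smooth_on (\<phi> ` (U \<inter> V)) (\<psi> \<circ> inv_into U \<phi>)"
    using atlas unfolding smooth_atlas_def by (elim conjE)
  from bspec[OF this assms(1)] show ?thesis using assms(2) by auto
qed

lemma chart_inv: "(U, \<phi>) \<in> A \<Longrightarrow> q \<in> U \<Longrightarrow> inv_into U \<phi> (\<phi> q) = q"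
  using chart(3) by (metis homeomorphism_apply1)

lemma chart_image_open:
  assumes "(U, \<phi>) \<in> A" "open W"
  shows "open (\<phi> ` (U \<inter> W))"
proof -
  have "openin (top_of_set (\<phi> ` U)) (\<phi> ` (U \<inter> W))"
    by (rule homeomorphism_imp_open_map[OF chart(3)[OF assms(1)]])
       (simp add: assms(2) openin_open_Int)
  then show ?thesis using chart(2)[OF assms(1)] openin_open_eq by blast
qed

lemma smooth_in_cong:
  assumes "open W" "\<And>p. p \<in> W \<Longrightarrow> f p = g p"
  shows "smooth_in A W f \<longleftrightarrow> smooth_in A W g"
proof -
  have "smooth_on (\<phi> ` (U \<inter> W)) (f \<circ> inv_into U \<phi>) \<longleftrightarrow> smooth_on (\<phi> ` (U \<inter> W)) (g \<circ> inv_into U \<phi>)"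
    if "(U, \<phi>) \<in> A" for U \<phi>
    using assms(2) chart_inv[OF that]
    by (intro smooth_on_cong chart_image_open that assms(1)) auto
  then show ?thesis unfolding smooth_in_def by blast
qed

lemma smooth_in_locally:
  assumes "open W" "\<And>p. p \<in> W \<Longrightarrow> \<exists>V. open V \<and> p \<in> V \<and> smooth_in A (W \<inter> V) f"
  shows "smooth_in A W f"
proof -
  have "smooth_on (\<phi> ` (U \<inter> W)) (f \<circ> inv_into U \<phi>)" if c: "(U, \<phi>) \<in> A" for U \<phi>
  proof (rule smooth_on_locally)
    fix x assume "x \<in> \<phi> ` (U \<inter> W)"
    then obtain p where p: "p \<in> U" "p \<in> W" "x = \<phi> p" by blast
    then obtain V where V: "open V" "p \<in> V" "smooth_in A (W \<inter> V) f" using assms(2) by blast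
    have "smooth_on (\<phi> ` (U \<inter> (W \<inter> V))) (f \<circ> inv_into U \<phi>)"
      using V(3) c unfolding smooth_in_def by blast
    moreover have "\<phi> ` (U \<inter> W) \<inter> \<phi> ` (U \<inter> V) \<subseteq> \<phi> ` (U \<inter> (W \<inter> V))"
      using chart_inv[OF c] by (auto simp: image_iff) (metis IntI)
    ultimately have "smooth_on (\<phi> ` (U \<inter> W) \<inter> \<phi> ` (U \<inter> V)) (f \<circ> inv_into U \<phi>)"
      by (rule smooth_on_subset)
    then show "\<exists>T. open T \<and> x \<in> T \<and> smooth_on (\<phi> ` (U \<inter> W) \<inter> T) (f \<circ> inv_into U \<phi>)"
      using chart_image_open[OF c V(1)] p V(2) by blast
  qed (intro chart_image_open c assms(1))
  then show ?thesis unfolding smooth_in_def by blast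
qed

lemma smooth_funI_locally:
  assumes "\<And>p. \<exists>V g. open V \<and> p \<in> V \<and> smooth_in A V g \<and> (\<forall>q\<in>V. f q = g q)"
  shows "smooth_fun A f"
  unfolding smooth_fun_iff
proof (rule smooth_in_locally)
  fix p
  obtain V g where V: "open V" "p \<in> V" "smooth_in A V g" "\<forall>q\<in>V. f q = g q"
    using assms by blast
  then have "smooth_in A V f" using smooth_in_cong[of V f g] by blast
  then show "\<exists>V. open V \<and> p \<in> V \<and> smooth_in A (UNIV \<inter> V) f" using V by auto
qed simp

lemma smooth_in_const: "open W \<Longrightarrow> smooth_in A W (\<lambda>p. c)"
  unfolding smooth_in_def by (auto simp: o_def intro!: smooth_on_const chart_image_open)

lemma smooth_in_add:
  "open W \<Longrightarrow> smooth_in A W f \<Longrightarrow> smooth_in A W g \<Longrightarrow> smooth_in A W (\<lambda>p. f p + g p)"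
  unfolding smooth_in_def o_def by (fast intro: smooth_on_add chart_image_open)

lemma smooth_in_mult:
  "open W \<Longrightarrow> smooth_in A W f \<Longrightarrow> smooth_in A W g \<Longrightarrow> smooth_in A W (\<lambda>p. f p * g p)"
  unfolding smooth_in_def o_def by (fast intro: smooth_on_mult chart_image_open)

lemma smooth_in_inverse:
  assumes "open W" "smooth_in A W f" "\<And>p. p \<in> W \<Longrightarrow> f p \<noteq> 0"
  shows "smooth_in A W (\<lambda>p. inverse (f p))"
proof -
  have "smooth_on (\<phi> ` (U \<inter> W)) (\<lambda>x. inverse (f (inv_into U \<phi> x)))" if "(U, \<phi>) \<in> A" for U \<phi>
    using assms that chart_inv[OF that]
    by (intro smooth_on_inverse chart_image_open) (auto simp: smooth_in_def o_def)
  then show ?thesis unfolding smooth_in_def o_def by blast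
qed

lemma smooth_in_sum:
  assumes "open W" "\<And>i. i \<in> I \<Longrightarrow> smooth_in A W (f i)"
  shows "smooth_in A W (\<lambda>p. \<Sum>i\<in>I. f i p)"
  using assms(2)
  by (induction I rule: infinite_finite_induct) (auto intro: smooth_in_add smooth_in_const assms(1))

lemmas smooth_fun_const = smooth_in_const[OF open_UNIV, folded smooth_fun_iff]
lemmas smooth_fun_add = smooth_in_add[OF open_UNIV, folded smooth_fun_iff]
lemmas smooth_fun_mult = smooth_in_mult[OF open_UNIV, folded smooth_fun_iff]
lemmas smooth_fun_sum = smooth_in_sum[OF open_UNIV, folded smooth_fun_iff]

lemma smooth_fun_diff: "smooth_fun A f \<Longrightarrow> smooth_fun A g \<Longrightarrow> smooth_fun A (\<lambda>p. f p - g p)"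
  using smooth_fun_add[of f "\<lambda>p. - 1 * g p"] smooth_fun_mult[OF smooth_fun_const[of "- 1"]] by simp

lemma smooth_fun_imp_isCont:
  assumes "smooth_fun A f" shows "isCont f p"
proof -
  obtain U \<phi> where c: "(U, \<phi>) \<in> A" "p \<in> U" using chart_exists by blast
  have "smooth_on (\<phi> ` U) (f \<circ> inv_into U \<phi>)"
    using assms c unfolding smooth_fun_def by blast
  then have "continuous_on (\<phi> ` U) (f \<circ> inv_into U \<phi>)" by (rule smooth_on_imp_continuous_on)
  moreover have "continuous_on U \<phi>" using chart(3)[OF c(1)] by (rule homeomorphism_cont1)
  ultimately have "continuous_on U (\<lambda>q. (f \<circ> inv_into U \<phi>) (\<phi> q))"
    by (rule continuous_on_compose2) simp
  then have "continuous_on U f"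
    by (rule continuous_on_eq) (simp add: chart_inv[OF c(1)])
  then show ?thesis using chart(1)[OF c(1)] c(2) continuous_on_eq_continuous_at by blast
qed

lemma smooth_in_chart_compose:
  assumes c: "(U, \<phi>) \<in> A" and b: "smooth_on (\<phi> ` U) b"
  shows "smooth_in A U (\<lambda>q. b (\<phi> q))"
proof -
  obtain B :: "'e set" where B: "orthonormal_basis B" using basis_exists by blast
  have "smooth_on (\<psi> ` (V \<inter> U)) (\<lambda>x. b ((\<phi> \<circ> inv_into V \<psi>) x))" if d: "(V, \<psi>) \<in> A" for V \<psi>
    using chart_inv[OF d]
    by (intro smooth_on_compose[OF B _ _ _ _ b] chart_image_open[OF d] chart[OF c]
        chart_transition[OF d c]) auto
  then show ?thesis unfolding smooth_in_def o_def by blast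
qed

text \<open>The Hausdorff property makes the compact image \<open>K\<close> of a closed coordinate ball closed in the
  manifold, so that a cut-off defined in the chart extends smoothly by \<open>0\<close>.\<close>

lemma bump_function:
  assumes "open W" "p \<in> W"
  obtains \<beta> V K where "smooth_fun A \<beta>" "open V" "p \<in> V" "V \<subseteq> W" "\<And>q. q \<in> V \<Longrightarrow> \<beta> q = 1"
    "closed K" "K \<subseteq> W" "\<And>q. q \<notin> K \<Longrightarrow> \<beta> q = 0"
proof -
  obtain U \<phi> where c: "(U, \<phi>) \<in> A" "p \<in> U" using chart_exists by blast
  let ?i = "inv_into U \<phi>"
  have op: "open (\<phi> ` (U \<inter> W))" by (rule chart_image_open[OF c(1) assms(1)])
  then obtain e where e: "e > 0" "cball (\<phi> p) e \<subseteq> \<phi> ` (U \<inter> W)"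
    using c assms open_contains_cball by (metis IntI imageI)
  define r where "r = e / 2"
  have r: "r > 0" "cball (\<phi> p) (2 * r) \<subseteq> \<phi> ` (U \<inter> W)" using e by (auto simp: r_def)
  obtain b :: "'e \<Rightarrow> real" where b: "smooth_on UNIV b" "\<And>x. x \<in> ball (\<phi> p) r \<Longrightarrow> b x = 1"
    "\<And>x. x \<notin> cball (\<phi> p) (2 * r) \<Longrightarrow> b x = 0"
    using smooth_bump_ball[OF r(1), of "\<phi> p"] by metis
  define \<beta> where "\<beta> q = (if q \<in> U then b (\<phi> q) else 0)" for q
  define K where "K = ?i ` cball (\<phi> p) (2 * r)"
  define V where "V = U \<inter> \<phi> -` ball (\<phi> p) r"
  have "continuous_on (\<phi> ` U) ?i" using chart(3)[OF c(1)] by (rule homeomorphism_cont2)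
  then have "continuous_on (cball (\<phi> p) (2 * r)) ?i" by (rule continuous_on_subset) (use r in blast)
  then have "compact K" unfolding K_def by (rule compact_continuous_image) (rule compact_cball)
  then have K: "closed K" by (rule compact_imp_closed)
  have KW: "K \<subseteq> U \<inter> W" using r(2) chart_inv[OF c(1)] unfolding K_def by fastforce
  have \<beta>0: "\<beta> q = 0" if "q \<notin> K" for q
  proof (cases "q \<in> U")
    case True
    then have "\<phi> q \<notin> cball (\<phi> p) (2 * r)" using that chart_inv[OF c(1)] unfolding K_def by force
    then show ?thesis using b(3) by (simp add: \<beta>_def)
  qed (simp add: \<beta>_def)
  have openV: "open V" unfolding V_def
    by (rule continuous_open_preimage[OF homeomorphism_cont1[OF chart(3)[OF c(1)]] chart(1)[OF c(1)] open_ball])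
  have "V \<subseteq> W"
  proof
    fix q assume q: "q \<in> V"
    then have "\<phi> q \<in> \<phi> ` (U \<inter> W)" using r by (auto simp: V_def)
    then obtain q' where "q' \<in> U" "q' \<in> W" "\<phi> q = \<phi> q'" by blast
    then show "q \<in> W" using q chart_inv[OF c(1)] unfolding V_def by (metis IntD1)
  qed
  moreover have "smooth_fun A \<beta>"
  proof (rule smooth_funI_locally)
    fix q
    show "\<exists>V g. open V \<and> q \<in> V \<and> smooth_in A V g \<and> (\<forall>q\<in>V. \<beta> q = g q)"
    proof (cases "q \<in> U")
      case True
      have "smooth_in A U (\<lambda>q. b (\<phi> q))"
        using b(1) by (intro smooth_in_chart_compose[OF c(1)]) (auto intro: smooth_on_subset)
      then show ?thesis using True chart(1)[OF c(1)] by (auto simp: \<beta>_def)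
    next
      case False
      then have "q \<in> - K" using KW by blast
      then show ?thesis using K \<beta>0 smooth_in_const[of "- K" 0] by (intro exI[of _ "- K"]) auto
    qed
  qed
  moreover have "p \<in> V" "\<And>q. q \<in> V \<Longrightarrow> \<beta> q = 1" using c(2) b(2) r(1) by (auto simp: V_def \<beta>_def)
  moreover have "K \<subseteq> W" using KW by blast
  ultimately show thesis using that openV K \<beta>0 by metis
qed

lemma smooth_fun_cutoff:
  assumes "open W" "smooth_in A W f" "smooth_fun A \<beta>" "closed K" "K \<subseteq> W" "\<And>q. q \<notin> K \<Longrightarrow> \<beta> q = 0"
    "\<And>q. q \<in> W \<Longrightarrow> h q = \<beta> q * f q" "\<And>q. q \<notin> W \<Longrightarrow> h q = 0"
  shows "smooth_fun A h"
proof (rule smooth_funI_locally)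
  fix q
  show "\<exists>V g. open V \<and> q \<in> V \<and> smooth_in A V g \<and> (\<forall>q\<in>V. h q = g q)"
  proof (cases "q \<in> W")
    case True
    then show ?thesis
      using assms smooth_in_mult[OF assms(1) smooth_in_smooth_fun[OF assms(3)] assms(2)] by blast
  next
    case False
    have "h q' = 0" if "q' \<in> - K" for q' using assms(6-8) that by (cases "q' \<in> W") auto
    then show ?thesis
      using False assms(4,5) smooth_in_const[of "- K" 0] by (intro exI[of _ "- K"]) auto
  qed
qed

lemma smooth_fun_extension:
  assumes "open W" "smooth_in A W f" "p \<in> W"
  shows "\<exists>h V. smooth_fun A h \<and> open V \<and> p \<in> V \<and> V \<subseteq> W \<and> (\<forall>q\<in>V. h q = f q)"
proof -
  obtain \<beta> V K where \<beta>: "smooth_fun A \<beta>" "open V" "p \<in> V" "V \<subseteq> W" "\<And>q. q \<in> V \<Longrightarrow> \<beta> q = 1"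
    "closed K" "K \<subseteq> W" "\<And>q. q \<notin> K \<Longrightarrow> \<beta> q = 0"
    by (rule bump_function[OF assms(1,3)]) (rule that)
  have "smooth_fun A (\<lambda>q. if q \<in> W then \<beta> q * f q else 0)"
    by (rule smooth_fun_cutoff[OF assms(1,2) \<beta>(1,6,7,8)]) auto
  then show ?thesis using \<beta>
    by (intro exI[of _ "\<lambda>q. if q \<in> W then \<beta> q * f q else 0"] exI[of _ V]) auto
qed

text \<open>The reciprocal is smooth where \<open>f\<close> is nonzero and is extended from there by cutting off.\<close>

lemma smooth_fun_reciprocal:
  assumes "smooth_fun A f" "f p \<noteq> 0"
  shows "\<exists>h V. smooth_fun A h \<and> open V \<and> p \<in> V \<and> (\<forall>q\<in>V. h q * f q = 1)"
proof -
  have "open (f -` (- {0}))"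
    using smooth_fun_imp_isCont[OF assms(1)]
    by (intro open_vimage open_Compl closed_singleton) (simp add: continuous_at_imp_continuous_on)
  moreover from this have "smooth_in A (f -` (- {0})) (\<lambda>q. inverse (f q))"
    by (rule smooth_in_inverse[OF _ smooth_in_smooth_fun[OF assms(1)]]) simp
  moreover have "p \<in> f -` (- {0})" using assms(2) by simp
  ultimately have "\<exists>h V. smooth_fun A h \<and> open V \<and> p \<in> V \<and> V \<subseteq> f -` (- {0}) \<and>
      (\<forall>q\<in>V. h q = inverse (f q))"
    by (rule smooth_fun_extension)
  then obtain h V where h: "smooth_fun A h" "open V" "p \<in> V" "V \<subseteq> f -` (- {0})"
    "\<forall>q\<in>V. h q = inverse (f q)"
    by blast
  have "h q * f q = 1" if "q \<in> V" for q
  proof -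
    have "f q \<noteq> 0" using h(4) that by blast
    then show ?thesis using h(5) that by simp
  qed
  then show ?thesis using h(1-3) by blast
qed


section \<open>Tangent vectors and vector fields\<close>

lemma coord_vec_apply:
  "smooth_fun A f \<Longrightarrow> coord_vec A (U, \<phi>) p u f = frechet_derivative (f \<circ> inv_into U \<phi>) (at (\<phi> p)) u"
  by (simp add: coord_vec_def)

lemma smooth_fun_has_derivative:
  assumes "smooth_fun A f" "(U, \<phi>) \<in> A" "p \<in> U"
  shows "((f \<circ> inv_into U \<phi>) has_derivative (frechet_derivative (f \<circ> inv_into U \<phi>) (at (\<phi> p)))) (at (\<phi> p))"
proof (rule smooth_on_has_derivative)
  show "smooth_on (\<phi> ` U) (f \<circ> inv_into U \<phi>)" using assms(1,2) by (auto simp: smooth_fun_def)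
qed (use assms(3) in simp)

lemma coord_vec_linear:
  assumes "(U, \<phi>) \<in> A" "p \<in> U"
  shows "coord_vec A (U, \<phi>) p (u + v) = coord_vec A (U, \<phi>) p u + coord_vec A (U, \<phi>) p v"
    "coord_vec A (U, \<phi>) p (r *\<^sub>R u) = r *\<^sub>R coord_vec A (U, \<phi>) p u"
    "coord_vec A (U, \<phi>) p 0 = 0"
  using has_derivative_linear[OF smooth_fun_has_derivative[OF _ assms]]
  by (auto simp: fun_eq_iff coord_vec_def scaleR_fun_def linear_add linear_cmul linear_0)

text \<open>By the chain rule for the transition map, every chart around \<open>p\<close> produces all tangent vectors;
  hence they form a vector space.\<close>

lemma tangent_space_chart:
  assumes c: "(U, \<phi>) \<in> A" "p \<in> U" and v: "v \<in> tangent_space A p"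
  shows "\<exists>u. v = coord_vec A (U, \<phi>) p u"
proof -
  obtain V \<psi> w where d: "(V, \<psi>) \<in> A" "p \<in> V" "v = coord_vec A (V, \<psi>) p w"
    using v unfolding tangent_space_def by force
  let ?t = "\<phi> \<circ> inv_into V \<psi>"
  have t: "(?t has_derivative frechet_derivative ?t (at (\<psi> p))) (at (\<psi> p))"
    using chart_transition[OF d(1) c(1)] c d by (intro smooth_on_has_derivative) auto
  have "coord_vec A (V, \<psi>) p w f = coord_vec A (U, \<phi>) p (frechet_derivative ?t (at (\<psi> p)) w) f"
    if f: "smooth_fun A f" for f
  proof -
    have pos: "?t (\<psi> p) = \<phi> p" using chart_inv[OF d(1,2)] by simp
    have "((f \<circ> inv_into U \<phi>) \<circ> ?t has_derivative
       frechet_derivative (f \<circ> inv_into U \<phi>) (at (\<phi> p)) \<circ> frechet_derivative ?t (at (\<psi> p))) (at (\<psi> p))"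
      by (rule diff_chain_at[OF t]) (unfold pos, rule smooth_fun_has_derivative[OF f c])
    moreover have "((f \<circ> inv_into U \<phi>) \<circ> ?t) x = (f \<circ> inv_into V \<psi>) x" if "x \<in> \<psi> ` (V \<inter> U)" for x
      using that chart_inv[OF c(1)] chart_inv[OF d(1)] by auto
    ultimately have "((f \<circ> inv_into V \<psi>) has_derivative
       frechet_derivative (f \<circ> inv_into U \<phi>) (at (\<phi> p)) \<circ> frechet_derivative ?t (at (\<psi> p))) (at (\<psi> p))"
      using has_derivative_cong_open[OF chart_image_open[OF d(1) chart(1)[OF c(1)]]] c d by blast
    then have "frechet_derivative (f \<circ> inv_into V \<psi>) (at (\<psi> p)) =
       frechet_derivative (f \<circ> inv_into U \<phi>) (at (\<phi> p)) \<circ> frechet_derivative ?t (at (\<psi> p))"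
      using frechet_derivative_at by metis
    then show ?thesis using f by (simp add: coord_vec_apply)
  qed
  then have "v = coord_vec A (U, \<phi>) p (frechet_derivative ?t (at (\<psi> p)) w)"
    unfolding d(3) by (auto simp: coord_vec_def)
  then show ?thesis by blast
qed

lemma tangent_spaceI: "(U, \<phi>) \<in> A \<Longrightarrow> p \<in> U \<Longrightarrow> coord_vec A (U, \<phi>) p u \<in> tangent_space A p"
  unfolding tangent_space_def by force

lemma subspace_tangent_space: "subspace (tangent_space A p)"
proof -
  obtain U \<phi> where c: "(U, \<phi>) \<in> A" "p \<in> U" using chart_exists by blast
  have eq: "tangent_space A p = range (coord_vec A (U, \<phi>) p)"
    using tangent_space_chart[OF c] tangent_spaceI[OF c] by blast
  show ?thesis
    unfolding subspace_def eq
    by (auto simp: image_iff simp flip: coord_vec_linear(1,2)[OF c])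
      (metis coord_vec_linear(3)[OF c])
qed

lemma tangent_nonsmooth: "v \<in> tangent_space A p \<Longrightarrow> \<not> smooth_fun A f \<Longrightarrow> v f = 0"
  unfolding tangent_space_def coord_vec_def by auto

lemma tangent_const:
  assumes "v \<in> tangent_space A p" shows "v (\<lambda>q. r) = 0"
proof -
  obtain U \<phi> u where "(U, \<phi>) \<in> A" "v = coord_vec A (U, \<phi>) p u"
    using assms unfolding tangent_space_def by force
  then show ?thesis using frechet_derivative_const[of r "\<phi> p"]
    by (simp add: coord_vec_def smooth_fun_const o_def)
qed

lemma vector_fieldD:
  assumes "X \<in> vector_fields A"
  shows "X p \<in> tangent_space A p" "smooth_fun A f \<Longrightarrow> smooth_fun A (\<lambda>p. X p f)"
  using assms unfolding vector_fields_def by auto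

lemma vector_fieldI:
  assumes "\<And>p. X p \<in> tangent_space A p" "\<And>f. smooth_fun A f \<Longrightarrow> smooth_fun A (\<lambda>p. X p f)"
  shows "X \<in> vector_fields A"
  using assms unfolding vector_fields_def by auto

lemma vector_field_scale:
  assumes "smooth_fun A f" "X \<in> vector_fields A"
  shows "(\<lambda>p. f p *\<^sub>R X p) \<in> vector_fields A"
  using smooth_fun_mult[OF assms(1) vector_fieldD(2)[OF assms(2)]]
  by (intro vector_fieldI subspace_scale subspace_tangent_space vector_fieldD(1)[OF assms(2)])
    (simp add: scaleR_fun_def)

lemma vector_field_add:
  assumes "X \<in> vector_fields A" "Y \<in> vector_fields A"
  shows "X + Y \<in> vector_fields A"
  using subspace_add[OF subspace_tangent_space vector_fieldD(1)[OF assms(1)] vector_fieldD(1)[OF assms(2)]]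
    smooth_fun_add[OF vector_fieldD(2)[OF assms(1)] vector_fieldD(2)[OF assms(2)]]
  by (intro vector_fieldI) simp_all

lemma vector_field_diff:
  assumes "X \<in> vector_fields A" "Y \<in> vector_fields A"
  shows "X - Y \<in> vector_fields A"
  using subspace_diff[OF subspace_tangent_space vector_fieldD(1)[OF assms(1)] vector_fieldD(1)[OF assms(2)]]
    smooth_fun_diff[OF vector_fieldD(2)[OF assms(1)] vector_fieldD(2)[OF assms(2)]]
  by (intro vector_fieldI) simp_all

lemma vector_field_zero: "0 \<in> vector_fields A"
  using subspace_0[OF subspace_tangent_space] smooth_fun_const[of 0]
  by (intro vector_fieldI) simp_all

lemma vector_field_sum:
  assumes "\<And>i. i \<in> I \<Longrightarrow> X i \<in> vector_fields A"
  shows "(\<Sum>i\<in>I. X i) \<in> vector_fields A"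
  using assms
proof (induction I rule: infinite_finite_induct)
  case (insert i I)
  have "X i \<in> vector_fields A" "(\<Sum>i\<in>I. X i) \<in> vector_fields A"
    using insert.prems insert.IH by blast+
  then show ?case unfolding sum.insert[OF insert.hyps] by (rule vector_field_add)
qed (simp_all add: vector_field_zero)

lemma vector_fieldI_locally:
  assumes "\<And>p. X p \<in> tangent_space A p"
    "\<And>p. \<exists>V Y. open V \<and> p \<in> V \<and> Y \<in> vector_fields A \<and> (\<forall>q\<in>V. X q = Y q)"
  shows "X \<in> vector_fields A"
proof (rule vector_fieldI[OF assms(1)], rule smooth_funI_locally)
  fix f p assume f: "smooth_fun A f"
  obtain V Y where V: "open V" "p \<in> V" "Y \<in> vector_fields A" "\<forall>q\<in>V. X q = Y q"
    using assms(2) by blast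
  then show "\<exists>V g. open V \<and> p \<in> V \<and> smooth_in A V g \<and> (\<forall>q\<in>V. X q f = g q)"
    using smooth_in_smooth_fun[OF vector_fieldD(2)[OF V(3) f], of V]
    by (intro exI[of _ V] exI[of _ "\<lambda>q. Y q f"]) auto
qed

lemma sum_fun_apply: "(\<Sum>i\<in>I. f i) x = (\<Sum>i\<in>I. f i x)"
  by (induction I rule: infinite_finite_induct) auto

text \<open>The coordinate frame and the coordinate functions of a chart, multiplied by a cut-off to make
  them global; on the smaller set \<open>W\<close> the cut-off is \<open>1\<close> and does not show.\<close>

lemma local_frame:
  obtains W and B :: "'e set" and E x
  where "open W" "p \<in> W" "finite B"
    "\<And>b. b \<in> B \<Longrightarrow> E b \<in> vector_fields A" "\<And>b. b \<in> B \<Longrightarrow> smooth_fun A (x b)"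
    "\<And>q v. q \<in> W \<Longrightarrow> v \<in> tangent_space A q \<Longrightarrow> v = (\<Sum>b\<in>B. v (x b) *\<^sub>R E b q)"
    "\<And>q b c. q \<in> W \<Longrightarrow> b \<in> B \<Longrightarrow> c \<in> B \<Longrightarrow> E b q (x c) = (if b = c then 1 else 0)"
proof -
  obtain U \<phi> where c: "(U, \<phi>) \<in> A" "p \<in> U" using chart_exists by blast
  note openU = chart(1)[OF c(1)]
  obtain B :: "'e set" where B: "orthonormal_basis B" using basis_exists by blast
  then have orth: "b \<bullet> b' = (if b = b' then 1 else 0)" if "b \<in> B" "b' \<in> B" for b b'
    using that unfolding orthonormal_basis_def by blast
  obtain \<beta> W K where \<beta>: "smooth_fun A \<beta>" "open W" "p \<in> W" "W \<subseteq> U" "\<And>q. q \<in> W \<Longrightarrow> \<beta> q = 1"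
    "closed K" "K \<subseteq> U" "\<And>q. q \<notin> K \<Longrightarrow> \<beta> q = 0"
    by (rule bump_function[OF openU c(2)]) (rule that)
  define x where "x b q = (if q \<in> U then \<beta> q * (\<phi> q \<bullet> b) else 0)" for b q
  define E where "E b q = (if q \<in> U then \<beta> q *\<^sub>R coord_vec A (U, \<phi>) q b else 0)" for b q
  have x: "smooth_fun A (x b)" for b
  proof (rule smooth_fun_cutoff[OF openU _ \<beta>(1,6,7,8)])
    show "smooth_in A U (\<lambda>q. \<phi> q \<bullet> b)"
      by (rule smooth_in_chart_compose[OF c(1), of "\<lambda>y. y \<bullet> b"])
        (intro smooth_on_bounded_linear chart(2)[OF c(1)] bounded_linear_inner_left)
  qed (auto simp: x_def)
  have E: "E b \<in> vector_fields A" for b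
  proof (rule vector_fieldI)
    show "E b q \<in> tangent_space A q" for q
      using c by (auto simp: E_def intro!: subspace_scale subspace_tangent_space tangent_spaceI subspace_0)
    fix f assume f: "smooth_fun A f"
    show "smooth_fun A (\<lambda>q. E b q f)"
    proof (rule smooth_fun_cutoff[OF openU _ \<beta>(1,6,7,8)])
      show "smooth_in A U (\<lambda>q. frechet_derivative (f \<circ> inv_into U \<phi>) (at (\<phi> q)) b)"
        using f c(1)
        by (intro smooth_in_chart_compose[OF c(1), of "\<lambda>y. frechet_derivative (f \<circ> inv_into U \<phi>) (at y) b"]
            smooth_on_frechet_derivative) (auto simp: smooth_fun_def)
    qed (auto simp: E_def coord_vec_apply f scaleR_fun_def)
  qed
  have coord: "coord_vec A (U, \<phi>) q u (x b) = u \<bullet> b" if q: "q \<in> W" for q u b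
  proof -
    have "((\<lambda>y. y \<bullet> b) has_derivative (\<lambda>u. u \<bullet> b)) (at (\<phi> q))"
      by (intro bounded_linear_imp_has_derivative bounded_linear_inner_left)
    moreover have "(x b \<circ> inv_into U \<phi>) y = y \<bullet> b" if "y \<in> \<phi> ` (U \<inter> W)" for y
      using that chart_inv[OF c(1)] \<beta>(5) by (auto simp: x_def)
    ultimately have "((x b \<circ> inv_into U \<phi>) has_derivative (\<lambda>u. u \<bullet> b)) (at (\<phi> q))"
      using has_derivative_cong_open[OF chart_image_open[OF c(1) \<beta>(2)], of "\<phi> q"
          "x b \<circ> inv_into U \<phi>" "\<lambda>y. y \<bullet> b"] q \<beta>(4) by blast
    then have "frechet_derivative (x b \<circ> inv_into U \<phi>) (at (\<phi> q)) = (\<lambda>u. u \<bullet> b)"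
      using frechet_derivative_at by metis
    then show ?thesis by (simp add: coord_vec_apply x)
  qed
  have frame: "v = (\<Sum>b\<in>B. v (x b) *\<^sub>R E b q)" if q: "q \<in> W" and v: "v \<in> tangent_space A q" for q v
  proof -
    have qU: "q \<in> U" using q \<beta> by blast
    obtain u where u: "v = coord_vec A (U, \<phi>) q u" using tangent_space_chart[OF c(1) qU v] by blast
    have "u = (\<Sum>b\<in>B. (u \<bullet> b) *\<^sub>R b)" using B unfolding orthonormal_basis_def by blast
    then have "v = coord_vec A (U, \<phi>) q (\<Sum>b\<in>B. (u \<bullet> b) *\<^sub>R b)" using u by simp
    also have "\<dots> = (\<Sum>b\<in>B. (u \<bullet> b) *\<^sub>R coord_vec A (U, \<phi>) q b)"
      by (induction B rule: infinite_finite_induct) (auto simp: coord_vec_linear[OF c(1) qU])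
    also have "\<dots> = (\<Sum>b\<in>B. v (x b) *\<^sub>R E b q)"
      by (simp add: u coord q E_def qU \<beta>(5))
    finally show ?thesis .
  qed
  have dual: "E b q (x b') = (if b = b' then 1 else 0)" if "q \<in> W" "b \<in> B" "b' \<in> B" for q b b'
  proof -
    have "q \<in> U" using that \<beta> by blast
    then show ?thesis using that orth by (simp add: E_def \<beta>(5) coord)
  qed
  have "finite B" using B unfolding orthonormal_basis_def by blast
  then show thesis by (rule that[OF \<beta>(2,3) _ E x frame dual])
qed

lemma vector_field_extension:
  assumes "v \<in> tangent_space A p"
  shows "\<exists>X\<in>vector_fields A. X p = v"
proof -
  obtain W and B :: "'e set" and E x where W: "open W" "p \<in> W" "finite B"
    and E: "\<And>b. b \<in> B \<Longrightarrow> E b \<in> vector_fields A" "\<And>b. b \<in> B \<Longrightarrow> smooth_fun A (x b)"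
    and frame: "\<And>q v. q \<in> W \<Longrightarrow> v \<in> tangent_space A q \<Longrightarrow> v = (\<Sum>b\<in>B. v (x b) *\<^sub>R E b q)"
    and dual: "\<And>q b c. q \<in> W \<Longrightarrow> b \<in> B \<Longrightarrow> c \<in> B \<Longrightarrow> E b q (x c) = (if b = c then 1 else 0)"
    by (rule local_frame[of p]) (rule that)
  have "(\<Sum>b\<in>B. (\<lambda>q. v (x b) *\<^sub>R E b q)) \<in> vector_fields A"
    by (intro vector_field_sum vector_field_scale smooth_fun_const E(1))
  moreover have "(\<Sum>b\<in>B. (\<lambda>q. v (x b) *\<^sub>R E b q)) p = v"
    using frame[OF W(2) assms] by (simp add: sum_fun_apply)
  ultimately show ?thesis by blast
qed

text \<open>Cut off near \<open>p\<close>, a field that vanishes at \<open>p\<close> is a sum of global fields with coefficients that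
  vanish at \<open>p\<close>. So an expression that is linear over smooth functions depends on a field only
  through its value at \<open>p\<close>.\<close>

lemma tensorial:
  fixes \<Phi> :: "('m \<Rightarrow> 'm tvec) \<Rightarrow> 'v::real_vector"
  assumes add: "\<And>X Y. X \<in> vector_fields A \<Longrightarrow> Y \<in> vector_fields A \<Longrightarrow> \<Phi> (X + Y) = \<Phi> X + \<Phi> Y"
    and scale: "\<And>f X. smooth_fun A f \<Longrightarrow> X \<in> vector_fields A \<Longrightarrow> \<Phi> (\<lambda>q. f q *\<^sub>R X q) = f p *\<^sub>R \<Phi> X"
    and X: "X \<in> vector_fields A" "X p = 0"
  shows "\<Phi> X = 0"
proof -
  obtain W and B :: "'e set" and E x where W: "open W" "p \<in> W" "finite B"
    and E: "\<And>b. b \<in> B \<Longrightarrow> E b \<in> vector_fields A" "\<And>b. b \<in> B \<Longrightarrow> smooth_fun A (x b)"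
    and frame: "\<And>q v. q \<in> W \<Longrightarrow> v \<in> tangent_space A q \<Longrightarrow> v = (\<Sum>b\<in>B. v (x b) *\<^sub>R E b q)"
    and dual: "\<And>q b c. q \<in> W \<Longrightarrow> b \<in> B \<Longrightarrow> c \<in> B \<Longrightarrow> E b q (x c) = (if b = c then 1 else 0)"
    by (rule local_frame[of p]) (rule that)
  obtain \<beta> V K where "smooth_fun A \<beta>" "open V" "p \<in> V" "V \<subseteq> W" "\<And>q. q \<in> V \<Longrightarrow> \<beta> q = 1"
    "closed K" "K \<subseteq> W" "\<And>q. q \<notin> K \<Longrightarrow> \<beta> q = 0"
    by (rule bump_function[OF W(1,2)]) (rule that)
  then have \<beta>: "smooth_fun A \<beta>" "\<beta> p = 1" "\<And>q. q \<notin> W \<Longrightarrow> \<beta> q = 0" by blast+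
  \<comment> \<open>At \<open>p\<close> the coefficients in \<open>Y b\<close> vanish with \<open>X p\<close>, and the one in \<open>Z\<close> because \<open>\<beta> p = 1\<close>.\<close>
  define Y where "Y b = (\<lambda>q. (\<beta> q * X q (x b)) *\<^sub>R E b q)" for b
  define Z where "Z = (\<lambda>q. (1 - \<beta> q) *\<^sub>R X q)"
  have coef: "smooth_fun A (\<lambda>q. \<beta> q * X q (x b))" if "b \<in> B" for b
    by (intro smooth_fun_mult \<beta>(1) vector_fieldD(2)[OF X(1)] E(2) that)
  have Y: "Y b \<in> vector_fields A" if "b \<in> B" for b
    unfolding Y_def by (intro vector_field_scale coef E(1) that)
  have Z: "Z \<in> vector_fields A"
    unfolding Z_def by (intro vector_field_scale smooth_fun_diff smooth_fun_const \<beta>(1) X)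
  have decomp: "X = (\<Sum>b\<in>B. Y b) + Z"
  proof
    fix q
    have "(\<Sum>b\<in>B. Y b q) = \<beta> q *\<^sub>R X q"
    proof (cases "q \<in> W")
      case True
      have "X q = (\<Sum>b\<in>B. X q (x b) *\<^sub>R E b q)"
        by (rule frame[OF True vector_fieldD(1)[OF X(1)]])
      then have "\<beta> q *\<^sub>R X q = \<beta> q *\<^sub>R (\<Sum>b\<in>B. X q (x b) *\<^sub>R E b q)" by simp
      then show ?thesis by (simp add: Y_def scaleR_sum_right)
    next
      case False
      then have "\<beta> q = 0" by (rule \<beta>(3))
      then show ?thesis by (simp add: Y_def)
    qed
    then show "X q = ((\<Sum>b\<in>B. Y b) + Z) q"
      by (simp add: sum_fun_apply Z_def scaleR_left_diff_distrib)
  qed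
  have zero: "\<Phi> 0 = 0" using add[OF vector_field_zero vector_field_zero] by simp
  have sum: "\<Phi> (\<Sum>b\<in>B. Y b) = (\<Sum>b\<in>B. \<Phi> (Y b))"
    using W(3) Y
  proof (induction B rule: finite_induct)
    case (insert b B)
    have IH: "\<Phi> (\<Sum>b\<in>B. Y b) = (\<Sum>b\<in>B. \<Phi> (Y b))"
      by (rule insert.IH) (rule insert.prems, rule insertI2)
    have "\<Phi> (Y b + (\<Sum>b\<in>B. Y b)) = \<Phi> (Y b) + \<Phi> (\<Sum>b\<in>B. Y b)"
      by (intro add vector_field_sum insert.prems) auto
    then show ?case unfolding sum.insert[OF insert.hyps] IH .
  qed (simp add: zero)
  have Y0: "\<Phi> (Y b) = 0" if "b \<in> B" for b
  proof -
    have "\<Phi> (Y b) = (\<beta> p * X p (x b)) *\<^sub>R \<Phi> (E b)"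
      unfolding Y_def by (rule scale[OF coef[OF that] E(1)[OF that]])
    then show ?thesis using X(2) by simp
  qed
  have "\<Phi> Z = (1 - \<beta> p) *\<^sub>R \<Phi> X"
    unfolding Z_def by (rule scale[OF smooth_fun_diff[OF smooth_fun_const \<beta>(1)] X(1)])
  then have Z0: "\<Phi> Z = 0" using \<beta>(2) by simp
  have "\<Phi> ((\<Sum>b\<in>B. Y b) + Z) = \<Phi> (\<Sum>b\<in>B. Y b) + \<Phi> Z"
    by (intro add vector_field_sum Y Z)
  also have "\<dots> = 0" unfolding sum Z0 by (simp add: Y0)
  finally show ?thesis unfolding decomp[symmetric] .
qed

end


section \<open>Riemannian metrics\<close>

locale riemannian_manifold = smooth_manifold A
  for A :: "('m::{t2_space,second_countable_topology}, 'e::{real_inner,heine_borel}) atlas" +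
  fixes g :: "'m \<Rightarrow> 'm tvec \<Rightarrow> 'm tvec \<Rightarrow> real"
  assumes metric: "riemannian_metric A g"
begin

lemma metric_add_left:
  "u \<in> tangent_space A p \<Longrightarrow> v \<in> tangent_space A p \<Longrightarrow> w \<in> tangent_space A p \<Longrightarrow>
    g p (u + v) w = g p u w + g p v w"
  using metric unfolding riemannian_metric_def by blast

lemma metric_scale_left:
  "u \<in> tangent_space A p \<Longrightarrow> w \<in> tangent_space A p \<Longrightarrow> g p (c *\<^sub>R u) w = c * g p u w"
  using metric unfolding riemannian_metric_def by blast

lemma metric_sym: "u \<in> tangent_space A p \<Longrightarrow> v \<in> tangent_space A p \<Longrightarrow> g p u v = g p v u"
  using metric unfolding riemannian_metric_def by blast

lemma metric_pos: "u \<in> tangent_space A p \<Longrightarrow> u \<noteq> 0 \<Longrightarrow> g p u u > 0"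
  using metric unfolding riemannian_metric_def by blast

lemma metric_smooth:
  "X \<in> vector_fields A \<Longrightarrow> Y \<in> vector_fields A \<Longrightarrow> smooth_fun A (\<lambda>p. g p (X p) (Y p))"
  using metric unfolding riemannian_metric_def by blast

lemma metric_add_right:
  "u \<in> tangent_space A p \<Longrightarrow> v \<in> tangent_space A p \<Longrightarrow> w \<in> tangent_space A p \<Longrightarrow>
    g p w (u + v) = g p w u + g p w v"
  by (metis metric_add_left metric_sym subspace_add subspace_tangent_space)

lemma metric_scale_right:
  "u \<in> tangent_space A p \<Longrightarrow> w \<in> tangent_space A p \<Longrightarrow> g p w (c *\<^sub>R u) = c * g p w u"
  by (metis metric_scale_left metric_sym subspace_scale subspace_tangent_space)

lemma metric_zero:
  assumes "u \<in> tangent_space A p" shows "g p 0 u = 0" "g p u 0 = 0"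
  using metric_scale_left[OF assms assms, of 0] metric_scale_right[OF assms assms, of 0] by simp_all

lemma metric_diff_left:
  assumes "u \<in> tangent_space A p" "v \<in> tangent_space A p" "w \<in> tangent_space A p"
  shows "g p (u - v) w = g p u w - g p v w"
  using metric_add_left[OF subspace_diff[OF subspace_tangent_space assms(1,2)] assms(2,3)] by simp

lemma metric_minus_left:
  assumes "u \<in> tangent_space A p" "w \<in> tangent_space A p"
  shows "g p (- u) w = - g p u w"
  using metric_scale_left[OF assms, of "- 1"] by simp

lemma metric_eq_0: "u \<in> tangent_space A p \<Longrightarrow> g p u u = 0 \<Longrightarrow> u = 0"
  using metric_pos by force

lemma metric_nondegenerate:
  assumes "u \<in> tangent_space A p" "v \<in> tangent_space A p"
    "\<And>w. w \<in> tangent_space A p \<Longrightarrow> g p u w = g p v w"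
  shows "u = v"
proof -
  have uv: "u - v \<in> tangent_space A p" by (rule subspace_diff[OF subspace_tangent_space assms(1,2)])
  have "g p (u - v) (u - v) = 0" using metric_diff_left[OF assms(1,2) uv] assms(3)[OF uv] by simp
  then show ?thesis using metric_eq_0[OF uv] by simp
qed

lemma subspace_orthogonal:
  assumes "u \<in> tangent_space A p"
  shows "subspace {w \<in> tangent_space A p. g p u w = 0}"
  unfolding subspace_def using subspace_tangent_space[of p] assms
  by (auto simp: metric_zero metric_add_right metric_scale_right subspace_0 subspace_add subspace_scale)

lemma orthogonal_span:
  assumes "u \<in> tangent_space A p" "C \<subseteq> tangent_space A p" "\<And>c. c \<in> C \<Longrightarrow> g p u c = 0" "w \<in> span C"
  shows "g p u w = 0"
proof -
  have "span C \<subseteq> {w \<in> tangent_space A p. g p u w = 0}"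
    using assms(2,3) by (intro span_minimal subspace_orthogonal assms(1)) auto
  then show ?thesis using assms(4) by blast
qed

text \<open>Gram-Schmidt as an induction: to add \<open>b\<close>, correct the projection by the component along \<open>b\<close>
  minus its own projection. If \<open>b\<close> already lies in the span, that difference is \<open>0\<close> and so is the
  correction, division by zero being zero.\<close>

lemma orthogonal_projection_span:
  assumes "finite C" "C \<subseteq> tangent_space A p" "v \<in> tangent_space A p"
  shows "\<exists>k\<in>span C. \<forall>c\<in>C. g p (v - k) c = 0"
  using assms
proof (induction C arbitrary: v rule: finite_induct)
  case empty
  then show ?case by auto
next
  case (insert b C)
  have CT: "C \<subseteq> tangent_space A p" and bT: "b \<in> tangent_space A p" using insert.prems by auto
  have spanT: "span C \<subseteq> tangent_space A p" by (rule span_minimal[OF CT subspace_tangent_space])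
  obtain k where k: "k \<in> span C" "\<And>c. c \<in> C \<Longrightarrow> g p (v - k) c = 0"
    using insert.IH[OF CT insert.prems(2)] by blast
  obtain l where l: "l \<in> span C" "\<And>c. c \<in> C \<Longrightarrow> g p (b - l) c = 0"
    using insert.IH[OF CT bT] by blast
  define e where "e = b - l"
  have eT: "e \<in> tangent_space A p" unfolding e_def
    using l spanT bT by (intro subspace_diff subspace_tangent_space) auto
  have vkT: "v - k \<in> tangent_space A p"
    using k spanT insert.prems by (intro subspace_diff subspace_tangent_space) auto
  define r where "r = g p (v - k) e / g p e e"
  have reT: "r *\<^sub>R e \<in> tangent_space A p" by (intro subspace_scale subspace_tangent_space eT)
  have "g p (v - (k + r *\<^sub>R e)) c = 0" if c: "c \<in> C" for c
  proof -
    have cT: "c \<in> tangent_space A p" using c CT by blast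
    have "g p ((v - k) - r *\<^sub>R e) c = g p (v - k) c - r * g p e c"
      by (simp add: metric_diff_left[OF vkT reT cT] metric_scale_left[OF eT cT])
    then show ?thesis using k(2)[OF c] l(2)[OF c] by (simp add: e_def algebra_simps)
  qed
  note orth_C = this
  have rest: "v - (k + r *\<^sub>R e) \<in> tangent_space A p"
    using subspace_diff[OF subspace_tangent_space vkT reT] by (simp add: algebra_simps)
  have "g p ((v - k) - r *\<^sub>R e) e = g p (v - k) e - r * g p e e"
    by (simp add: metric_diff_left[OF vkT reT eT] metric_scale_left[OF eT eT])
  also have "\<dots> = 0"
    using metric_eq_0[OF eT] metric_zero[OF vkT] by (cases "e = 0") (auto simp: r_def)
  finally have orth_e: "g p (v - (k + r *\<^sub>R e)) e = 0" by (simp add: algebra_simps)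
  have "g p (v - (k + r *\<^sub>R e)) l = 0" by (rule orthogonal_span[OF rest CT orth_C l(1)])
  then have "g p (v - (k + r *\<^sub>R e)) (e + l) = 0"
    using orth_e metric_add_right[OF eT _ rest, of l] l(1) spanT by auto
  then have "\<forall>c\<in>insert b C. g p (v - (k + r *\<^sub>R e)) c = 0" using orth_C by (simp add: e_def)
  moreover have "k + r *\<^sub>R e \<in> span (insert b C)"
    unfolding e_def using k(1) l(1) span_mono[of C "insert b C"]
    by (intro span_add span_scale span_diff) (auto intro: span_base)
  ultimately show ?case by blast
qed

lemma orthogonal_projection:
  assumes K: "subspace K" "K \<subseteq> tangent_space A p" and v: "v \<in> tangent_space A p"
  shows "\<exists>k\<in>K. \<forall>w\<in>K. g p (v - k) w = 0"
proof -
  obtain W and B :: "'e set" and E x where W: "open W" "p \<in> W" "finite B"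
    and E: "\<And>b. b \<in> B \<Longrightarrow> E b \<in> vector_fields A" "\<And>b. b \<in> B \<Longrightarrow> smooth_fun A (x b)"
    and frame: "\<And>q v. q \<in> W \<Longrightarrow> v \<in> tangent_space A q \<Longrightarrow> v = (\<Sum>b\<in>B. v (x b) *\<^sub>R E b q)"
    and dual: "\<And>q b c. q \<in> W \<Longrightarrow> b \<in> B \<Longrightarrow> c \<in> B \<Longrightarrow> E b q (x c) = (if b = c then 1 else 0)"
    by (rule local_frame[of p]) (rule that)
  have T: "tangent_space A p \<subseteq> span ((\<lambda>b. E b p) ` B)"
  proof
    fix v assume "v \<in> tangent_space A p"
    then have "v = (\<Sum>b\<in>B. v (x b) *\<^sub>R E b p)" by (rule frame[OF W(2)])
    also have "\<dots> \<in> span ((\<lambda>b. E b p) ` B)"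
      by (intro span_sum span_scale span_base) auto
    finally show "v \<in> span ((\<lambda>b. E b p) ` B)" .
  qed
  obtain C where C: "C \<subseteq> K" "independent C" "K \<subseteq> span C"
    using maximal_independent_subset[of K] by blast
  have "finite C"
    using independent_span_bound[OF finite_imageI[OF W(3)] C(2)] C(1) K(2) T by blast
  moreover have "C \<subseteq> tangent_space A p" using C(1) K(2) by blast
  ultimately obtain k where k: "k \<in> span C" "\<forall>c\<in>C. g p (v - k) c = 0"
    using orthogonal_projection_span v by blast
  have "k \<in> K" using k(1) span_minimal[OF C(1) K(1)] by blast
  moreover have "g p (v - k) w = 0" if "w \<in> K" for w
  proof (rule orthogonal_span)
    show "v - k \<in> tangent_space A p"
      using \<open>k \<in> K\<close> K(2) v by (intro subspace_diff subspace_tangent_space) auto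
    show "C \<subseteq> tangent_space A p" by fact
    show "w \<in> span C" using that C(3) by blast
  qed (use k in blast)
  ultimately show ?thesis by blast
qed

text \<open>The same induction with smooth coefficients. The denominator \<open>g(e, e)\<close> is nonzero at \<open>p\<close> by
  independence there, hence has a smooth reciprocal near \<open>p\<close>. Quantifying over all fields \<open>Z\<close> with
  smooth pairings, rather than over smooth fields, lets the conclusion be applied to fields whose
  smoothness is in question.\<close>

lemma smooth_projection_onto_frame:
  assumes "finite S" "\<And>b. b \<in> S \<Longrightarrow> E b \<in> vector_fields A"
    and "\<And>k R. k \<in> S \<Longrightarrow> R \<subseteq> S - {k} \<Longrightarrow> E k p \<notin> span ((\<lambda>b. E b p) ` R)"
  shows "\<exists>V. open V \<and> p \<in> V \<and> (\<forall>Z. (\<forall>q. Z q \<in> tangent_space A q) \<and>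
      (\<forall>X\<in>vector_fields A. smooth_fun A (\<lambda>q. g q (Z q) (X q))) \<longrightarrow>
      (\<exists>P\<in>vector_fields A. \<forall>q\<in>V. P q \<in> span ((\<lambda>b. E b q) ` S) \<and>
        (\<forall>b\<in>S. g q (Z q - P q) (E b q) = 0)))"
  using assms
proof (induction S rule: finite_induct)
  case empty
  show ?case by (intro exI[of _ UNIV]) (auto intro!: bexI[of _ 0] vector_field_zero span_zero)
next
  case (insert k S)
  have ET: "E b q \<in> tangent_space A q" if "b \<in> insert k S" for b q
    using vector_fieldD(1)[OF insert.prems(1)[OF that]] .
  have ES: "E b \<in> vector_fields A" if "b \<in> S" for b using insert.prems(1) that by blast
  have indep: "E l p \<notin> span ((\<lambda>b. E b p) ` R)" if "l \<in> S" "R \<subseteq> S - {l}" for l R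
    using insert.prems(2)[of l R] that by blast
  obtain V where V: "open V" "p \<in> V"
    and IH: "\<And>Z. (\<forall>q. Z q \<in> tangent_space A q) \<Longrightarrow>
      (\<forall>X\<in>vector_fields A. smooth_fun A (\<lambda>q. g q (Z q) (X q))) \<Longrightarrow>
      (\<exists>P\<in>vector_fields A. \<forall>q\<in>V. P q \<in> span ((\<lambda>b. E b q) ` S) \<and>
        (\<forall>b\<in>S. g q (Z q - P q) (E b q) = 0))"
    using insert.IH[OF ES indep] by blast
  have Ek: "E k \<in> vector_fields A" using insert.prems(1) by blast
  obtain Q where Q: "Q \<in> vector_fields A" "\<And>q. q \<in> V \<Longrightarrow> Q q \<in> span ((\<lambda>b. E b q) ` S)"
    "\<And>q b. q \<in> V \<Longrightarrow> b \<in> S \<Longrightarrow> g q (E k q - Q q) (E b q) = 0"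
    using IH[of "E k"] metric_smooth[OF Ek] vector_fieldD(1)[OF Ek] by blast
  define e where "e = E k - Q"
  have e: "e \<in> vector_fields A" unfolding e_def by (rule vector_field_diff[OF Ek Q(1)])
  have eT: "e q \<in> tangent_space A q" for q by (rule vector_fieldD(1)[OF e])
  have "E k p \<notin> span ((\<lambda>b. E b p) ` S)" using insert.prems(2)[of k S] insert.hyps by blast
  then have "e p \<noteq> 0" using Q(2)[OF V(2)] by (auto simp: e_def)
  then have "g p (e p) (e p) \<noteq> 0" using metric_pos[OF eT] by force
  then have "\<exists>\<gamma> V'. smooth_fun A \<gamma> \<and> open V' \<and> p \<in> V' \<and> (\<forall>q\<in>V'. \<gamma> q * g q (e q) (e q) = 1)"
    by (rule smooth_fun_reciprocal[OF metric_smooth[OF e e]])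
  then obtain \<gamma> V' where \<gamma>: "smooth_fun A \<gamma>" "open V'" "p \<in> V'"
    "\<And>q. q \<in> V' \<Longrightarrow> \<gamma> q * g q (e q) (e q) = 1"
    by blast
  have "\<exists>P\<in>vector_fields A. \<forall>q\<in>V \<inter> V'. P q \<in> span ((\<lambda>b. E b q) ` insert k S) \<and>
        (\<forall>b\<in>insert k S. g q (Z q - P q) (E b q) = 0)"
    if ZT: "\<forall>q. Z q \<in> tangent_space A q"
      and Z: "\<forall>X\<in>vector_fields A. smooth_fun A (\<lambda>q. g q (Z q) (X q))" for Z
  proof -
    obtain R where R: "R \<in> vector_fields A" "\<And>q. q \<in> V \<Longrightarrow> R q \<in> span ((\<lambda>b. E b q) ` S)"
      "\<And>q b. q \<in> V \<Longrightarrow> b \<in> S \<Longrightarrow> g q (Z q - R q) (E b q) = 0"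
      using IH[OF ZT Z] by blast
    define r where "r q = \<gamma> q * g q (Z q - R q) (e q)" for q
    define P where "P = R + (\<lambda>q. r q *\<^sub>R e q)"
    have ZR: "g q (Z q - R q) (e q) = g q (Z q) (e q) - g q (R q) (e q)" for q
      using metric_diff_left[OF _ vector_fieldD(1)[OF R(1)] eT] ZT by blast
    have "smooth_fun A r"
      unfolding r_def ZR
      by (intro smooth_fun_mult smooth_fun_diff \<gamma>(1) Z[rule_format] e metric_smooth R(1))
    then have P: "P \<in> vector_fields A"
      unfolding P_def by (intro vector_field_add vector_field_scale R(1) e)
    have "P q \<in> span ((\<lambda>b. E b q) ` insert k S)" if q: "q \<in> V \<inter> V'" for q
    proof -
      have sub: "span ((\<lambda>b. E b q) ` S) \<subseteq> span ((\<lambda>b. E b q) ` insert k S)"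
        by (intro span_mono) auto
      have "R q \<in> span ((\<lambda>b. E b q) ` insert k S)" "Q q \<in> span ((\<lambda>b. E b q) ` insert k S)"
        using R(2) Q(2) q sub by blast+
      moreover have "E k q \<in> span ((\<lambda>b. E b q) ` insert k S)" by (rule span_base) simp
      ultimately show ?thesis unfolding P_def e_def
        by (simp add: span_add span_scale span_diff)
    qed
    moreover have "g q (Z q - P q) (E b q) = 0" if q: "q \<in> V \<inter> V'" and b: "b \<in> insert k S" for q b
    proof -
      have ZRT: "Z q - R q \<in> tangent_space A q"
        by (intro subspace_diff subspace_tangent_space vector_fieldD(1)[OF R(1)]) (use ZT in blast)
      have reT: "r q *\<^sub>R e q \<in> tangent_space A q" by (intro subspace_scale subspace_tangent_space eT)
      have ZP: "Z q - P q = (Z q - R q) - r q *\<^sub>R e q" by (simp add: P_def)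
      have ZPT: "Z q - P q \<in> tangent_space A q"
        unfolding ZP by (rule subspace_diff[OF subspace_tangent_space ZRT reT])
      have *: "g q (Z q - P q) w = g q (Z q - R q) w - r q * g q (e q) w"
        if "w \<in> tangent_space A q" for w
        unfolding ZP by (simp add: metric_diff_left[OF ZRT reT that] metric_scale_left[OF eT that])
      have orth_S: "g q (Z q - P q) (E c q) = 0" if c: "c \<in> S" for c
      proof -
        have "g q (e q) (E c q) = 0" using Q(3) q c by (simp add: e_def)
        then show ?thesis using *[OF ET] R(3) q c by simp
      qed
      have orth_e: "g q (Z q - P q) (e q) = 0"
        using *[OF eT] \<gamma>(4) q by (simp add: r_def)
      have orth_Q: "g q (Z q - P q) (Q q) = 0"
        using orthogonal_span[OF ZPT _ _ Q(2), of q] orth_S ET q by auto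
      show ?thesis
      proof (cases "b = k")
        case True
        have "g q (Z q - P q) (e q + Q q) = 0"
          using metric_add_right[OF eT vector_fieldD(1)[OF Q(1)] ZPT] orth_e orth_Q by simp
        then show ?thesis using True by (simp add: e_def)
      qed (use b orth_S in blast)
    qed
    ultimately show ?thesis using P by blast
  qed
  moreover have "open (V \<inter> V')" "p \<in> V \<inter> V'" using V \<gamma>(2,3) by auto
  ultimately show ?case by blast
qed

text \<open>Passing from a smooth covector field to its dual field keeps smoothness: near each point the field equals its smooth
  projection onto a full frame.\<close>

theorem smooth_if_smooth_pairings:
  assumes T: "\<And>q. Z q \<in> tangent_space A q"
    and smooth: "\<And>X. X \<in> vector_fields A \<Longrightarrow> smooth_fun A (\<lambda>q. g q (Z q) (X q))"
  shows "Z \<in> vector_fields A"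
proof (rule vector_fieldI_locally[OF T])
  fix p
  obtain W and B :: "'e set" and E x where W: "open W" "p \<in> W" "finite B"
    and E: "\<And>b. b \<in> B \<Longrightarrow> E b \<in> vector_fields A" "\<And>b. b \<in> B \<Longrightarrow> smooth_fun A (x b)"
    and frame: "\<And>q v. q \<in> W \<Longrightarrow> v \<in> tangent_space A q \<Longrightarrow> v = (\<Sum>b\<in>B. v (x b) *\<^sub>R E b q)"
    and dual: "\<And>q b c. q \<in> W \<Longrightarrow> b \<in> B \<Longrightarrow> c \<in> B \<Longrightarrow> E b q (x c) = (if b = c then 1 else 0)"
    by (rule local_frame[of p]) (rule that)
  have indep: "E k p \<notin> span ((\<lambda>b. E b p) ` R)" if k: "k \<in> B" "R \<subseteq> B - {k}" for k R
  proof
    assume *: "E k p \<in> span ((\<lambda>b. E b p) ` R)"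
    have "subspace {v. v (x k) = 0}"
      by (auto simp: subspace_def scaleR_fun_def)
    moreover have "(\<lambda>b. E b p) ` R \<subseteq> {v. v (x k) = 0}"
    proof (clarsimp)
      fix b assume "b \<in> R"
      then have "b \<in> B" "b \<noteq> k" using k(2) by auto
      then show "E b p (x k) = 0" using dual[OF W(2) _ k(1)] by simp
    qed
    ultimately have "span ((\<lambda>b. E b p) ` R) \<subseteq> {v. v (x k) = 0}" by (intro span_minimal)
    then show False using * dual[OF W(2) k(1) k(1)] by auto
  qed
  have "\<exists>V. open V \<and> p \<in> V \<and> (\<forall>Z. (\<forall>q. Z q \<in> tangent_space A q) \<and>
      (\<forall>X\<in>vector_fields A. smooth_fun A (\<lambda>q. g q (Z q) (X q))) \<longrightarrow>
      (\<exists>P\<in>vector_fields A. \<forall>q\<in>V. P q \<in> span ((\<lambda>b. E b q) ` B) \<and>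
        (\<forall>b\<in>B. g q (Z q - P q) (E b q) = 0)))"
    by (rule smooth_projection_onto_frame[OF W(3) E(1) indep])
  then obtain V where V: "open V" "p \<in> V" and proj: "\<forall>Z. (\<forall>q. Z q \<in> tangent_space A q) \<and>
      (\<forall>X\<in>vector_fields A. smooth_fun A (\<lambda>q. g q (Z q) (X q))) \<longrightarrow>
      (\<exists>P\<in>vector_fields A. \<forall>q\<in>V. P q \<in> span ((\<lambda>b. E b q) ` B) \<and>
        (\<forall>b\<in>B. g q (Z q - P q) (E b q) = 0))"
    by (elim exE conjE) (rule that)
  have "\<exists>P\<in>vector_fields A. \<forall>q\<in>V. P q \<in> span ((\<lambda>b. E b q) ` B) \<and>
        (\<forall>b\<in>B. g q (Z q - P q) (E b q) = 0)"
    by (rule proj[THEN spec, THEN mp]) (intro conjI allI ballI T smooth)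
  then obtain P where P: "P \<in> vector_fields A"
    and orth: "\<And>q b. q \<in> V \<Longrightarrow> b \<in> B \<Longrightarrow> g q (Z q - P q) (E b q) = 0"
    by blast
  have "Z q = P q" if q: "q \<in> V \<inter> W" for q
  proof -
    have ZP: "Z q - P q \<in> tangent_space A q"
      by (intro subspace_diff subspace_tangent_space T vector_fieldD(1)[OF P])
    have "Z q - P q = (\<Sum>b\<in>B. (Z q - P q) (x b) *\<^sub>R E b q)" by (rule frame[OF _ ZP]) (use q in blast)
    also have "\<dots> \<in> span ((\<lambda>b. E b q) ` B)" by (intro span_sum span_scale span_base) auto
    finally have mem: "Z q - P q \<in> span ((\<lambda>b. E b q) ` B)" .
    have "g q (Z q - P q) (Z q - P q) = 0"
    proof (rule orthogonal_span[OF ZP _ _ mem])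
      show "(\<lambda>b. E b q) ` B \<subseteq> tangent_space A q" using vector_fieldD(1)[OF E(1)] by blast
      show "g q (Z q - P q) c = 0" if "c \<in> (\<lambda>b. E b q) ` B" for c using orth q that by blast
    qed
    then show ?thesis using metric_eq_0[OF ZP] by simp
  qed
  then show "\<exists>V Y. open V \<and> p \<in> V \<and> Y \<in> vector_fields A \<and> (\<forall>q\<in>V. Z q = Y q)"
    using V W(1,2) P by (intro exI[of _ "V \<inter> W"] exI[of _ P]) blast
qed

end


section \<open>Riemannian submersions\<close>

lemma differential_linear:
  "differential B F (u + v) = differential B F u + differential B F v"
  "differential B F (c *\<^sub>R u) = c *\<^sub>R differential B F u"
  "differential B F 0 = 0"
  by (rule ext, simp add: differential_def scaleR_fun_def)+

lemma differential_diff: "differential B F (u - v) = differential B F u - differential B F v"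
  by (rule ext, simp add: differential_def)

text \<open>Two candidates for the component differ by an element of both subspaces.\<close>

lemma component_eq:
  assumes "subspace S" "subspace T" "S \<inter> T \<subseteq> {0}" "a \<in> S" "v - a \<in> T"
  shows "component S T v = a"
  unfolding component_def
proof (rule the_equality)
  fix b assume b: "b \<in> S \<and> v - b \<in> T"
  have "(v - a) - (v - b) \<in> T" by (rule subspace_diff[OF assms(2,5)]) (use b in blast)
  then have "b - a \<in> T" by (simp add: algebra_simps)
  moreover have "b - a \<in> S" by (rule subspace_diff[OF assms(1) _ assms(4)]) (use b in blast)
  ultimately have "b - a = 0" using assms(3) by blast
  then show "b = a" by simp
qed (use assms in blast)

lemma connection_onD:
  assumes "connection_on A \<Gamma> nab" "X \<in> vector_fields A" "s \<in> \<Gamma>"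
  shows "nab X s \<in> \<Gamma>"
    "Y \<in> vector_fields A \<Longrightarrow> nab (X + Y) s = nab X s + nab Y s"
    "t \<in> \<Gamma> \<Longrightarrow> nab X (s + t) = nab X s + nab X t"
    "smooth_fun A f \<Longrightarrow> nab (\<lambda>p. f p *\<^sub>R X p) s = (\<lambda>p. f p *\<^sub>R nab X s p)"
    "smooth_fun A f \<Longrightarrow> nab X (\<lambda>p. f p *\<^sub>R s p) = (\<lambda>p. X p f *\<^sub>R s p + f p *\<^sub>R nab X s p)"
proof -
  note c = assms(1)[unfolded connection_on_def, THEN conjunct1]
    assms(1)[unfolded connection_on_def, THEN conjunct2, THEN conjunct1]
    assms(1)[unfolded connection_on_def, THEN conjunct2, THEN conjunct2, THEN conjunct1]
    assms(1)[unfolded connection_on_def, THEN conjunct2, THEN conjunct2, THEN conjunct2]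
  show "nab X s \<in> \<Gamma>" by (rule c(1)[rule_format, OF assms(2,3)])
  show "nab (X + Y) s = nab X s + nab Y s" if "Y \<in> vector_fields A"
    by (rule c(2)[rule_format, OF assms(2) that assms(3)])
  show "nab X (s + t) = nab X s + nab X t" if "t \<in> \<Gamma>"
    by (rule c(3)[rule_format, OF assms(2,3) that])
  show "nab (\<lambda>p. f p *\<^sub>R X p) s = (\<lambda>p. f p *\<^sub>R nab X s p)" if "smooth_fun A f"
    by (rule c(4)[THEN bspec, OF assms(2), THEN bspec, OF assms(3), THEN spec, THEN mp, OF that, THEN conjunct1])
  show "nab X (\<lambda>p. f p *\<^sub>R s p) = (\<lambda>p. X p f *\<^sub>R s p + f p *\<^sub>R nab X s p)" if "smooth_fun A f"
    by (rule c(4)[THEN bspec, OF assms(2), THEN bspec, OF assms(3), THEN spec, THEN mp, OF that, THEN conjunct2])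
qed

lemma connection_on_zero:
  assumes "connection_on A \<Gamma> nab"
  shows "X \<in> vector_fields A \<Longrightarrow> 0 \<in> \<Gamma> \<Longrightarrow> nab X 0 = 0"
    and "0 \<in> vector_fields A \<Longrightarrow> s \<in> \<Gamma> \<Longrightarrow> nab 0 s = 0"
proof -
  show "nab X 0 = 0" if "X \<in> vector_fields A" "0 \<in> \<Gamma>"
    using connection_onD(3)[OF assms that that(2)] by (metis add_0 add_left_cancel add.right_neutral)
  show "nab 0 s = 0" if "0 \<in> vector_fields A" "s \<in> \<Gamma>"
    using connection_onD(2)[OF assms that that(1)] by (metis add_0 add_left_cancel add.right_neutral)
qed

locale riem_submersion = dom: riemannian_manifold A g + cod: riemannian_manifold B h
  for A :: "('m::{t2_space,second_countable_topology}, 'e::{real_inner,heine_borel}) atlas"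
    and g :: "'m \<Rightarrow> 'm tvec \<Rightarrow> 'm tvec \<Rightarrow> real"
    and B :: "('n::{t2_space,second_countable_topology}, 'd::{real_inner,heine_borel}) atlas"
    and h :: "'n \<Rightarrow> 'n tvec \<Rightarrow> 'n tvec \<Rightarrow> real" +
  fixes F :: "'m \<Rightarrow> 'n"
  assumes submersion: "riemannian_submersion A g B h F"
begin

abbreviation dF :: "'m tvec \<Rightarrow> 'n tvec" where "dF \<equiv> differential B F"
abbreviation vert :: "'m \<Rightarrow> 'm tvec set" where "vert \<equiv> ker_dist A B F"
abbreviation hor :: "'m \<Rightarrow> 'm tvec set" where "hor \<equiv> hor_dist A g B F"

lemma smooth_map: "smooth_map A B F"
  using submersion unfolding riemannian_submersion_def by (elim conjE)

lemma continuous_F: "continuous_on UNIV F"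
  using smooth_map unfolding smooth_map_def by (rule conjunct1)

lemma dF_image: "dF ` tangent_space A p = tangent_space B (F p)"
proof -
  have "\<forall>p. dF ` tangent_space A p = tangent_space B (F p)"
    using submersion unfolding riemannian_submersion_def by (elim conjE)
  then show ?thesis by (rule spec)
qed

lemma dF_tangent: "u \<in> tangent_space A p \<Longrightarrow> dF u \<in> tangent_space B (F p)"
  unfolding dF_image[symmetric] by (rule imageI)

text \<open>Read in charts, \<open>f \<circ> F\<close> is the chart expression of \<open>f\<close> after that of \<open>F\<close>.\<close>

lemma smooth_in_pullback:
  assumes f: "smooth_fun B f" and d: "(V, \<psi>) \<in> B"
  shows "smooth_in A (F -` V) (f \<circ> F)"
proof -
  obtain C :: "'d set" where C: "orthonormal_basis C" using cod.basis_exists by blast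
  have oV: "open (F -` V)" using cod.chart(1)[OF d] continuous_F by (rule open_vimage)
  have "smooth_on (\<phi> ` (U \<inter> F -` V)) ((f \<circ> F) \<circ> inv_into U \<phi>)" if c: "(U, \<phi>) \<in> A" for U \<phi>
  proof -
    let ?S = "\<phi> ` (U \<inter> F -` V)"
    have oS: "open ?S" by (rule dom.chart_image_open[OF c oV])
    have "\<forall>(U, \<phi>)\<in>A. \<forall>(V, \<psi>)\<in>B. smooth_on (\<phi> ` (U \<inter> F -` V)) (\<psi> \<circ> F \<circ> inv_into U \<phi>)"
      using smooth_map unfolding smooth_map_def by (elim conjE)
    from bspec[OF this c] have 1: "smooth_on ?S (\<psi> \<circ> F \<circ> inv_into U \<phi>)" using d by auto
    have 2: "smooth_on (\<psi> ` V) (f \<circ> inv_into V \<psi>)" using f d by (auto simp: smooth_fun_def)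
    have comp: "smooth_on ?S (\<lambda>x. (f \<circ> inv_into V \<psi>) ((\<psi> \<circ> F \<circ> inv_into U \<phi>) x))"
      by (rule smooth_on_compose[OF C oS cod.chart(2)[OF d] _ 1 2])
        (auto simp: dom.chart_inv[OF c])
    have eq: "(f \<circ> inv_into V \<psi>) ((\<psi> \<circ> F \<circ> inv_into U \<phi>) x) = ((f \<circ> F) \<circ> inv_into U \<phi>) x"
      if "x \<in> ?S" for x
      using that dom.chart_inv[OF c] cod.chart_inv[OF d] by auto
    show ?thesis by (rule smooth_on_cong[OF oS eq, THEN iffD1, OF _ comp])
  qed
  then show ?thesis unfolding smooth_in_def by blast
qed

lemma smooth_pullback:
  assumes "smooth_fun B f" shows "smooth_fun A (f \<circ> F)"
proof (rule dom.smooth_funI_locally)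
  fix p
  obtain V \<psi> where d: "(V, \<psi>) \<in> B" "F p \<in> V" using cod.chart_exists by blast
  have "open (F -` V)" using cod.chart(1)[OF d(1)] continuous_F by (rule open_vimage)
  then show "\<exists>V k. open V \<and> p \<in> V \<and> smooth_in A V k \<and> (\<forall>q\<in>V. (f \<circ> F) q = k q)"
    using smooth_in_pullback[OF assms d(1)] d(2)
    by (intro exI[of _ "F -` V"] exI[of _ "f \<circ> F"]) simp
qed

lemma subspace_vert: "subspace (vert p)"
proof -
  have "subspace {v. dF v = 0}" by (rule subspaceI) (simp_all add: differential_linear)
  then have "subspace (tangent_space A p \<inter> {v. dF v = 0})"
    by (rule subspace_inter[OF dom.subspace_tangent_space])
  moreover have "vert p = tangent_space A p \<inter> {v. dF v = 0}" by (auto simp: ker_dist_def)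
  ultimately show ?thesis by simp
qed

lemma vert_tangent: "v \<in> vert p \<Longrightarrow> v \<in> tangent_space A p" "v \<in> vert p \<Longrightarrow> dF v = 0"
  by (auto simp: ker_dist_def)

lemma vertI: "v \<in> tangent_space A p \<Longrightarrow> dF v = 0 \<Longrightarrow> v \<in> vert p"
  by (auto simp: ker_dist_def)

lemma hor_tangent: "v \<in> hor p \<Longrightarrow> v \<in> tangent_space A p"
  by (auto simp: hor_dist_def orth_compl_in_def)

lemma hor_orth:
  assumes "v \<in> hor p" "w \<in> vert p"
  shows "g p v w = 0" "g p w v = 0"
proof -
  show "g p v w = 0" using assms by (simp add: hor_dist_def orth_compl_in_def)
  then show "g p w v = 0"
    using dom.metric_sym[OF hor_tangent[OF assms(1)] vert_tangent(1)[OF assms(2)]] by simp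
qed

lemma horI: "v \<in> tangent_space A p \<Longrightarrow> (\<And>w. w \<in> vert p \<Longrightarrow> g p v w = 0) \<Longrightarrow> v \<in> hor p"
  by (simp add: hor_dist_def orth_compl_in_def)

lemma subspace_orth_compl:
  assumes "subspace S" "S \<subseteq> tangent_space A p" "R \<subseteq> tangent_space A p"
  shows "subspace (orth_compl_in (g p) S R)"
  unfolding orth_compl_in_def
proof (rule subspaceI; (intro CollectI conjI ballI)?)
  show "0 \<in> S" by (rule subspace_0[OF assms(1)])
  show "g p 0 w = 0" if "w \<in> R" for w using dom.metric_zero(1) assms(3) that by blast
next
  fix u v assume uv: "u \<in> {v \<in> S. \<forall>w\<in>R. g p v w = 0}" "v \<in> {v \<in> S. \<forall>w\<in>R. g p v w = 0}"
  then show "u + v \<in> S" using subspace_add[OF assms(1)] by blast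
  show "g p (u + v) w = 0" if w: "w \<in> R" for w
    using dom.metric_add_left[of u p v w] uv assms(2,3) w by (simp add: subset_iff)
next
  fix c u assume u: "u \<in> {v \<in> S. \<forall>w\<in>R. g p v w = 0}"
  then show "c *\<^sub>R u \<in> S" using subspace_scale[OF assms(1)] by blast
  show "g p (c *\<^sub>R u) w = 0" if w: "w \<in> R" for w
    using dom.metric_scale_left[of u p w c] u assms(2,3) w by (simp add: subset_iff)
qed

lemma subspace_hor: "subspace (hor p)"
  unfolding hor_dist_def using dom.subspace_tangent_space vert_tangent(1)
  by (intro subspace_orth_compl) auto

lemma vert_Int_hor: "vert p \<inter> hor p \<subseteq> {0}"
  using hor_orth(1) dom.metric_eq_0 vert_tangent(1) by blast

lemma vert_hor_decomposition:
  assumes "v \<in> tangent_space A p"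
  shows "\<exists>k\<in>vert p. v - k \<in> hor p"
proof -
  obtain k where k: "k \<in> vert p" "\<forall>w\<in>vert p. g p (v - k) w = 0"
    using dom.orthogonal_projection[OF subspace_vert _ assms] vert_tangent(1) by blast
  have "v - k \<in> tangent_space A p"
    by (intro subspace_diff dom.subspace_tangent_space assms vert_tangent(1)[OF k(1)])
  then have "v - k \<in> hor p" using k(2) by (intro horI) blast+
  then show ?thesis using k(1) by blast
qed

lemma vert_proj_eq: "a \<in> vert p \<Longrightarrow> X p - a \<in> hor p \<Longrightarrow> vert_proj A g B F X p = a"
  unfolding vert_proj_def by (rule component_eq[OF subspace_vert subspace_hor vert_Int_hor])

lemma hor_proj_eq: "a \<in> vert p \<Longrightarrow> X p - a \<in> hor p \<Longrightarrow> hor_proj A g B F X p = X p - a"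
  unfolding hor_proj_def using vert_Int_hor
  by (intro component_eq[OF subspace_hor subspace_vert]) auto

lemma projections:
  assumes X: "X \<in> vector_fields A"
  shows "vert_proj A g B F X p \<in> vert p" "hor_proj A g B F X p \<in> hor p"
    "vert_proj A g B F X p + hor_proj A g B F X p = X p"
proof -
  obtain k where k: "k \<in> vert p" "X p - k \<in> hor p" using vert_hor_decomposition[OF dom.vector_fieldD(1)[OF X]] by blast
  show "vert_proj A g B F X p \<in> vert p" "hor_proj A g B F X p \<in> hor p"
    "vert_proj A g B F X p + hor_proj A g B F X p = X p"
    using k by (simp_all add: vert_proj_eq[where X = X, OF k] hor_proj_eq[where X = X, OF k])
qed

lemma dF_isometry:
  assumes u: "u \<in> hor p" and v: "v \<in> hor p"
  shows "h (F p) (dF u) (dF v) = g p u v"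
proof -
  have norm: "h (F p) (dF w) (dF w) = g p w w" if "w \<in> hor p" for w
  proof -
    have "\<forall>p. \<forall>u\<in>hor p. sqrt (h (F p) (dF u) (dF u)) = sqrt (g p u u)"
      using submersion unfolding riemannian_submersion_def by (elim conjE)
    then have "sqrt (h (F p) (dF w) (dF w)) = sqrt (g p w w)" using that by blast
    then show ?thesis by (rule real_sqrt_eq_iff[THEN iffD1])
  qed
  note T = hor_tangent[OF u] hor_tangent[OF v]
  note uv = subspace_add[OF dom.subspace_tangent_space T]
  note T' = dF_tangent[OF T(1)] dF_tangent[OF T(2)]
  note uv' = subspace_add[OF cod.subspace_tangent_space T']
  have "g p (u + v) (u + v) = g p u u + 2 * g p u v + g p v v"
    using dom.metric_add_left[OF T uv] dom.metric_add_right[OF T T(1)] dom.metric_add_right[OF T T(2)]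
      dom.metric_sym[OF T] by simp
  moreover have "h (F p) (dF u + dF v) (dF u + dF v) =
      h (F p) (dF u) (dF u) + 2 * h (F p) (dF u) (dF v) + h (F p) (dF v) (dF v)"
    using cod.metric_add_left[OF T' uv'] cod.metric_add_right[OF T' T'(1)]
      cod.metric_add_right[OF T' T'(2)] cod.metric_sym[OF T'] by simp
  ultimately show ?thesis
    using norm[OF u] norm[OF v] norm[OF subspace_add[OF subspace_hor u v]] by (simp add: differential_linear)
qed

text \<open>The vertical part of \<open>v\<close> contributes to neither side.\<close>

lemma metric_hor:
  assumes "v \<in> tangent_space A p" "z \<in> hor p"
  shows "g p v z = h (F p) (dF v) (dF z)"
proof -
  obtain k where k: "k \<in> vert p" "v - k \<in> hor p" using vert_hor_decomposition[OF assms(1)] by blast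
  have "g p v z = g p (v - k) z"
    using dom.metric_diff_left[OF assms(1) vert_tangent(1)[OF k(1)] hor_tangent[OF assms(2)]]
      hor_orth(2)[OF assms(2) k(1)] by simp
  also have "\<dots> = h (F p) (dF (v - k)) (dF z)" by (rule dF_isometry[OF k(2) assms(2), symmetric])
  also have "dF (v - k) = dF v" using vert_tangent(2)[OF k(1)] by (simp add: differential_diff)
  finally show ?thesis .
qed

lemma horizontal_lift:
  assumes "w \<in> tangent_space B (F p)"
  shows "\<exists>z\<in>hor p. dF z = w"
proof -
  obtain u where u: "u \<in> tangent_space A p" "w = dF u" using assms dF_image[of p] by blast
  obtain k where k: "k \<in> vert p" "u - k \<in> hor p" using vert_hor_decomposition[OF u(1)] by blast
  have "dF (u - k) = w" using vert_tangent(2)[OF k(1)] u by (simp add: differential_diff)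
  then show ?thesis using k by blast
qed

text \<open>Fields along \<open>F\<close> need not extend to fields on the target. Near a point they are combinations of
  a frame of the target with coefficients that are smooth on the source, which reduces the claim to
  the metric coefficients in that frame.\<close>

lemma smooth_pairing_along:
  assumes s: "s \<in> sections_along A B F" and t: "t \<in> sections_along A B F"
  shows "smooth_fun A (\<lambda>p. h (F p) (s p) (t p))"
proof (rule dom.smooth_funI_locally)
  fix p
  obtain W and C :: "'d set" and E x where W: "open W" "F p \<in> W" "finite C"
    and E: "\<And>b. b \<in> C \<Longrightarrow> E b \<in> vector_fields B" "\<And>b. b \<in> C \<Longrightarrow> smooth_fun B (x b)"
    and frame: "\<And>q v. q \<in> W \<Longrightarrow> v \<in> tangent_space B q \<Longrightarrow> v = (\<Sum>b\<in>C. v (x b) *\<^sub>R E b q)"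
    and dual: "\<And>q b c. q \<in> W \<Longrightarrow> b \<in> C \<Longrightarrow> c \<in> C \<Longrightarrow> E b q (x c) = (if b = c then 1 else 0)"
    by (rule cod.local_frame[of "F p"]) (rule that)
  have sT: "s q \<in> tangent_space B (F q)" "t q \<in> tangent_space B (F q)" for q
    using s t by (auto simp: sections_along_def)
  have st: "smooth_fun A (\<lambda>q. s q f)" "smooth_fun A (\<lambda>q. t q f)" if "smooth_fun B f" for f
    using s t that by (auto simp: sections_along_def)
  let ?k = "\<lambda>q. \<Sum>b\<in>C. \<Sum>c\<in>C. s q (x b) * (t q (x c) * ((\<lambda>r. h r (E b r) (E c r)) \<circ> F) q)"
  have "smooth_fun A ?k"
    by (intro dom.smooth_fun_sum dom.smooth_fun_mult st smooth_pullback cod.metric_smooth E)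
  have sum_left: "h r (\<Sum>b\<in>C'. a b *\<^sub>R E b r) w = (\<Sum>b\<in>C'. a b * h r (E b r) w)"
    if "C' \<subseteq> C" "w \<in> tangent_space B r" for C' a r w
    using finite_subset[OF that(1) W(3)] that(1)
  proof (induction C' rule: finite_induct)
    case empty
    show ?case unfolding sum.empty by (rule cod.metric_zero(1)[OF that(2)])
  next
    case (insert b C')
    have b: "E b r \<in> tangent_space B r" using cod.vector_fieldD(1)[OF E(1)] insert.prems by blast
    have S: "(\<Sum>b\<in>C'. a b *\<^sub>R E b r) \<in> tangent_space B r"
      using insert.prems cod.vector_fieldD(1)[OF E(1)]
      by (intro subspace_sum subspace_scale cod.subspace_tangent_space) auto
    have IH: "h r (\<Sum>b\<in>C'. a b *\<^sub>R E b r) w = (\<Sum>b\<in>C'. a b * h r (E b r) w)"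
      using insert.IH insert.prems by blast
    show ?case
      unfolding sum.insert[OF insert.hyps] IH[symmetric]
        cod.metric_add_left[OF subspace_scale[OF cod.subspace_tangent_space b] S that(2)]
        cod.metric_scale_left[OF b that(2)] ..
  qed
  have "h (F q) (s q) (t q) = ?k q" if q: "F q \<in> W" for q
  proof -
    have ET: "E b (F q) \<in> tangent_space B (F q)" if "b \<in> C" for b
      by (rule cod.vector_fieldD(1)[OF E(1)[OF that]])
    have 1: "h (F q) (s q) w = (\<Sum>b\<in>C. s q (x b) * h (F q) (E b (F q)) w)"
      if "w \<in> tangent_space B (F q)" for w
      using sum_left[OF order.refl that, of "\<lambda>b. s q (x b)"] frame[OF q sT(1)] by simp
    have 2: "h (F q) w (t q) = (\<Sum>c\<in>C. t q (x c) * h (F q) w (E c (F q)))"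
      if w: "w \<in> tangent_space B (F q)" for w
    proof -
      have "h (F q) w (t q) = h (F q) (t q) w" by (rule cod.metric_sym[OF w sT(2)])
      also have "\<dots> = (\<Sum>c\<in>C. t q (x c) * h (F q) (E c (F q)) w)"
        using sum_left[OF order.refl w, of "\<lambda>b. t q (x b)"] frame[OF q sT(2)] by simp
      also have "\<dots> = (\<Sum>c\<in>C. t q (x c) * h (F q) w (E c (F q)))"
        by (intro sum.cong refl arg_cong2[where f = "(*)"] cod.metric_sym[OF ET w])
      finally show ?thesis .
    qed
    show ?thesis
      unfolding 1[OF sT(2)] by (intro sum.cong refl) (simp add: 2[OF ET] sum_distrib_left)
  qed
  moreover have "open (F -` W)" using W(1) continuous_F by (rule open_vimage)
  ultimately show "\<exists>V k. open V \<and> p \<in> V \<and> smooth_in A V k \<and> (\<forall>q\<in>V. h (F q) (s q) (t q) = k q)"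
    using W(2) smooth_in_smooth_fun[OF \<open>smooth_fun A ?k\<close>, of "F -` W"]
    by (intro exI[of _ "F -` W"] exI[of _ ?k]) simp
qed

lemma section_along_dF:
  assumes "X \<in> vector_fields A"
  shows "(\<lambda>q. dF (X q)) \<in> sections_along A B F"
  unfolding sections_along_def
proof (intro CollectI conjI allI impI)
  show "dF (X p) \<in> tangent_space B (F p)" for p by (rule dF_tangent[OF dom.vector_fieldD(1)[OF assms]])
  fix f assume f: "smooth_fun B f"
  show "smooth_fun A (\<lambda>p. dF (X p) f)"
    using dom.vector_fieldD(2)[OF assms smooth_pullback[OF f]] by (simp add: differential_def f)
qed

lemma section_along_compose:
  assumes "W \<in> vector_fields B"
  shows "W \<circ> F \<in> sections_along A B F"
  unfolding sections_along_def
proof (intro CollectI conjI allI impI)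
  show "(W \<circ> F) p \<in> tangent_space B (F p)" for p using cod.vector_fieldD(1)[OF assms] by simp
  fix f assume f: "smooth_fun B f"
  show "smooth_fun A (\<lambda>p. (W \<circ> F) p f)"
    using smooth_pullback[OF cod.vector_fieldD(2)[OF assms f]] by (simp add: o_def)
qed

text \<open>For horizontal \<open>Z\<close> the pairing \<open>g(Z, X)\<close> is \<open>h(F\<^sub>*Z, F\<^sub>*X)\<close>, which only involves smooth fields along
  \<open>F\<close>. This gives smoothness of horizontal projections and of horizontal lifts at once.\<close>

lemma horizontal_smooth:
  assumes Z: "\<And>p. Z p \<in> hor p" and s: "(\<lambda>p. dF (Z p)) \<in> sections_along A B F"
  shows "Z \<in> vector_fields A"
proof (rule dom.smooth_if_smooth_pairings)
  show "Z p \<in> tangent_space A p" for p by (rule hor_tangent[OF Z])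
  fix X assume X: "X \<in> vector_fields A"
  have "g q (Z q) (X q) = h (F q) (dF (X q)) (dF (Z q))" for q
    using metric_hor[OF dom.vector_fieldD(1)[OF X] Z]
      dom.metric_sym[OF hor_tangent[OF Z] dom.vector_fieldD(1)[OF X]] by simp
  then show "smooth_fun A (\<lambda>q. g q (Z q) (X q))"
    using smooth_pairing_along[OF section_along_dF[OF X] s] by simp
qed

lemma hor_proj_smooth:
  assumes X: "X \<in> vector_fields A"
  shows "hor_proj A g B F X \<in> vector_fields A"
proof (rule horizontal_smooth)
  note P = projections[OF X]
  show "hor_proj A g B F X p \<in> hor p" for p by (rule P(2))
  have "dF (hor_proj A g B F X p) = dF (X p)" for p
    using arg_cong[OF P(3)[of p], of dF] vert_tangent(2)[OF P(1)[of p]] by (simp add: differential_linear)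
  then show "(\<lambda>p. dF (hor_proj A g B F X p)) \<in> sections_along A B F"
    using section_along_dF[OF X] by simp
qed

lemma vert_proj_smooth:
  assumes X: "X \<in> vector_fields A"
  shows "vert_proj A g B F X \<in> sections_of A vert"
proof -
  note P = projections[OF X]
  have "vert_proj A g B F X = X - hor_proj A g B F X"
  proof
    show "vert_proj A g B F X p = (X - hor_proj A g B F X) p" for p
      using P(3)[of p] by (simp add: eq_diff_eq)
  qed
  then have "vert_proj A g B F X \<in> vector_fields A"
    using dom.vector_field_diff[OF X hor_proj_smooth[OF X]] by simp
  then show ?thesis using P(1) by (simp add: sections_of_def)
qed

lemma basic_field_exists:
  assumes W: "W \<in> vector_fields B"
  shows "\<exists>Z\<in>basic_fields A g B F. \<forall>p. dF (Z p) = W (F p)"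
proof -
  have "\<forall>p. \<exists>z. z \<in> hor p \<and> dF z = W (F p)"
    using horizontal_lift[OF cod.vector_fieldD(1)[OF W]] by blast
  then obtain Z where Z: "\<And>p. Z p \<in> hor p" "\<And>p. dF (Z p) = W (F p)" by metis
  have "Z \<in> vector_fields A"
    using section_along_compose[OF W] by (intro horizontal_smooth Z(1)) (simp add: Z(2) o_def)
  then have "Z \<in> basic_fields A g B F"
    using Z W unfolding basic_fields_def sections_of_def by blast
  then show ?thesis using Z(2) by blast
qed

lemma basic_fieldD:
  assumes "Z \<in> basic_fields A g B F"
  shows "Z \<in> vector_fields A" "Z p \<in> hor p" "\<exists>W\<in>vector_fields B. \<forall>p. dF (Z p) = W (F p)"
  using assms by (auto simp: basic_fields_def sections_of_def)

lemma vertical_fieldD: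
  assumes "X \<in> sections_of A vert"
  shows "X \<in> vector_fields A" "X p \<in> vert p"
  using assms by (auto simp: sections_of_def)

text \<open>The horizontal part of \<open>X\<close> itself need not be basic. It agrees at \<open>p\<close> with the lift of any field
  on the target through \<open>F\<^sub>*(X p)\<close>, and agreement at \<open>p\<close> is enough for tensors.\<close>

lemma vertical_plus_basic:
  assumes X: "X \<in> vector_fields A"
  shows "\<exists>V\<in>sections_of A vert. \<exists>Z\<in>basic_fields A g B F. X p = (V + Z) p"
proof -
  note P = projections[OF X, of p]
  obtain W where W: "W \<in> vector_fields B" "W (F p) = dF (X p)"
    using cod.vector_field_extension[OF dF_tangent[OF dom.vector_fieldD(1)[OF X]]] by blast
  obtain Z where Z: "Z \<in> basic_fields A g B F" "\<And>p. dF (Z p) = W (F p)"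
    using basic_field_exists[OF W(1)] by blast
  let ?d = "hor_proj A g B F X p - Z p"
  have d: "?d \<in> hor p" by (intro subspace_diff subspace_hor P(2) basic_fieldD(2)[OF Z(1)])
  have "dF (hor_proj A g B F X p) = dF (X p)"
    using arg_cong[OF P(3), of dF] vert_tangent(2)[OF P(1)] by (simp add: differential_linear)
  then have "dF ?d = 0" using Z(2)[of p] W(2) by (simp add: differential_diff)
  then have "?d \<in> vert p" by (rule vertI[OF hor_tangent[OF d]])
  then have "?d = 0" using d vert_Int_hor by blast
  then have "hor_proj A g B F X p = Z p" by simp
  then have "X p = (vert_proj A g B F X + Z) p" using P(3) by simp
  then show ?thesis using vert_proj_smooth[OF X] Z(1) by blast
qed

end


section \<open>The second fundamental form of a Riemannian submersion\<close>

locale riem_submersion_connections = riem_submersion A g B h F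
  for A :: "('m::{t2_space,second_countable_topology}, 'e::{real_inner,heine_borel}) atlas"
    and g :: "'m \<Rightarrow> 'm tvec \<Rightarrow> 'm tvec \<Rightarrow> real"
    and B :: "('n::{t2_space,second_countable_topology}, 'd::{real_inner,heine_borel}) atlas"
    and h :: "'n \<Rightarrow> 'n tvec \<Rightarrow> 'n tvec \<Rightarrow> real"
    and F :: "'m \<Rightarrow> 'n" +
  fixes nabla1 :: "('m \<Rightarrow> 'm tvec) \<Rightarrow> ('m \<Rightarrow> 'm tvec) \<Rightarrow> ('m \<Rightarrow> 'm tvec)"
    and nabla2 :: "('n \<Rightarrow> 'n tvec) \<Rightarrow> ('n \<Rightarrow> 'n tvec) \<Rightarrow> ('n \<Rightarrow> 'n tvec)"
    and nablaF :: "('m \<Rightarrow> 'm tvec) \<Rightarrow> ('m \<Rightarrow> 'n tvec) \<Rightarrow> ('m \<Rightarrow> 'n tvec)"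
  assumes lc1: "levi_civita A g nabla1" and lc2: "levi_civita B h nabla2"
    and pullback: "pullback_connection A B F nabla2 nablaF"
begin

abbreviation sff where "sff \<equiv> second_fundamental_form B F nabla1 nablaF"

lemma conn1: "connection_on A (vector_fields A) nabla1"
  using lc1 by (simp add: levi_civita_def)

lemma conn2: "connection_on B (vector_fields B) nabla2"
  using lc2 by (simp add: levi_civita_def)

lemma connF: "connection_on A (sections_along A B F) nablaF"
  using pullback by (simp add: pullback_connection_def)

lemma torsion1: "X \<in> vector_fields A \<Longrightarrow> Y \<in> vector_fields A \<Longrightarrow> nabla1 X Y - nabla1 Y X = lie_bracket X Y"
  using lc1 by (simp add: levi_civita_def)

lemma torsion2: "X \<in> vector_fields B \<Longrightarrow> Y \<in> vector_fields B \<Longrightarrow> nabla2 X Y - nabla2 Y X = lie_bracket X Y"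
  using lc2 by (simp add: levi_civita_def)

lemma compatible1:
  "X \<in> vector_fields A \<Longrightarrow> Y \<in> vector_fields A \<Longrightarrow> Z \<in> vector_fields A \<Longrightarrow>
    X p (\<lambda>q. g q (Y q) (Z q)) = g p (nabla1 X Y p) (Z p) + g p (Y p) (nabla1 X Z p)"
  using lc1 by (simp add: levi_civita_def)

lemma compatible2:
  "X \<in> vector_fields B \<Longrightarrow> Y \<in> vector_fields B \<Longrightarrow> Z \<in> vector_fields B \<Longrightarrow>
    X p (\<lambda>q. h q (Y q) (Z q)) = h p (nabla2 X Y p) (Z p) + h p (Y p) (nabla2 X Z p)"
  using lc2 by (simp add: levi_civita_def)

lemma nabla1_field: "X \<in> vector_fields A \<Longrightarrow> Y \<in> vector_fields A \<Longrightarrow> nabla1 X Y \<in> vector_fields A"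
  by (rule connection_onD(1)[OF conn1])

lemma nabla1_tangent: "X \<in> vector_fields A \<Longrightarrow> Y \<in> vector_fields A \<Longrightarrow> nabla1 X Y p \<in> tangent_space A p"
  by (rule dom.vector_fieldD(1)[OF nabla1_field])

lemma pullback_eq:
  "X \<in> vector_fields A \<Longrightarrow> V \<in> vector_fields B \<Longrightarrow> W \<in> vector_fields B \<Longrightarrow> V (F p) = dF (X p) \<Longrightarrow>
    nablaF X (W \<circ> F) p = nabla2 V W (F p)"
  using pullback[unfolded pullback_connection_def, THEN conjunct2, rule_format] .

lemma sff_tangent:
  assumes X: "X \<in> vector_fields A" and Y: "Y \<in> vector_fields A"
  shows "sff X Y p \<in> tangent_space B (F p)"
proof -
  have "nablaF X (\<lambda>q. dF (Y q)) p \<in> tangent_space B (F p)"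
    using connection_onD(1)[OF connF X section_along_dF[OF Y]] by (simp add: sections_along_def)
  then show ?thesis unfolding second_fundamental_form_def
    by (intro subspace_diff cod.subspace_tangent_space dF_tangent nabla1_tangent X Y)
qed

lemma sff_add_left:
  assumes "X \<in> vector_fields A" "X' \<in> vector_fields A" "Y \<in> vector_fields A"
  shows "sff (X + X') Y p = sff X Y p + sff X' Y p"
  using connection_onD(2)[OF connF assms(1) section_along_dF[OF assms(3)] assms(2)]
    connection_onD(2)[OF conn1 assms(1,3,2)]
  by (simp add: second_fundamental_form_def differential_linear)

lemma sff_add_right:
  assumes "X \<in> vector_fields A" "Y \<in> vector_fields A" "Y' \<in> vector_fields A"
  shows "sff X (Y + Y') p = sff X Y p + sff X Y' p"
proof -
  have "(\<lambda>q. dF ((Y + Y') q)) = (\<lambda>q. dF (Y q)) + (\<lambda>q. dF (Y' q))"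
    by (auto simp: differential_linear)
  then show ?thesis
    using connection_onD(3)[OF connF assms(1) section_along_dF[OF assms(2)] section_along_dF[OF assms(3)]]
      connection_onD(3)[OF conn1 assms]
    by (simp add: second_fundamental_form_def differential_linear)
qed

lemma sff_scale_left:
  assumes "smooth_fun A f" "X \<in> vector_fields A" "Y \<in> vector_fields A"
  shows "sff (\<lambda>q. f q *\<^sub>R X q) Y p = f p *\<^sub>R sff X Y p"
  using connection_onD(4)[OF connF assms(2) section_along_dF[OF assms(3)] assms(1)]
    connection_onD(4)[OF conn1 assms(2,3,1)]
  by (simp add: second_fundamental_form_def differential_linear scaleR_right_diff_distrib)

lemma sff_scale_right:
  assumes "smooth_fun A f" "X \<in> vector_fields A" "Y \<in> vector_fields A"
  shows "sff X (\<lambda>q. f q *\<^sub>R Y q) p = f p *\<^sub>R sff X Y p"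
  using connection_onD(5)[OF connF assms(2) section_along_dF[OF assms(3)] assms(1)]
    connection_onD(5)[OF conn1 assms(2,3,1)]
  by (simp add: second_fundamental_form_def differential_linear scaleR_right_diff_distrib)

text \<open>In the second argument the derivative terms of the two Leibniz rules cancel, so the form is
  tensorial in both arguments.\<close>

lemma sff_pointwise:
  assumes X: "X \<in> vector_fields A" "X' \<in> vector_fields A" "X p = X' p"
    and Y: "Y \<in> vector_fields A" "Y' \<in> vector_fields A" "Y p = Y' p"
  shows "sff X Y p = sff X' Y' p"
proof -
  have 1: "sff Z Y p = 0" if "Z \<in> vector_fields A" "Z p = 0" for Z
    by (rule dom.tensorial[where \<Phi> = "\<lambda>Z. sff Z Y p" and p = p])
      (simp_all add: sff_add_left sff_scale_left Y that)
  have 2: "sff X' Z p = 0" if "Z \<in> vector_fields A" "Z p = 0" for Z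
    by (rule dom.tensorial[where \<Phi> = "\<lambda>Z. sff X' Z p" and p = p])
      (simp_all add: sff_add_right sff_scale_right X that)
  have "sff X Y p = sff X' Y p + sff (X - X') Y p"
    using sff_add_left[OF X(2) dom.vector_field_diff[OF X(1,2)] Y(1), of p] by simp
  moreover have "sff (X - X') Y p = 0" using 1[OF dom.vector_field_diff[OF X(1,2)]] X(3) by simp
  moreover have "sff X' Y p = sff X' Y' p + sff X' (Y - Y') p"
    using sff_add_right[OF X(2) Y(2) dom.vector_field_diff[OF Y(1,2)], of p] by simp
  moreover have "sff X' (Y - Y') p = 0" using 2[OF dom.vector_field_diff[OF Y(1,2)]] Y(3) by simp
  ultimately show ?thesis by simp
qed

lemma zero_section_along: "0 \<in> sections_along A B F"
  using subspace_0[OF cod.subspace_tangent_space] dom.smooth_fun_const[of 0]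
  by (simp add: sections_along_def)

lemma sff_vertical:
  assumes X: "X \<in> vector_fields A" and V: "V \<in> sections_of A vert"
  shows "sff X V p = - dF (nabla1 X V p)"
proof -
  have "(\<lambda>q. dF (V q)) = 0" using vert_tangent(2)[OF vertical_fieldD(2)[OF V]] by auto
  then show ?thesis using connection_on_zero(1)[OF connF X zero_section_along]
    by (simp add: second_fundamental_form_def)
qed

text \<open>Along a vertical direction the pullback connection differentiates \<open>W \<circ> F\<close> in the direction
  \<open>F\<^sub>*X = 0\<close>.\<close>

lemma sff_vertical_basic:
  assumes X: "X \<in> sections_of A vert" and Z: "Z \<in> basic_fields A g B F"
  shows "sff X Z p = - dF (nabla1 X Z p)"
proof -
  obtain W where W: "W \<in> vector_fields B" "\<And>p. dF (Z p) = W (F p)" using basic_fieldD(3)[OF Z] by blast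
  have "(\<lambda>q. dF (Z q)) = W \<circ> F" using W(2) by auto
  moreover have "nablaF X (W \<circ> F) p = nabla2 0 W (F p)"
    using vert_tangent(2)[OF vertical_fieldD(2)[OF X]]
    by (intro pullback_eq vertical_fieldD(1)[OF X] cod.vector_field_zero W(1)) simp
  moreover have "nabla2 0 W = 0" by (rule connection_on_zero(2)[OF conn2 cod.vector_field_zero W(1)])
  ultimately show ?thesis by (simp add: second_fundamental_form_def)
qed

lemma dF_related:
  assumes X: "X \<in> vector_fields A" and W: "\<And>p. dF (X p) = W (F p)" and f: "smooth_fun B f"
  shows "X p (f \<circ> F) = W (F p) f"
  using W[of p] f by (metis differential_def)

text \<open>The difference is \<open>F\<^sub>*[Z, X]\<close>. It vanishes because \<open>Z\<close> and \<open>X\<close> are \<open>F\<close>-related to \<open>W\<close> and \<open>0\<close>, so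
  their bracket is \<open>F\<close>-related to \<open>[W, 0] = 0\<close>.\<close>

lemma dF_nabla1_commute:
  assumes X: "X \<in> sections_of A vert" and Z: "Z \<in> basic_fields A g B F"
  shows "dF (nabla1 Z X p) = dF (nabla1 X Z p)"
proof -
  note XF = vertical_fieldD(1)[OF X] and ZF = basic_fieldD(1)[OF Z]
  obtain W where W: "W \<in> vector_fields B" "\<And>p. dF (Z p) = W (F p)" using basic_fieldD(3)[OF Z] by blast
  have X0: "X q (f \<circ> F) = 0" if f: "smooth_fun B f" for q f
    using dF_related[OF XF _ f, of 0 q] vert_tangent(2)[OF vertical_fieldD(2)[OF X]] by simp
  have "dF (lie_bracket Z X p) f = 0" for f
  proof (cases "smooth_fun B f")
    case True
    have Zf: "(\<lambda>q. Z q (f \<circ> F)) = (\<lambda>r. W r f) \<circ> F"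
      by (rule ext) (simp only: dF_related[OF ZF W(2) True] o_apply)
    have "X p (\<lambda>q. Z q (f \<circ> F)) = 0"
      unfolding Zf by (rule X0[OF cod.vector_fieldD(2)[OF W(1) True]])
    moreover have "Z p (\<lambda>q. X q (f \<circ> F)) = 0"
      unfolding X0[OF True] by (rule dom.tangent_const[OF dom.vector_fieldD(1)[OF ZF]])
    ultimately show ?thesis using True by (simp only: differential_def lie_bracket_def if_True diff_self)
  qed (simp add: differential_def)
  then have "dF (lie_bracket Z X p) = 0" by auto
  then have "dF (nabla1 Z X p - nabla1 X Z p) = 0"
    using fun_cong[OF torsion1[OF ZF XF], of p] by simp
  then show ?thesis by (simp add: differential_diff)
qed

lemma sff_basic_eq:
  assumes X: "X \<in> vector_fields A" "W \<in> vector_fields B" "\<And>p. dF (X p) = W (F p)"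
    and Y: "Y \<in> vector_fields A" "W' \<in> vector_fields B" "\<And>p. dF (Y p) = W' (F p)"
  shows "sff X Y p = nabla2 W W' (F p) - dF (nabla1 X Y p)"
proof -
  have "(\<lambda>q. dF (Y q)) = W' \<circ> F" using Y(3) by auto
  moreover have "nablaF X (W' \<circ> F) p = nabla2 W W' (F p)"
    by (rule pullback_eq[OF X(1,2) Y(2)]) (simp add: X(3))
  ultimately show ?thesis by (simp add: second_fundamental_form_def)
qed

text \<open>Both connections are torsion free, and brackets of \<open>F\<close>-related fields are \<open>F\<close>-related.\<close>

lemma sff_basic_sym:
  assumes X: "X \<in> basic_fields A g B F" and Y: "Y \<in> basic_fields A g B F"
  shows "sff X Y p = sff Y X p"
proof -
  note XF = basic_fieldD(1)[OF X] and YF = basic_fieldD(1)[OF Y]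
  obtain W where W: "W \<in> vector_fields B" "\<And>p. dF (X p) = W (F p)" using basic_fieldD(3)[OF X] by blast
  obtain W' where W': "W' \<in> vector_fields B" "\<And>p. dF (Y p) = W' (F p)" using basic_fieldD(3)[OF Y] by blast
  have "dF (lie_bracket X Y p) f = lie_bracket W W' (F p) f" for f
  proof (cases "smooth_fun B f")
    case True
    have Xf: "(\<lambda>q. X q (f \<circ> F)) = (\<lambda>r. W r f) \<circ> F"
      by (rule ext) (simp only: dF_related[OF XF W(2) True] o_apply)
    have Yf: "(\<lambda>q. Y q (f \<circ> F)) = (\<lambda>r. W' r f) \<circ> F"
      by (rule ext) (simp only: dF_related[OF YF W'(2) True] o_apply)
    show ?thesis
      using True by (simp only: differential_def lie_bracket_def if_True Xf Yf
        dF_related[OF XF W(2) cod.vector_fieldD(2)[OF W'(1) True]]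
        dF_related[OF YF W'(2) cod.vector_fieldD(2)[OF W(1) True]])
  next
    case False
    have "(\<lambda>q. W q f) = (\<lambda>q. 0)" "(\<lambda>q. W' q f) = (\<lambda>q. 0)"
      using cod.tangent_nonsmooth[OF cod.vector_fieldD(1)[OF W(1)] False]
        cod.tangent_nonsmooth[OF cod.vector_fieldD(1)[OF W'(1)] False] by auto
    then show ?thesis
      using False cod.tangent_const[OF cod.vector_fieldD(1)[OF W(1)]]
        cod.tangent_const[OF cod.vector_fieldD(1)[OF W'(1)]]
      by (simp add: differential_def lie_bracket_def)
  qed
  then have "dF (lie_bracket X Y p) = lie_bracket W W' (F p)" by auto
  then have "dF (nabla1 X Y p) - dF (nabla1 Y X p) = nabla2 W W' (F p) - nabla2 W' W (F p)"
    using fun_cong[OF torsion1[OF XF YF], of p] fun_cong[OF torsion2[OF W(1) W'(1)], of "F p"]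
    by (simp add: differential_diff[symmetric])
  then show ?thesis
    unfolding sff_basic_eq[OF XF W YF W'] sff_basic_eq[OF YF W' XF W] by (simp add: algebra_simps)
qed

text \<open>\<open>F\<^sub>*\<close> is isometric on horizontal vectors, so \<open>g(Y, Z)\<close> is a function pulled back from the target.
  Differentiating it upstairs and downstairs by metric compatibility and comparing gives the
  claim.\<close>

lemma sff_basic_skew:
  assumes X: "X \<in> basic_fields A g B F" and Y: "Y \<in> basic_fields A g B F" and Z: "Z \<in> basic_fields A g B F"
  shows "h (F p) (sff X Y p) (dF (Z p)) = - h (F p) (sff X Z p) (dF (Y p))"
proof -
  note XF = basic_fieldD(1)[OF X] and YF = basic_fieldD(1)[OF Y] and ZF = basic_fieldD(1)[OF Z]
  obtain W where W: "W \<in> vector_fields B" "\<And>p. dF (X p) = W (F p)" using basic_fieldD(3)[OF X] by blast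
  obtain W' where W': "W' \<in> vector_fields B" "\<And>p. dF (Y p) = W' (F p)" using basic_fieldD(3)[OF Y] by blast
  obtain W'' where W'': "W'' \<in> vector_fields B" "\<And>p. dF (Z p) = W'' (F p)" using basic_fieldD(3)[OF Z] by blast
  let ?k = "\<lambda>r. h r (W' r) (W'' r)"
  have n2: "nabla2 W V (F p) \<in> tangent_space B (F p)" if "V \<in> vector_fields B" for V
    by (rule cod.vector_fieldD(1)[OF connection_onD(1)[OF conn2 W(1) that]])
  have n1: "dF (nabla1 X V p) \<in> tangent_space B (F p)" if "V \<in> vector_fields A" for V
    by (rule dF_tangent[OF nabla1_tangent[OF XF that]])
  note T' = cod.vector_fieldD(1)[OF W'(1), of "F p"] and T'' = cod.vector_fieldD(1)[OF W''(1), of "F p"]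
  have gk: "(\<lambda>q. g q (Y q) (Z q)) = ?k \<circ> F"
    by (rule ext)
      (simp only: metric_hor[OF dom.vector_fieldD(1)[OF YF] basic_fieldD(2)[OF Z]] W'(2) W''(2) o_apply)
  have "X p (\<lambda>q. g q (Y q) (Z q)) = W (F p) ?k"
    unfolding gk by (rule dF_related[OF XF W(2) cod.metric_smooth[OF W'(1) W''(1)]])
  then have "g p (nabla1 X Y p) (Z p) + g p (Y p) (nabla1 X Z p) =
      h (F p) (nabla2 W W' (F p)) (W'' (F p)) + h (F p) (W' (F p)) (nabla2 W W'' (F p))"
    by (simp add: compatible1[OF XF YF ZF] compatible2[OF W(1) W'(1) W''(1)])
  moreover have "g p (nabla1 X Y p) (Z p) = h (F p) (dF (nabla1 X Y p)) (W'' (F p))"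
    using metric_hor[OF nabla1_tangent[OF XF YF] basic_fieldD(2)[OF Z]] by (simp add: W'')
  moreover have "g p (Y p) (nabla1 X Z p) = h (F p) (dF (nabla1 X Z p)) (W' (F p))"
    using metric_hor[OF nabla1_tangent[OF XF ZF] basic_fieldD(2)[OF Y]]
      dom.metric_sym[OF dom.vector_fieldD(1)[OF YF] nabla1_tangent[OF XF ZF]] by (simp add: W')
  moreover have "h (F p) (W' (F p)) (nabla2 W W'' (F p)) = h (F p) (nabla2 W W'' (F p)) (W' (F p))"
    by (rule cod.metric_sym[OF T' n2[OF W''(1)]])
  ultimately show ?thesis
    unfolding sff_basic_eq[OF XF W YF W'] sff_basic_eq[OF XF W ZF W''] W'(2) W''(2)
    using cod.metric_diff_left[OF n2[OF W'(1)] n1[OF YF] T'']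
      cod.metric_diff_left[OF n2[OF W''(1)] n1[OF ZF] T'] by simp
qed

text \<open>The trilinear form \<open>h((\<nabla>F\<^sub>*)(X, Y), F\<^sub>*Z)\<close> is symmetric in its first two and skew in its last two
  arguments. Such a form is zero: six alternating exchanges return to the original arguments with the
  opposite sign.\<close>

lemma sff_basic:
  assumes X: "X \<in> basic_fields A g B F" and Y: "Y \<in> basic_fields A g B F"
  shows "sff X Y p = 0"
proof (rule cod.metric_nondegenerate)
  show "sff X Y p \<in> tangent_space B (F p)" by (rule sff_tangent[OF basic_fieldD(1)[OF X] basic_fieldD(1)[OF Y]])
  show "0 \<in> tangent_space B (F p)" by (rule subspace_0[OF cod.subspace_tangent_space])
  fix w assume w: "w \<in> tangent_space B (F p)"
  obtain W where W: "W \<in> vector_fields B" "W (F p) = w" using cod.vector_field_extension[OF w] by blast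
  obtain Z where Z: "Z \<in> basic_fields A g B F" "\<And>p. dF (Z p) = W (F p)"
    using basic_field_exists[OF W(1)] by blast
  let ?a = "\<lambda>X Y Z. h (F p) (sff X Y p) (dF (Z p))"
  have "?a X Y Z = - ?a X Z Y" by (rule sff_basic_skew[OF X Y Z(1)])
  also have "\<dots> = - ?a Z X Y" by (simp add: sff_basic_sym[OF X Z(1)])
  also have "\<dots> = ?a Z Y X" by (simp add: sff_basic_skew[OF Z(1) X Y])
  also have "\<dots> = ?a Y Z X" by (simp add: sff_basic_sym[OF Y Z(1)])
  also have "\<dots> = - ?a Y X Z" by (rule sff_basic_skew[OF Y Z(1) X])
  also have "\<dots> = - ?a X Y Z" by (simp add: sff_basic_sym[OF X Y])
  finally have "?a X Y Z = 0" by simp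
  then show "h (F p) (sff X Y p) w = h (F p) 0 w" using Z(2)[of p] W(2) cod.metric_zero[OF w] by simp
qed

text \<open>By tensoriality only sums of vertical and basic fields matter. Their vertical-vertical and mixed
  terms are \<open>- F\<^sub>*\<close> of the derivatives on the right, and the basic-basic terms always vanish.\<close>

theorem totally_geodesic_iff_vertical:
  "totally_geodesic_map A B F nabla1 nablaF \<longleftrightarrow>
    (\<forall>X\<in>sections_of A vert. \<forall>Y\<in>sections_of A vert. \<forall>Z\<in>basic_fields A g B F. \<forall>p.
      nabla1 X Y p \<in> vert p \<and> nabla1 X Z p \<in> vert p)" (is "?L \<longleftrightarrow> ?R")
proof
  assume L: ?L
  show ?R
  proof (intro ballI allI)
    fix X Y Z p
    assume X: "X \<in> sections_of A vert" and Y: "Y \<in> sections_of A vert" and Z: "Z \<in> basic_fields A g B F"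
    note F = vertical_fieldD(1)[OF X] vertical_fieldD(1)[OF Y] basic_fieldD(1)[OF Z]
    have "sff X Y p = 0" "sff X Z p = 0" using L F unfolding totally_geodesic_map_def by blast+
    then have "dF (nabla1 X Y p) = 0" "dF (nabla1 X Z p) = 0"
      using sff_vertical[OF F(1) Y, of p] sff_vertical_basic[OF X Z, of p] by simp_all
    then show "nabla1 X Y p \<in> vert p \<and> nabla1 X Z p \<in> vert p"
      by (intro conjI vertI nabla1_tangent F)
  qed
next
  assume R: ?R
  have zero: "0 \<in> basic_fields A g B F" "0 \<in> sections_of A vert"
    using dom.vector_field_zero cod.vector_field_zero subspace_0[OF subspace_hor] subspace_0[OF subspace_vert]
    by (auto simp: basic_fields_def sections_of_def differential_linear intro!: bexI[of _ 0])
  have VV: "dF (nabla1 X Y p) = 0" if "X \<in> sections_of A vert" "Y \<in> sections_of A vert" for X Y p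
    using R that zero vert_tangent(2) by blast
  have VB: "dF (nabla1 X Z p) = 0" if "X \<in> sections_of A vert" "Z \<in> basic_fields A g B F" for X Z p
    using R that zero vert_tangent(2) by blast
  show ?L unfolding totally_geodesic_map_def
  proof (intro ballI allI)
    fix X Y p assume X: "X \<in> vector_fields A" and Y: "Y \<in> vector_fields A"
    obtain V Z where V: "V \<in> sections_of A vert" and Z: "Z \<in> basic_fields A g B F" and XVZ: "X p = (V + Z) p"
      using vertical_plus_basic[OF X] by blast
    obtain V' Z' where V': "V' \<in> sections_of A vert" and Z': "Z' \<in> basic_fields A g B F" and YVZ: "Y p = (V' + Z') p"
      using vertical_plus_basic[OF Y] by blast
    note F = vertical_fieldD(1)[OF V] vertical_fieldD(1)[OF V'] basic_fieldD(1)[OF Z] basic_fieldD(1)[OF Z']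
    note S = dom.vector_field_add[OF F(1,3)] dom.vector_field_add[OF F(2,4)]
    have "sff X Y p = sff (V + Z) (V' + Z') p" by (rule sff_pointwise[OF X S(1) XVZ Y S(2) YVZ])
    also have "\<dots> = sff V V' p + sff V Z' p + (sff Z V' p + sff Z Z' p)"
      by (simp add: sff_add_left[OF F(1,3) S(2)] sff_add_right[OF F(1,2,4)] sff_add_right[OF F(3,2,4)])
    also have "\<dots> = 0"
      by (simp add: sff_vertical[OF F(1) V'] sff_vertical[OF F(3) V'] sff_vertical_basic[OF V Z']
          sff_basic[OF Z Z'] dF_nabla1_commute[OF V' Z] VV[OF V V'] VB[OF V Z'] VB[OF V' Z])
    finally show "sff X Y p = 0" .
  qed
qed

end


section \<open>Semi-invariant submersions from Kaehler manifolds\<close>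

lemma add_diff_pairs: "(a + b) + (c + d) - (a + c) = b + d" for a :: "'x::ab_group_add"
  by simp

locale semi_invariant_kaehler = riem_submersion_connections A g B h F nabla1 nabla2 nablaF
  for A :: "('m::{t2_space,second_countable_topology}, 'e::{real_inner,heine_borel}) atlas"
    and g :: "'m \<Rightarrow> 'm tvec \<Rightarrow> 'm tvec \<Rightarrow> real"
    and B :: "('n::{t2_space,second_countable_topology}, 'd::{real_inner,heine_borel}) atlas"
    and h :: "'n \<Rightarrow> 'n tvec \<Rightarrow> 'n tvec \<Rightarrow> real"
    and F :: "'m \<Rightarrow> 'n"
    and nabla1 :: "('m \<Rightarrow> 'm tvec) \<Rightarrow> ('m \<Rightarrow> 'm tvec) \<Rightarrow> ('m \<Rightarrow> 'm tvec)"
    and nabla2 :: "('n \<Rightarrow> 'n tvec) \<Rightarrow> ('n \<Rightarrow> 'n tvec) \<Rightarrow> ('n \<Rightarrow> 'n tvec)"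
    and nablaF :: "('m \<Rightarrow> 'm tvec) \<Rightarrow> ('m \<Rightarrow> 'n tvec) \<Rightarrow> ('m \<Rightarrow> 'n tvec)" +
  fixes J :: "'m \<Rightarrow> 'm tvec \<Rightarrow> 'm tvec" and D1 :: "'m \<Rightarrow> 'm tvec set"
  assumes kaehler: "kaehler A g nabla1 J"
    and semi_invariant: "semi_invariant_submersion A g J B h F D1"
begin

abbreviation D2 :: "'m \<Rightarrow> 'm tvec set" where "D2 \<equiv> D2_of A g B F D1"
abbreviation JD2 :: "'m \<Rightarrow> 'm tvec set" where "JD2 \<equiv> JD2_of A g J B F D1"
abbreviation mu :: "'m \<Rightarrow> 'm tvec set" where "mu \<equiv> mu_of A g J B F D1"
abbreviation \<V> :: "('m \<Rightarrow> 'm tvec) \<Rightarrow> ('m \<Rightarrow> 'm tvec)" where "\<V> \<equiv> vert_proj A g B F"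
abbreviation \<H> :: "('m \<Rightarrow> 'm tvec) \<Rightarrow> ('m \<Rightarrow> 'm tvec)" where "\<H> \<equiv> hor_proj A g B F"
abbreviation JF :: "('m \<Rightarrow> 'm tvec) \<Rightarrow> ('m \<Rightarrow> 'm tvec)" where "JF X \<equiv> (\<lambda>p. J p (X p))"

lemma almost_hermitian: "almost_hermitian A g J"
  using kaehler unfolding kaehler_def by (rule conjunct1)

lemma J_linear:
  assumes u: "u \<in> tangent_space A p" and v: "v \<in> tangent_space A p"
  shows "J p u \<in> tangent_space A p" "J p (u + v) = J p u + J p v" "J p (c *\<^sub>R u) = c *\<^sub>R J p u"
    "J p (J p u) = - u" "g p (J p u) (J p v) = g p u v"
proof -
  note * = almost_hermitian[unfolded almost_hermitian_def, THEN conjunct2, THEN conjunct1,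
      THEN spec[of _ p], THEN bspec[OF _ u], THEN bspec[OF _ v], THEN spec[of _ c]]
  show "J p u \<in> tangent_space A p" "J p (u + v) = J p u + J p v" "J p (c *\<^sub>R u) = c *\<^sub>R J p u"
    "J p (J p u) = - u" "g p (J p u) (J p v) = g p u v"
    using * by (elim conjE, simp only:)+
qed

lemma J_field: "X \<in> vector_fields A \<Longrightarrow> JF X \<in> vector_fields A"
  using almost_hermitian[unfolded almost_hermitian_def, THEN conjunct2, THEN conjunct2] by (rule bspec)

lemma J_parallel:
  assumes "X \<in> vector_fields A" "Y \<in> vector_fields A"
  shows "nabla1 X (JF Y) p = J p (nabla1 X Y p)"
proof -
  have "nabla1 X (JF Y) p - J p (nabla1 X Y p) = 0"
    by (rule kaehler[unfolded kaehler_def, THEN conjunct2, THEN conjunct2, THEN bspec[OF _ assms(1)],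
          THEN bspec[OF _ assms(2)], THEN spec])
  then show ?thesis by simp
qed

lemma splitting:
  shows "D1 p \<subseteq> vert p" "vert p = {u + v | u v. u \<in> D1 p \<and> v \<in> D2 p}"
    "J p ` D1 p = D1 p" "J p ` D2 p \<subseteq> hor p"
proof -
  note * = semi_invariant[unfolded semi_invariant_submersion_def, THEN conjunct2, THEN conjunct2,
      THEN spec[of _ p]]
  show "D1 p \<subseteq> vert p" by (rule *[THEN conjunct1])
  show "vert p = {u + v | u v. u \<in> D1 p \<and> v \<in> D2 p}" by (rule *[THEN conjunct2, THEN conjunct1])
  show "J p ` D1 p = D1 p" by (rule *[THEN conjunct2, THEN conjunct2, THEN conjunct2, THEN conjunct1])
  show "J p ` D2 p \<subseteq> hor p" by (rule *[THEN conjunct2, THEN conjunct2, THEN conjunct2, THEN conjunct2])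
qed

lemma D1_vert: "u \<in> D1 p \<Longrightarrow> u \<in> vert p"
  using splitting(1) by (rule subsetD)

lemma D2_vert: "u \<in> D2 p \<Longrightarrow> u \<in> vert p"
  by (simp add: D2_of_def orth_compl_in_def)

lemma J_D1: "u \<in> D1 p \<Longrightarrow> J p u \<in> D1 p"
  using imageI[of u "D1 p" "J p"] splitting(3)[of p] by simp

lemma JD2_hor: "u \<in> JD2 p \<Longrightarrow> u \<in> hor p"
  using splitting(4)[of p] unfolding JD2_of_def by (rule subsetD)

lemma vert_split:
  assumes "v \<in> vert p"
  obtains d e where "d \<in> D1 p" "e \<in> D2 p" "v = d + e"
  using assms unfolding splitting(2) by blast

lemma subspace_D1: "subspace (D1 p)"
proof -
  have "distribution A D1"
    by (rule semi_invariant[unfolded semi_invariant_submersion_def, THEN conjunct2, THEN conjunct1])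
  then show ?thesis unfolding distribution_def by (elim conjE) (drule spec[of _ p], elim conjE)
qed

lemma subspace_D2: "subspace (D2 p)"
  unfolding D2_of_def
  by (rule subspace_orth_compl[OF subspace_vert]) (auto intro: vert_tangent(1) D1_vert)

lemma subspace_JD2: "subspace (JD2 p)"
proof -
  have T: "e \<in> tangent_space A p" if "e \<in> D2 p" for e by (rule vert_tangent(1)[OF D2_vert[OF that]])
  show ?thesis unfolding JD2_of_def
  proof (rule subspaceI)
    have "J p 0 = 0" using J_linear(3)[OF T T, of 0 0 0] subspace_0[OF subspace_D2] by simp
    then show "0 \<in> J p ` D2 p" using subspace_0[OF subspace_D2[of p]] by (metis imageI)
  next
    fix x y assume "x \<in> J p ` D2 p" "y \<in> J p ` D2 p"
    then obtain u v where u: "u \<in> D2 p" "x = J p u" and v: "v \<in> D2 p" "y = J p v" by blast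
    have "x + y = J p (u + v)" using J_linear(2)[OF T[OF u(1)] T[OF v(1)]] u v by simp
    then show "x + y \<in> J p ` D2 p" using subspace_add[OF subspace_D2 u(1) v(1)] by simp
  next
    fix c x assume "x \<in> J p ` D2 p"
    then obtain u where u: "u \<in> D2 p" "x = J p u" by blast
    have "c *\<^sub>R x = J p (c *\<^sub>R u)" using J_linear(3)[OF T[OF u(1)] T[OF u(1)]] u by simp
    then show "c *\<^sub>R x \<in> J p ` D2 p" using subspace_scale[OF subspace_D2 u(1)] by simp
  qed
qed

lemma subspace_mu: "subspace (mu p)"
  unfolding mu_of_def
  by (rule subspace_orth_compl[OF subspace_hor]) (auto intro: hor_tangent JD2_hor)

lemma J_vertical:
  assumes "v \<in> vert p"
  obtains d e where "d \<in> D1 p" "e \<in> JD2 p" "J p v = d + e"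
proof -
  obtain u w where uw: "u \<in> D1 p" "w \<in> D2 p" "v = u + w" using assms by (rule vert_split)
  have "J p v = J p u + J p w"
    unfolding uw(3) by (rule J_linear(2)[OF vert_tangent(1)[OF D1_vert[OF uw(1)]] vert_tangent(1)[OF D2_vert[OF uw(2)]]])
  then show thesis using J_D1[OF uw(1)] uw(2) by (intro that[of "J p u" "J p w"]) (auto simp: JD2_of_def)
qed

text \<open>The summands of \<open>JY\<close> along \<open>\<D>\<^sub>1 \<oplus> J\<D>\<^sub>2\<close> are vertical and horizontal. In this form they are seen to be
  smooth fields, so that the connection may be applied to them.\<close>

lemma phi_omega_eq:
  assumes Y: "Y \<in> sections_of A vert"
  shows "phi_part A g J B F D1 Y = \<V> (JF Y)" "omega_part A g J B F D1 Y = \<H> (JF Y)"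
proof -
  have "phi_part A g J B F D1 Y p = \<V> (JF Y) p \<and> omega_part A g J B F D1 Y p = \<H> (JF Y) p" for p
  proof -
    obtain d e where de: "d \<in> D1 p" "e \<in> JD2 p" "J p (Y p) = d + e"
      by (rule J_vertical[OF vertical_fieldD(2)[OF Y]])
    have disj: "D1 p \<inter> JD2 p \<subseteq> {0}" using vert_Int_hor[of p] D1_vert JD2_hor by blast
    have e: "J p (Y p) - d = e" "J p (Y p) - e = d" using de(3) by simp_all
    have "phi_part A g J B F D1 Y p = d"
      unfolding phi_part_def using de e by (intro component_eq subspace_D1 subspace_JD2 disj) simp_all
    moreover have "omega_part A g J B F D1 Y p = e"
      unfolding omega_part_def using de e disj by (intro component_eq subspace_D1 subspace_JD2) (auto simp: e)
    moreover have "\<V> (JF Y) p = d"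
      using de e JD2_hor D1_vert by (intro vert_proj_eq) simp_all
    moreover have "\<H> (JF Y) p = J p (Y p) - d"
      using de e JD2_hor D1_vert by (intro hor_proj_eq) simp_all
    ultimately show ?thesis using e by simp
  qed
  then show "phi_part A g J B F D1 Y = \<V> (JF Y)" "omega_part A g J B F D1 Y = \<H> (JF Y)" by (simp_all add: ext)
qed

text \<open>\<open>g(Jz, u) = - g(z, Ju)\<close>, and \<open>Ju\<close> is vertical because \<open>J\<close> preserves \<open>\<D>\<^sub>1\<close>.\<close>

lemma J_horizontal_orth_D1:
  assumes "z \<in> hor p" "u \<in> D1 p"
  shows "g p (J p z) u = 0"
proof -
  have zT: "z \<in> tangent_space A p" and uT: "u \<in> tangent_space A p"
    using assms hor_tangent vert_tangent(1) D1_vert by blast+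
  have "g p (J p z) u = g p (J p (J p z)) (J p u)" by (rule J_linear(5)[OF J_linear(1)[OF zT zT] uT, symmetric])
  also have "\<dots> = - g p z (J p u)"
    by (simp add: J_linear(4)[OF zT zT] dom.metric_minus_left[OF zT J_linear(1)[OF uT uT]])
  also have "\<dots> = 0" using hor_orth(1)[OF assms(1) D1_vert[OF J_D1[OF assms(2)]]] by simp
  finally show ?thesis .
qed

text \<open>Here the vertical and horizontal parts of \<open>JZ\<close> have to be placed in \<open>\<D>\<^sub>2\<close> and \<open>\<mu>\<close>: \<open>JZ\<close> is orthogonal to
  \<open>\<D>\<^sub>1\<close> by the previous lemma, and to \<open>J\<D>\<^sub>2\<close> because \<open>J\<close> is isometric and \<open>Z\<close> is horizontal.\<close>

lemma B_C_eq:
  assumes Z: "Z \<in> vector_fields A" and hor: "\<And>p. Z p \<in> hor p"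
  shows "B_part A g J B F D1 Z = \<V> (JF Z)" "C_part A g J B F D1 Z = \<H> (JF Z)"
proof -
  have "B_part A g J B F D1 Z p = \<V> (JF Z) p \<and> C_part A g J B F D1 Z p = \<H> (JF Z) p" for p
  proof -
    let ?b = "\<V> (JF Z) p" and ?c = "\<H> (JF Z) p"
    note P = projections[OF J_field[OF Z], of p]
    have sum: "J p (Z p) - ?b = ?c" "J p (Z p) - ?c = ?b" using P(3) by (simp_all add: algebra_simps)
    have bT: "?b \<in> tangent_space A p" and cT: "?c \<in> tangent_space A p"
      using P vert_tangent(1) hor_tangent by blast+
    have ZT: "Z p \<in> tangent_space A p" and JZT: "J p (Z p) \<in> tangent_space A p"
      using dom.vector_fieldD(1)[OF Z] dom.vector_fieldD(1)[OF J_field[OF Z]] by blast+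
    have "g p ?b u = 0" if u: "u \<in> D1 p" for u
    proof -
      have uT: "u \<in> tangent_space A p" by (rule vert_tangent(1)[OF D1_vert[OF u]])
      have "g p (J p (Z p) - ?c) u = g p (J p (Z p)) u - g p ?c u"
        by (rule dom.metric_diff_left[OF JZT cT uT])
      then show ?thesis
        using J_horizontal_orth_D1[OF hor u] hor_orth(1)[OF P(2) D1_vert[OF u]] sum(2) by simp
    qed
    then have b: "?b \<in> D2 p" using P(1) by (simp add: D2_of_def orth_compl_in_def)
    have "g p ?c w = 0" if w: "w \<in> JD2 p" for w
    proof -
      obtain e where e: "e \<in> D2 p" "w = J p e" using w by (auto simp: JD2_of_def)
      have eT: "e \<in> tangent_space A p" by (rule vert_tangent(1)[OF D2_vert[OF e(1)]])
      have wT: "w \<in> tangent_space A p" by (rule hor_tangent[OF JD2_hor[OF w]])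
      have "g p (J p (Z p) - ?b) w = g p (J p (Z p)) w - g p ?b w"
        by (rule dom.metric_diff_left[OF JZT bT wT])
      moreover have "g p (J p (Z p)) w = 0"
        unfolding e(2) J_linear(5)[OF ZT eT] by (rule hor_orth(1)[OF hor D2_vert[OF e(1)]])
      ultimately show ?thesis using hor_orth(2)[OF JD2_hor[OF w] P(1)] sum(1) by simp
    qed
    then have c: "?c \<in> mu p" using P(2) by (simp add: mu_of_def orth_compl_in_def)
    have "mu p \<subseteq> hor p" by (auto simp: mu_of_def orth_compl_in_def)
    then have disj: "D2 p \<inter> mu p \<subseteq> {0}" using vert_Int_hor[of p] D2_vert by blast
    have "B_part A g J B F D1 Z p = ?b"
      unfolding B_part_def by (rule component_eq[OF subspace_D2 subspace_mu disj b]) (simp add: sum c)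
    moreover have "C_part A g J B F D1 Z p = ?c"
      unfolding C_part_def
      by (rule component_eq[OF subspace_mu subspace_D2 _ c]) (use disj in blast, simp add: sum b)
    ultimately show ?thesis by simp
  qed
  then show "B_part A g J B F D1 Z = \<V> (JF Z)" "C_part A g J B F D1 Z = \<H> (JF Z)" by (simp_all add: ext)
qed

text \<open>The left side says that \<open>JE\<close> lies in \<open>\<D>\<^sub>1 \<oplus> J\<D>\<^sub>2 = J(ker F\<^sub>*)\<close> at \<open>p\<close>; applying \<open>J\<close> once more
  recovers \<open>E\<close> up to sign.\<close>

lemma projections_of_J_iff_vertical:
  assumes E: "E \<in> vector_fields A"
  shows "\<V> (JF E) p \<in> D1 p \<and> \<H> (JF E) p \<in> JD2 p \<longleftrightarrow> E p \<in> vert p"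
proof
  have ET: "E p \<in> tangent_space A p" by (rule dom.vector_fieldD(1)[OF E])
  assume "\<V> (JF E) p \<in> D1 p \<and> \<H> (JF E) p \<in> JD2 p"
  then obtain d e where de: "d \<in> D1 p" "e \<in> D2 p" "\<V> (JF E) p = d" "\<H> (JF E) p = J p e"
    by (auto simp: JD2_of_def)
  have dT: "d \<in> tangent_space A p" and eT: "e \<in> tangent_space A p"
    using de(1,2) D1_vert D2_vert vert_tangent(1) by blast+
  have "J p (E p) = d + J p e" using projections(3)[OF J_field[OF E], of p] de by simp
  then have "J p (J p (E p)) = J p d + J p (J p e)"
    by (simp add: J_linear(2)[OF dT J_linear(1)[OF eT eT]])
  then have "E p = e - J p d"
    using J_linear(4)[OF ET ET] J_linear(4)[OF eT eT] by (simp add: algebra_simps)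
  then show "E p \<in> vert p"
    using subspace_diff[OF subspace_vert D2_vert[OF de(2)] D1_vert[OF J_D1[OF de(1)]]] by simp
next
  assume "E p \<in> vert p"
  then obtain d e where de: "d \<in> D1 p" "e \<in> JD2 p" "J p (E p) = d + e" by (rule J_vertical)
  have e: "J p (E p) - d = e" using de(3) by simp
  have h: "J p (E p) - d \<in> hor p" unfolding e by (rule JD2_hor[OF de(2)])
  have "\<V> (JF E) p = d" by (rule vert_proj_eq[where X = "JF E", OF D1_vert[OF de(1)] h])
  moreover have "\<H> (JF E) p = J p (E p) - d" by (rule hor_proj_eq[where X = "JF E", OF D1_vert[OF de(1)] h])
  ultimately show "\<V> (JF E) p \<in> D1 p \<and> \<H> (JF E) p \<in> JD2 p" using de e by simp
qed

lemma projections_vertical: "(\<And>p. X p \<in> vert p) \<Longrightarrow> \<V> X = X" "(\<And>p. X p \<in> vert p) \<Longrightarrow> \<H> X = 0"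
  using vert_proj_eq[of "X p" p X for p] hor_proj_eq[of "X p" p X for p] subspace_0[OF subspace_hor]
  by (auto intro!: ext)

lemma projections_horizontal: "(\<And>p. X p \<in> hor p) \<Longrightarrow> \<V> X = 0" "(\<And>p. X p \<in> hor p) \<Longrightarrow> \<H> X = X"
  using vert_proj_eq[of 0 p X for p] hor_proj_eq[of 0 p X for p] subspace_0[OF subspace_vert]
  by (auto intro!: ext)

lemma projections_add:
  assumes X: "X \<in> vector_fields A" and Y: "Y \<in> vector_fields A"
  shows "\<V> (X + Y) = \<V> X + \<V> Y" "\<H> (X + Y) = \<H> X + \<H> Y"
proof -
  have "\<V> (X + Y) p = \<V> X p + \<V> Y p \<and> \<H> (X + Y) p = \<H> X p + \<H> Y p" for p
  proof -
    note P = projections[OF X, of p] and Q = projections[OF Y, of p]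
    have v: "\<V> X p + \<V> Y p \<in> vert p" by (rule subspace_add[OF subspace_vert P(1) Q(1)])
    have sum: "(X + Y) p = (\<V> X p + \<H> X p) + (\<V> Y p + \<H> Y p)"
      by (simp only: P(3) Q(3) plus_fun_apply[of X Y p])
    have eq: "(X + Y) p - (\<V> X p + \<V> Y p) = \<H> X p + \<H> Y p"
      unfolding sum by (rule add_diff_pairs)
    have h: "(X + Y) p - (\<V> X p + \<V> Y p) \<in> hor p"
      unfolding eq by (rule subspace_add[OF subspace_hor P(2) Q(2)])
    show ?thesis
      unfolding vert_proj_eq[where X = "X + Y", OF v h] hor_proj_eq[where X = "X + Y", OF v h] eq by simp
  qed
  then show "\<V> (X + Y) = \<V> X + \<V> Y" "\<H> (X + Y) = \<H> X + \<H> Y" by (auto intro!: ext)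
qed

lemma oneill_T_vertical:
  assumes X: "X \<in> sections_of A vert" and G: "G \<in> vector_fields A"
  shows "(\<And>p. G p \<in> vert p) \<Longrightarrow> oneill_T A g B F nabla1 X G = \<H> (nabla1 X G)"
    "(\<And>p. G p \<in> hor p) \<Longrightarrow> oneill_T A g B F nabla1 X G = \<V> (nabla1 X G)"
proof -
  have X0: "nabla1 X 0 = 0"
    by (rule connection_on_zero(1)[OF conn1 vertical_fieldD(1)[OF X] dom.vector_field_zero])
  have XV: "\<V> X = X" by (rule projections_vertical(1)[OF vertical_fieldD(2)[OF X]])
  have V0: "\<V> 0 = 0" by (rule projections_vertical(1)) (simp add: subspace_0[OF subspace_vert])
  have H0: "\<H> 0 = 0" by (rule projections_vertical(2)) (simp add: subspace_0[OF subspace_vert])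
  show "oneill_T A g B F nabla1 X G = \<H> (nabla1 X G)" if "\<And>p. G p \<in> vert p"
    unfolding oneill_T_def XV projections_vertical[of G, OF that] X0 V0 by (rule add_0_right)
  show "oneill_T A g B F nabla1 X G = \<V> (nabla1 X G)" if "\<And>p. G p \<in> hor p"
    unfolding oneill_T_def XV projections_horizontal[of G, OF that] X0 H0 by (rule add_0_left)
qed

text \<open>For vertical \<open>X\<close> the tensor \<open>\<T>\<^sub>X\<close> supplies the parts of \<open>\<nabla>\<^sub>X\<close> that cross between the two
  distributions, while \<open>\<nabla>\<close>-hat and \<open>\<H>\<nabla>\<^sub>X\<close> supply those that stay inside.\<close>

lemma covariant_derivative_split:
  assumes X: "X \<in> sections_of A vert" and G: "G \<in> vector_fields A"
  shows "vert_connection A g B F nabla1 X (\<V> G) + oneill_T A g B F nabla1 X (\<H> G) = \<V> (nabla1 X G)"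
    "\<H> (nabla1 X (\<H> G)) + oneill_T A g B F nabla1 X (\<V> G) = \<H> (nabla1 X G)"
proof -
  note XF = vertical_fieldD(1)[OF X]
  note VF = vertical_fieldD(1)[OF vert_proj_smooth[OF G]] and HF = hor_proj_smooth[OF G]
  have "\<V> G + \<H> G = G" by (rule ext) (simp only: plus_fun_apply projections(3)[OF G])
  then have split: "nabla1 X G = nabla1 X (\<V> G) + nabla1 X (\<H> G)"
    using connection_onD(3)[OF conn1 XF VF HF] by simp
  note T = oneill_T_vertical(1)[OF X VF projections(1)[OF G]] oneill_T_vertical(2)[OF X HF projections(2)[OF G]]
  show "vert_connection A g B F nabla1 X (\<V> G) + oneill_T A g B F nabla1 X (\<H> G) = \<V> (nabla1 X G)"
    unfolding vert_connection_def T split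
    by (rule projections_add(1)[OF nabla1_field[OF XF VF] nabla1_field[OF XF HF], symmetric])
  show "\<H> (nabla1 X (\<H> G)) + oneill_T A g B F nabla1 X (\<V> G) = \<H> (nabla1 X G)"
    unfolding T split projections_add(2)[OF nabla1_field[OF XF VF] nabla1_field[OF XF HF]]
    by (rule add.commute)
qed

text \<open>Conditions (a) and (b) for a single field \<open>G\<close>, to be used with \<open>G = Y\<close> and \<open>G = Z\<close>.\<close>

lemma conditions_iff_vertical:
  assumes X: "X \<in> sections_of A vert" and G: "G \<in> vector_fields A"
  shows "(vert_connection A g B F nabla1 X (\<V> (JF G)) + oneill_T A g B F nabla1 X (\<H> (JF G))) p \<in> D1 p \<and>
    (\<H> (nabla1 X (\<H> (JF G))) + oneill_T A g B F nabla1 X (\<V> (JF G))) p \<in> JD2 p \<longleftrightarrow>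
    nabla1 X G p \<in> vert p"
proof -
  note XF = vertical_fieldD(1)[OF X]
  have "nabla1 X (JF G) = JF (nabla1 X G)" by (rule ext) (rule J_parallel[OF XF G])
  then show ?thesis
    unfolding covariant_derivative_split[OF X J_field[OF G]]
    using projections_of_J_iff_vertical[OF nabla1_field[OF XF G]] by simp
qed

end

theorem theorem3p4:
  fixes A1 :: "('m::{t2_space,second_countable_topology}, 'e::{real_inner,heine_borel}) atlas"
    and A2 :: "('n::{t2_space,second_countable_topology}, 'd::{real_inner,heine_borel}) atlas"
    and g1 :: "'m \<Rightarrow> 'm tvec \<Rightarrow> 'm tvec \<Rightarrow> real"
    and g2 :: "'n \<Rightarrow> 'n tvec \<Rightarrow> 'n tvec \<Rightarrow> real"
    and J :: "'m \<Rightarrow> 'm tvec \<Rightarrow> 'm tvec"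
    and nabla1 :: "('m \<Rightarrow> 'm tvec) \<Rightarrow> ('m \<Rightarrow> 'm tvec) \<Rightarrow> ('m \<Rightarrow> 'm tvec)"
    and nabla2 :: "('n \<Rightarrow> 'n tvec) \<Rightarrow> ('n \<Rightarrow> 'n tvec) \<Rightarrow> ('n \<Rightarrow> 'n tvec)"
    and nablaF :: "('m \<Rightarrow> 'm tvec) \<Rightarrow> ('m \<Rightarrow> 'n tvec) \<Rightarrow> ('m \<Rightarrow> 'n tvec)"
    and F :: "'m \<Rightarrow> 'n"
    and D1 :: "'m \<Rightarrow> 'm tvec set"
  assumes "smooth_atlas A1" and "smooth_atlas A2"
    and "riemannian_metric A1 g1" and "levi_civita A1 g1 nabla1"
    and "kaehler A1 g1 nabla1 J"
    and "riemannian_metric A2 g2" and "levi_civita A2 g2 nabla2"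
    and "pullback_connection A1 A2 F nabla2 nablaF"
    and "semi_invariant_submersion A1 g1 J A2 g2 F D1"
  defines "\<V> \<equiv> vert_proj A1 g1 A2 F"
    and "\<H> \<equiv> hor_proj A1 g1 A2 F"
    and "T \<equiv> oneill_T A1 g1 A2 F nabla1"
    and "hatnabla \<equiv> vert_connection A1 g1 A2 F nabla1"
    and "\<phi> \<equiv> phi_part A1 g1 J A2 F D1"
    and "\<omega> \<equiv> omega_part A1 g1 J A2 F D1"
    and "\<B> \<equiv> B_part A1 g1 J A2 F D1"
    and "\<C> \<equiv> C_part A1 g1 J A2 F D1"
    and "JD2 \<equiv> JD2_of A1 g1 J A2 F D1"
  shows "totally_geodesic_map A1 A2 F nabla1 nablaF \<longleftrightarrow>
    (\<forall>X\<in>sections_of A1 (ker_dist A1 A2 F).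
     \<forall>Y\<in>sections_of A1 (ker_dist A1 A2 F).
     \<forall>Z\<in>basic_fields A1 g1 A2 F. \<forall>p.
       ((hatnabla X (\<phi> Y) + T X (\<omega> Y)) p \<in> D1 p \<and>
        (hatnabla X (\<B> Z) + T X (\<C> Z)) p \<in> D1 p) \<and>
       ((\<H> (nabla1 X (\<omega> Y)) + T X (\<phi> Y)) p \<in> JD2 p \<and>
        (T X (\<B> Z) + \<H> (nabla1 X (\<C> Z))) p \<in> JD2 p))"
proof -
  have "riemannian_submersion A1 g1 A2 g2 F"
    using assms(9) unfolding semi_invariant_submersion_def by (rule conjunct1)
  then interpret semi_invariant_kaehler A1 g1 A2 g2 F nabla1 nabla2 nablaF J D1
    using assms(1-9) by unfold_locales
  have "((hatnabla X (\<phi> Y) + T X (\<omega> Y)) p \<in> D1 p \<and> (hatnabla X (\<B> Z) + T X (\<C> Z)) p \<in> D1 p) \<and>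
       ((\<H> (nabla1 X (\<omega> Y)) + T X (\<phi> Y)) p \<in> JD2 p \<and> (T X (\<B> Z) + \<H> (nabla1 X (\<C> Z))) p \<in> JD2 p)
       \<longleftrightarrow> nabla1 X Y p \<in> vert p \<and> nabla1 X Z p \<in> vert p"
    if X: "X \<in> sections_of A1 vert" and Y: "Y \<in> sections_of A1 vert" and Z: "Z \<in> basic_fields A1 g1 A2 F"
    for X Y Z p
  proof -
    have comm: "T X (\<B> Z) + \<H> (nabla1 X (\<C> Z)) = \<H> (nabla1 X (\<C> Z)) + T X (\<B> Z)"
      by (rule add.commute)
    show ?thesis
      unfolding comm
      unfolding \<H>_def T_def hatnabla_def \<phi>_def \<omega>_def \<B>_def \<C>_def JD2_def
        phi_omega_eq[OF Y] B_C_eq[OF basic_fieldD(1)[OF Z] basic_fieldD(2)[OF Z]]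
      using conditions_iff_vertical[OF X vertical_fieldD(1)[OF Y], of p]
        conditions_iff_vertical[OF X basic_fieldD(1)[OF Z], of p]
      by argo
  qed
  then show ?thesis unfolding totally_geodesic_iff_vertical by (simp cong: ball_cong)
qed

end
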